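(* Let $f\in H^2(\mathbb{B})$. Then the following are equivalent: (i) $f$ is inner; (ii) for all $k\in\mathbb{N}$, $\langle q^k\ast f,f\rangle=\delta_k(0)$; (iii) there exists $I\in\mathbb{S}$ such that, for all $k\in\mathbb{N}$, $\langle q^k\ast f,f\rangle_I=\delta_k(0)$.
   Context: $\mathbb{H}$ is the skew field of quaternions, $\mathbb{B}=\{q\in\mathbb{H}:|q|<1\}$, $\mathbb{S}=\{q\in\mathbb{H}:q^2=-1\}$; for $I\in\mathbb{S}$, $L_I=\mathbb{R}+\mathbb{R}I\cong\mathbb{C}$ and $\mathbb{B}_I=\mathbb{B}\cap L_I$. $\mathbb{N}$ includes $0$. A function $f:\mathbb{B}\to\mathbb{H}$ is slice regular if, for every $I\in\mathbb{S}$, its restriction $f_I$ to $\mathbb{B}_I$ has continuous partial derivatives and $\frac12(\partial_x+I\partial_y)f_I(x+yI)=0$; equivalently $f(q)=\sum_{n\ge0}q^na_n$ on $\mathbb{B}$ with $a_n\in\mathbb{H}$. $H^2(\mathbb{B})$ is the space of slice regular functions $f(q)=\sum_{n\ge0}q^na_n$ with $(a_n)\in\ell^2(\mathbb{N},\mathbb{H})$, a right quaternionic Hilbert space with inner product $\langle\sum q^na_n,\sum q^nb_n\rangle=\sum_{n\ge0}\overline{b_n}a_n$. $H^\infty(\mathbb{B})\subseteq H^2(\mathbb{B})$ is the space of bounded slice regular functions on $\mathbb{B}$. The boundary $\partial\mathbb{B}=\{e^{tI}=\cos t+\sin t\,I:I\in\mathbb{S},t\in\mathbb{R}\}$ carries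 the measure $d\Sigma(e^{tI})=d\sigma(I)\,dt$, with $dt$ Lebesgue measure on $[0,2\pi)$ and $d\sigma$ the standard area element of $\mathbb{S}$, normalized so that $\Sigma(\partial\mathbb{B})=1$. Every $f\in H^2(\mathbb{B})$ has boundary values $\Sigma$-a.e. on $\partial\mathbb{B}$ (and a.e. on each circle $\partial\mathbb{B}_I$), given by radial limits and still denoted $f$. For $I\in\mathbb{S}$, $$\langle f,g\rangle_I=\frac1{2\pi}\int_0^{2\pi}\overline{g(e^{\theta I})}f(e^{\theta I})\,d\theta .$$ A function $\varphi\in H^\infty(\mathbb{B})$ is inner if $|\varphi(q)|\le1$ on $\mathbb{B}$ and $|\varphi(q)|=1$ for $\Sigma$-a.e. $q\in\partial\mathbb{B}$. The $\ast$-product of $f=\sum q^na_n$ and $g=\sum q^nb_n$ is $f\ast g(q)=\sum_{n\ge0}q^n\sum_{k=0}^na_kb_{n-k}$; in particular $q^k\ast f(q)=\sum_{n\ge0}q^{n+k}a_n$. $\delta_k(j)$ is the Kronecker delta ($1$ if $j=k$, $0$ otherwise). *)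

theory Defs
  imports "HOL-Analysis.Analysis"
begin

section \<open>The skew field of quaternions\<close>

codatatype quat = Quat (qre: real) (qi: real) (qj: real) (qk: real)

lemma quat_eqI [intro?]:
  "\<lbrakk>qre x = qre y; qi x = qi y; qj x = qj y; qk x = qk y\<rbrakk> \<Longrightarrow> x = y"
  by (rule quat.expand) simp

lemma quat_eq_iff: "x = y \<longleftrightarrow> qre x = qre y \<and> qi x = qi y \<and> qj x = qj y \<and> qk x = qk y"
  by (auto intro: quat.expand)

instantiation quat :: ring_1
begin

primcorec zero_quat where
  "qre 0 = 0" | "qi 0 = 0" | "qj 0 = 0" | "qk 0 = 0"

primcorec one_quat where
  "qre 1 = 1" | "qi 1 = 0" | "qj 1 = 0" | "qk 1 = 0"

primcorec plus_quat where
  "qre (x + y) = qre x + qre y"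
| "qi (x + y) = qi x + qi y"
| "qj (x + y) = qj x + qj y"
| "qk (x + y) = qk x + qk y"

primcorec uminus_quat where
  "qre (- x) = - qre x"
| "qi (- x) = - qi x"
| "qj (- x) = - qj x"
| "qk (- x) = - qk x"

primcorec minus_quat where
  "qre (x - y) = qre x - qre y"
| "qi (x - y) = qi x - qi y"
| "qj (x - y) = qj x - qj y"
| "qk (x - y) = qk x - qk y"

primcorec times_quat where
  "qre (x * y) = qre x * qre y - qi x * qi y - qj x * qj y - qk x * qk y"
| "qi (x * y) = qre x * qi y + qi x * qre y + qj x * qk y - qk x * qj y"
| "qj (x * y) = qre x * qj y - qi x * qk y + qj x * qre y + qk x * qi y"
| "qk (x * y) = qre x * qk y + qi x * qj y - qj x * qi y + qk x * qre y"

instance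
  by standard (simp_all add: quat_eq_iff algebra_simps)

end

primcorec qconj :: "quat \<Rightarrow> quat" where
  "qre (qconj x) = qre x"
| "qi (qconj x) = - qi x"
| "qj (qconj x) = - qj x"
| "qk (qconj x) = - qk x"

instantiation quat :: real_vector
begin

primcorec scaleR_quat where
  "qre (scaleR r x) = r * qre x"
| "qi (scaleR r x) = r * qi x"
| "qj (scaleR r x) = r * qj x"
| "qk (scaleR r x) = r * qk x"

instance
  by standard (simp_all add: quat_eq_iff algebra_simps)

end

instance quat :: real_algebra_1
  by standard (simp_all add: quat_eq_iff algebra_simps)

lemma quat_sum_squares_eq_0_iff:
  "qre x * qre x + qi x * qi x + qj x * qj x + qk x * qk x = 0 \<longleftrightarrow> x = 0"
  by (simp add: quat_eq_iff add_nonneg_eq_0_iff)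

instantiation quat :: real_inner
begin

definition inner_quat :: "quat \<Rightarrow> quat \<Rightarrow> real" where
  "inner_quat x y = qre x * qre y + qi x * qi y + qj x * qj y + qk x * qk y"

definition norm_quat :: "quat \<Rightarrow> real" where
  "norm_quat x = sqrt (inner x x)"

definition sgn_quat :: "quat \<Rightarrow> quat" where
  "sgn_quat x = x /\<^sub>R norm x"

definition dist_quat :: "quat \<Rightarrow> quat \<Rightarrow> real" where
  "dist_quat x y = norm (x - y)"

definition uniformity_quat :: "(quat \<times> quat) filter" where
  "uniformity_quat = (INF e\<in>{0 <..}. principal {(x, y). dist x y < e})"

definition open_quat :: "quat set \<Rightarrow> bool" where
  "open_quat U \<longleftrightarrow> (\<forall>x\<in>U. \<forall>\<^sub>F (x', y) in uniformity. x' = x \<longrightarrow> y \<in> U)"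

instance
proof
  fix x y z :: quat and r :: real and U :: "quat set"
  show "inner x y = inner y x" "inner (x + y) z = inner x z + inner y z"
    "inner (r *\<^sub>R x) y = r * inner x y"
    by (simp_all add: inner_quat_def algebra_simps)
  show "0 \<le> inner x x" by (simp add: inner_quat_def)
  show "inner x x = 0 \<longleftrightarrow> x = 0" 
    unfolding inner_quat_def by (rule quat_sum_squares_eq_0_iff)
qed (fact norm_quat_def sgn_quat_def dist_quat_def uniformity_quat_def open_quat_def)+

end

instantiation quat :: inverse
begin

definition inverse_quat :: "quat \<Rightarrow> quat" where
  "inverse_quat x = qconj x /\<^sub>R inner x x"

definition divide_quat :: "quat \<Rightarrow> quat \<Rightarrow> quat" where
  "divide_quat x y = x * inverse y"

instance ..

end

lemma quat_inner_mult: "inner (x * y) (x * y) = inner x x * inner y (y :: quat)"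
proof -
  have "(a*e - b*f - c*g - d*h) * (a*e - b*f - c*g - d*h) + (a*f + b*e + c*h - d*g) * (a*f + b*e + c*h - d*g)
      + (a*g - b*h + c*e + d*f) * (a*g - b*h + c*e + d*f) + (a*h + b*g - c*f + d*e) * (a*h + b*g - c*f + d*e)
      = (a*a + b*b + c*c + d*d) * (e*e + f*f + g*g + h*h)" for a b c d e f g h :: real
    by algebra
  then show ?thesis by (simp only: inner_quat_def times_quat.sel)
qed

instance quat :: real_normed_div_algebra
proof
  fix x y :: quat
  have 1: "qconj x * x = inner x x *\<^sub>R 1" "x * qconj x = inner x x *\<^sub>R 1"
    by (simp_all add: quat_eq_iff inner_quat_def algebra_simps)
  show "x \<noteq> 0 \<Longrightarrow> inverse x * x = 1" "x \<noteq> 0 \<Longrightarrow> x * inverse x = 1"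
    by (simp_all add: inverse_quat_def 1)
  show "x / y = x * inverse y" by (rule divide_quat_def)
  show "inverse (0 :: quat) = 0" by (simp add: inverse_quat_def quat_eq_iff)
  show "norm (x * y) = norm x * norm y"
    by (simp only: norm_quat_def real_sqrt_mult [symmetric] quat_inner_mult)
qed

instantiation quat :: euclidean_space
begin

definition Basis_quat :: "quat set" where
  "Basis_quat = {Quat 1 0 0 0, Quat 0 1 0 0, Quat 0 0 1 0, Quat 0 0 0 1}"

instance
proof
  fix x u v :: quat
  show "(Basis :: quat set) \<noteq> {}" "finite (Basis :: quat set)"
    by (simp_all add: Basis_quat_def)
  show "u \<in> Basis \<Longrightarrow> v \<in> Basis \<Longrightarrow> inner u v = (if u = v then 1 else 0)"
    unfolding Basis_quat_def insert_iff empty_iff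
    by (elim disjE FalseE) (simp_all add: inner_quat_def)
  show "(\<forall>u\<in>Basis. inner x u = 0) \<longleftrightarrow> x = 0"
    unfolding Basis_quat_def quat_eq_iff [of x] by (simp add: inner_quat_def)
qed

end


section \<open>Slice regular functions\<close>

text \<open>
  A function on the open unit ball \<open>ball 0 1\<close> is represented by a total function on \<^typ>\<open>quat\<close>;
  every notion below depends only on its values on the ball.
\<close>

definition imag_units :: "quat set" where
  "imag_units = {q. q\<^sup>2 = - 1}"

lemma imag_units_iff: "I \<in> imag_units \<longleftrightarrow> qre I = 0 \<and> norm I = 1"
proof -
  have "I\<^sup>2 = - 1 \<longleftrightarrow> qre I = 0 \<and> qi I * qi I + qj I * qj I + qk I * qk I = 1" (is "?L \<longleftrightarrow> ?R")
  proof
    assume ?L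
    then have eqs: "qre I * qre I - qi I * qi I - qj I * qj I - qk I * qk I = - 1"
      "qre I * qi I = 0" "qre I * qj I = 0" "qre I * qk I = 0"
      by (simp_all add: power2_eq_square quat_eq_iff algebra_simps)
    have "qre I = 0"
    proof (rule ccontr)
      assume "qre I \<noteq> 0"
      with eqs have "qre I * qre I = - 1" by simp
      with zero_le_square[of "qre I"] show False by linarith
    qed
    with eqs show ?R by simp
  qed (simp add: power2_eq_square quat_eq_iff algebra_simps)
  then show ?thesis
    by (auto simp: imag_units_def norm_quat_def inner_quat_def)
qed

definition slice_point :: "quat \<Rightarrow> real \<times> real \<Rightarrow> quat" where
  "slice_point I = (\<lambda>(x, y). of_real x + of_real y * I)"

definition slice_regular :: "(quat \<Rightarrow> quat) \<Rightarrow> bool" where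
  "slice_regular f \<longleftrightarrow> (\<forall>I\<in>imag_units. \<exists>fx fy :: real \<times> real \<Rightarrow> quat.
     continuous_on {p. slice_point I p \<in> ball 0 1} fx \<and>
     continuous_on {p. slice_point I p \<in> ball 0 1} fy \<and>
     (\<forall>x y. slice_point I (x, y) \<in> ball 0 1 \<longrightarrow>
        ((\<lambda>s. f (slice_point I (s, y))) has_vector_derivative fx (x, y)) (at x) \<and>
        ((\<lambda>t. f (slice_point I (x, t))) has_vector_derivative fy (x, y)) (at y) \<and>
        (1 / 2) *\<^sub>R (fx (x, y) + I * fy (x, y)) = 0))"

definition has_slice_coeffs :: "(quat \<Rightarrow> quat) \<Rightarrow> (nat \<Rightarrow> quat) \<Rightarrow> bool" where
  "has_slice_coeffs f a \<longleftrightarrow> (\<forall>q\<in>ball 0 1. (\<lambda>n. q ^ n * a n) sums f q)"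

definition slice_coeff :: "(quat \<Rightarrow> quat) \<Rightarrow> nat \<Rightarrow> quat" where
  "slice_coeff f = (THE a. has_slice_coeffs f a)"

lemma powser_coeffs_0:
  fixes c :: "nat \<Rightarrow> real"
  assumes "\<And>x. norm x < 1 \<Longrightarrow> (\<lambda>n. c n * x ^ n) sums 0"
  shows "c n = 0"
  using assms
proof (induction n arbitrary: c)
  case (0 c)
  from powser_sums_zero[of c] show ?case using 0[of 0] sums_unique2 by force
next
  case (Suc n c)
  have c0: "c 0 = 0" using powser_sums_zero[of c] Suc.prems[of 0] sums_unique2 by force
  have *: "(\<lambda>n. c (Suc n) * x ^ n) sums 0" if "x \<noteq> 0" "norm x < 1" for x
  proof -
    have "(\<lambda>n. c (Suc n) * x ^ Suc n) sums 0"
      using Suc.prems[OF that(2)] by (subst sums_Suc_iff) (simp add: c0)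
    then have "(\<lambda>n. inverse x * (c (Suc n) * x ^ Suc n)) sums (inverse x * 0)"
      by (rule sums_mult)
    then show ?thesis using that by (simp add: field_simps)
  qed
  have "((\<lambda>_. 0) \<longlongrightarrow> c (Suc 0)) (at (0::real))"
    by (rule powser_limit_0_strong[where s = 1 and a = "\<lambda>n. c (Suc n)"]) (use * in auto)
  then have "c (Suc 0) = 0" by (simp add: tendsto_const_iff)
  then have "(\<lambda>n. c (Suc n) * x ^ n) sums 0" if "norm x < 1" for x
    using * that powser_sums_zero[of "\<lambda>n. c (Suc n)"] by (cases "x = 0") auto
  then show ?case by (rule Suc.IH)
qed

lemma has_slice_coeffs_unique:
  assumes "has_slice_coeffs f a" "has_slice_coeffs f b"
  shows "a = b"
proof (rule ccontr)
  assume "a \<noteq> b"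
  then obtain m where "a m \<noteq> b m" by auto
  then obtain i where i: "i \<in> Basis" and neq: "inner (a m) i \<noteq> inner (b m) i"
    by (metis euclidean_eqI)
  define c where "c = (\<lambda>n. inner (a n - b n) i)"
  have sums: "(\<lambda>n. c n * x ^ n) sums 0" if "norm x < 1" for x :: real
  proof -
    have "(\<lambda>n. of_real x ^ n * a n - of_real x ^ n * b n) sums (f (of_real x) - f (of_real x))"
      using assms that unfolding has_slice_coeffs_def by (intro sums_diff) auto
    then have "(\<lambda>n. inner (of_real x ^ n * a n - of_real x ^ n * b n) i) sums inner 0 i"
      using bounded_linear.sums[OF bounded_linear_inner_left] by fastforce
    moreover have "inner (of_real x ^ n * a n - of_real x ^ n * b n) i = c n * x ^ n" for n
      by (simp add: c_def inner_diff_left of_real_def algebra_simps flip: of_real_power)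
    ultimately show ?thesis by simp
  qed
  have "c m \<noteq> 0" using neq by (simp add: c_def inner_diff_left)
  then show False
    using powser_coeffs_0[OF sums] by simp
qed

lemma slice_coeff_eq: "has_slice_coeffs f a \<Longrightarrow> slice_coeff f = a"
  unfolding slice_coeff_def by (blast intro: has_slice_coeffs_unique)

definition star_prod :: "(quat \<Rightarrow> quat) \<Rightarrow> (quat \<Rightarrow> quat) \<Rightarrow> quat \<Rightarrow> quat"  (infixl \<open>\<star>\<close> 70) where
  "f \<star> g = (\<lambda>q. \<Sum>n. q ^ n * (\<Sum>k\<le>n. slice_coeff f k * slice_coeff g (n - k)))"


section \<open>Hardy spaces\<close>

definition hardy2 :: "(quat \<Rightarrow> quat) set" where
  "hardy2 = {f. slice_regular f \<and>
     (\<exists>a. has_slice_coeffs f a \<and> summable (\<lambda>n. (norm (a n))\<^sup>2))}"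

definition hardy_inf :: "(quat \<Rightarrow> quat) set" where
  "hardy_inf = {f. slice_regular f \<and> bounded (f ` ball 0 1)}"

definition hardy_inner :: "(quat \<Rightarrow> quat) \<Rightarrow> (quat \<Rightarrow> quat) \<Rightarrow> quat" where
  "hardy_inner f g = (\<Sum>n. qconj (slice_coeff g n) * slice_coeff f n)"

text \<open>
  The radial limit of \<open>f\<close> at \<open>q\<close>. \<^const>\<open>Lim\<close> is unspecified where the limit does not exist; for
  \<open>f \<in> hardy2\<close> this concerns only a null set of boundary points, on each circle and on the sphere.
\<close>

definition boundary_value :: "(quat \<Rightarrow> quat) \<Rightarrow> quat \<Rightarrow> quat" where
  "boundary_value f q = Lim (at_left 1) (\<lambda>r. f (r *\<^sub>R q))"

definition unit_exp :: "quat \<Rightarrow> real \<Rightarrow> quat" where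
  "unit_exp I t = of_real (cos t) + of_real (sin t) * I"

lemma norm_unit_exp: "I \<in> imag_units \<Longrightarrow> norm (unit_exp I t) = 1"
proof -
  assume "I \<in> imag_units"
  then have I: "qre I = 0" "inner I I = 1" by (simp_all add: imag_units_iff norm_eq_1)
  have "inner (unit_exp I t) (unit_exp I t) = (cos t)\<^sup>2 + (sin t)\<^sup>2 * inner I I"
    by (simp add: unit_exp_def inner_quat_def of_real_def I(1) power2_eq_square algebra_simps)
  then show ?thesis by (simp add: norm_eq_1 I(2))
qed

definition slice_inner :: "quat \<Rightarrow> (quat \<Rightarrow> quat) \<Rightarrow> (quat \<Rightarrow> quat) \<Rightarrow> quat" where
  "slice_inner I f g = (1 / (2 * pi)) *\<^sub>R
     (LINT \<theta>:{0..2 * pi}|lebesgue.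
        qconj (boundary_value g (unit_exp I \<theta>)) * boundary_value f (unit_exp I \<theta>))"


section \<open>The measure on the boundary of the ball and inner functions\<close>

definition sphere_coords :: "real \<times> real \<Rightarrow> quat" where
  "sphere_coords = (\<lambda>(\<phi>, \<theta>). Quat 0 (sin \<phi> * cos \<theta>) (sin \<phi> * sin \<theta>) (cos \<phi>))"

text \<open>
  The area measure of the 2-sphere \<^const>\<open>imag_units\<close>, in spherical coordinates (colatitude
  \<open>\<phi>\<close>, longitude \<open>\<theta>\<close>), in which the area element is \<open>sin \<phi> d\<phi> d\<theta>\<close>. It is a Borel
  measure on \<^typ>\<open>quat\<close> concentrated on \<^const>\<open>imag_units\<close>.
\<close>

definition sphere_area :: "quat measure" where
  "sphere_area = distr
     (density (restrict_space lborel ({0..pi} \<times> {0..<2 * pi})) (\<lambda>(\<phi>, \<theta>). ennreal (sin \<phi>)))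
     borel sphere_coords"

text \<open>
  The factor normalizes the total mass \<open>4\<pi> \<cdot> 2\<pi>\<close> to 1 (see \<open>emeasure_boundary_measure\<close> below).
\<close>

definition boundary_measure :: "quat measure" where
  "boundary_measure = scale_measure (ennreal (1 / (8 * pi\<^sup>2)))
     (distr (sphere_area \<Otimes>\<^sub>M restrict_space lborel {0..<2 * pi}) borel (\<lambda>(I, t). unit_exp I t))"

lemma borel_measurable_quat_iff:
  fixes g :: "'a \<Rightarrow> quat"
  shows "g \<in> borel_measurable M \<longleftrightarrow>
    (\<lambda>x. qre (g x)) \<in> borel_measurable M \<and> (\<lambda>x. qi (g x)) \<in> borel_measurable M \<and>
    (\<lambda>x. qj (g x)) \<in> borel_measurable M \<and> (\<lambda>x. qk (g x)) \<in> borel_measurable M"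
  by (subst borel_measurable_euclidean_space) (simp add: Basis_quat_def inner_quat_def)

lemma measurable_sphere_coords [measurable]: "sphere_coords \<in> borel_measurable (borel \<Otimes>\<^sub>M borel)"
  by (subst borel_measurable_quat_iff) (simp add: sphere_coords_def split_beta)

lemma measurable_unit_exp [measurable]: "(\<lambda>(I, t). unit_exp I t) \<in> borel_measurable (borel \<Otimes>\<^sub>M borel)"
  by (simp add: unit_exp_def split_beta)

lemma sphere_coords_in_imag_units: "sphere_coords p \<in> imag_units"
proof -
  obtain \<phi> \<theta> where p: "p = (\<phi>, \<theta>)" by force
  have "(sin \<phi> * cos \<theta>)\<^sup>2 + (sin \<phi> * sin \<theta>)\<^sup>2 + (cos \<phi>)\<^sup>2
      = (sin \<phi>)\<^sup>2 * ((sin \<theta>)\<^sup>2 + (cos \<theta>)\<^sup>2) + (cos \<phi>)\<^sup>2"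
    by algebra
  also have "\<dots> = 1" by simp
  finally show ?thesis
    by (simp add: p imag_units_iff sphere_coords_def norm_quat_def inner_quat_def power2_eq_square)
qed

lemma space_sphere_area [simp]: "space sphere_area = UNIV"
  and sets_sphere_area [simp, measurable_cong]: "sets sphere_area = sets borel"
  by (simp_all add: sphere_area_def)

lemma emeasure_sphere_area: "emeasure sphere_area UNIV = ennreal (4 * pi)"
proof -
  have [measurable]: "{0..pi} \<times> {0..<2 * pi} \<in> sets (borel :: (real \<times> real) measure)"
    by (simp add: borel_Times)
  have coords [measurable]: "sphere_coords \<in> borel_measurable borel"
    using measurable_sphere_coords by (simp add: borel_prod)
  have "(\<lambda>p. ennreal (sin (fst p))) \<in> borel_measurable (borel \<Otimes>\<^sub>M (borel :: real measure))"
    by measurable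
  then have dens [measurable]: "(\<lambda>p::real \<times> real. ennreal (sin (fst p))) \<in> borel_measurable borel"
    by (simp add: borel_prod)
  have m: "(\<lambda>p. ennreal (sin (fst p)) * indicator ({0..pi} \<times> {0..<2 * pi}) p) \<in> borel_measurable borel"
    by measurable
  have "emeasure sphere_area UNIV =
    (\<integral>\<^sup>+p. ennreal (sin (fst p)) \<partial>restrict_space lborel ({0..pi} \<times> {0..<2 * pi}))"
    unfolding sphere_area_def split_beta
    by (subst emeasure_distr)
       (auto simp: emeasure_density space_restrict_space measurable_restrict_space1
             sets_restrict_space_iff intro!: nn_integral_cong)
  also have "\<dots> = (\<integral>\<^sup>+p. ennreal (sin (fst p)) * indicator ({0..pi} \<times> {0..<2 * pi}) p \<partial>lborel)"
    by (subst nn_integral_restrict_space) auto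
  also have "\<dots> = (\<integral>\<^sup>+x. \<integral>\<^sup>+y. ennreal (sin x) * indicator {0..pi} x * indicator {0..<2 * pi} y \<partial>lborel \<partial>(lborel::real measure))"
    unfolding lborel_prod [symmetric]
    by (subst lborel.nn_integral_fst [symmetric]) (use m [unfolded indicator_times] in \<open>simp_all add: borel_prod lborel_prod indicator_times mult.assoc\<close>)
  also have "\<dots> = (\<integral>\<^sup>+x. ennreal (sin x) * indicator {0..pi} x \<partial>lborel) * ennreal (2 * pi)"
    by (simp add: nn_integral_cmult nn_integral_multc)
  also have "(\<integral>\<^sup>+x. ennreal (sin x) * indicator {0..pi} x \<partial>lborel) = ennreal (- cos pi - - cos 0)"
    by (rule nn_integral_FTC_Icc) (auto intro!: derivative_eq_intros sin_ge_zero)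
  finally show ?thesis by (simp flip: ennreal_mult ennreal_numeral)
qed

lemma emeasure_boundary_measure: "emeasure boundary_measure UNIV = 1"
proof -
  interpret sphere_area: finite_measure sphere_area
    by standard (simp add: emeasure_sphere_area)
  define T where "T = restrict_space lborel {0..<2 * pi}"
  have T: "emeasure T {0..<2 * pi} = ennreal (2 * pi)" "space T = {0..<2 * pi}"
    by (simp_all add: T_def emeasure_restrict_space)
  interpret T: finite_measure T by standard (simp add: T)
  have [measurable]: "(\<lambda>t. t) \<in> borel_measurable T"
    unfolding T_def by (intro measurable_restrict_space1) simp
  have [measurable]: "(\<lambda>(I, t). unit_exp I t) \<in> borel_measurable (sphere_area \<Otimes>\<^sub>M T)"
    unfolding unit_exp_def split_beta by measurable
  have "emeasure (distr (sphere_area \<Otimes>\<^sub>M T) borel (\<lambda>(I, t). unit_exp I t)) UNIV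
      = emeasure (sphere_area \<Otimes>\<^sub>M T) (UNIV \<times> {0..<2 * pi})"
    by (subst emeasure_distr) (auto simp: space_pair_measure T)
  also have "\<dots> = ennreal (4 * pi) * ennreal (2 * pi)"
    using sets.top [of T] by (subst T.emeasure_pair_measure_Times) (simp_all add: T emeasure_sphere_area)
  finally show ?thesis
    unfolding boundary_measure_def T_def [symmetric]
    by (simp add: power2_eq_square flip: ennreal_mult)
qed

definition inner_function :: "(quat \<Rightarrow> quat) \<Rightarrow> bool" where
  "inner_function f \<longleftrightarrow> f \<in> hardy_inf \<and> (\<forall>q\<in>ball 0 1. norm (f q) \<le> 1) \<and>
     (AE q in boundary_measure. norm (boundary_value f q) = 1)"

end

theory Submission
  imports Defs
begin

text \<open>
  Let \<open>a\<close> be the coefficient sequence of \<open>f\<close> and put \<open>A k = (\<Sum>n. qconj (a (n + k)) * a n)\<close>. The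
  coefficients of \<open>q\<^sup>k \<star> f\<close> are those of \<open>f\<close> shifted by \<open>k\<close>, so \<open>A k\<close> is the Hardy inner product of
  \<open>q\<^sup>k \<star> f\<close> with \<open>f\<close>. Both equivalences are obtained by computing \<open>A k\<close> from boundary values.

  On the slice of \<open>J\<close> the value at the point with modulus \<open>r\<close> and angle \<open>t\<close> is
  \<open>cos_part a r t + J * sin_part a r t\<close>. Both parts have radial limits \<open>b t\<close> and \<open>c t\<close> for almost
  every \<open>t\<close>, so \<open>f\<close> has the boundary value \<open>b t + J * c t\<close> at \<open>unit_exp J t\<close> for all \<open>J\<close>
  simultaneously (\<open>AE_radial_limit_parts\<close>). Existence of the limits is Fatou's theorem for square
  summable coefficients (\<open>AE_radial_limit\<close>): the partial sums of the boundary series converge in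
  \<open>L\<^sup>1\<close> to some \<open>g\<close>, the symmetric means of \<open>g\<close> converge almost everywhere by Lebesgue's
  differentiation theorem, and convergence of the symmetric means implies Abel summability
  (\<open>abel_sum_of_lebesgue_sum\<close>). By Parseval's identity and Fatou's lemma the Abel means also
  converge in mean square, which yields
  \<open>1 / (2 * pi) * \<integral> qconj F * unit_exp I (k * t) * F = A k\<close> for the boundary function
  \<open>F = b + I * c\<close> on each slice (\<open>integral_limit_sandwich\<close>). Since the integrand is the one in the
  slice inner product, the conditions on the Hardy and on the slice inner products coincide, for
  every single slice.

  For inner functions the difficulty is that \<open>qconj F * unit_exp I (k * t) * F\<close> is not determined by
  the modulus of \<open>F\<close>. Averaging over \<open>I\<close> and \<open>- I\<close> gives, with \<open>U = norm b\<^sup>2 + norm c\<^sup>2\<close> and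
  \<open>V = qconj c * b - qconj b * c\<close>, the formula
  \<open>pi * A k = \<integral> cos (k * t) * U t + sin (k * t) * V t\<close> over \<open>[0, pi]\<close>. By uniqueness of Fourier
  coefficients, \<open>A k\<close> is the Kronecker delta if and only if \<open>U = 1\<close> and \<open>V = 0\<close> almost everywhere
  (\<open>orthonormal_iff_unimodular\<close>). On the other hand \<open>norm (b + J * c) = 1\<close> for all \<open>J\<close> means that
  \<open>U = 1\<close> and that \<open>c * qconj b\<close> is real. The latter is equivalent to \<open>V = 0\<close>, that is, to
  \<open>qconj c * b\<close> being real, because the two products have the same norm and the same real part
  (\<open>self_conj_swap\<close>). Fubini's theorem translates the statement for almost all spheres into the one for
  almost all boundary points. Finally, orthonormality of the shifts bounds \<open>f\<close> by 1 on the ball,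
  because it makes the \<open>\<star>\<close>-multiplication by \<open>f\<close> isometric (\<open>norm_le_1_if_orthonormal\<close>).
\<close>

section \<open>Quaternionic preliminaries\<close>

lemma qconj_add: "qconj (x + y) = qconj x + qconj y"
  and qconj_diff: "qconj (x - y) = qconj x - qconj y"
  and qconj_minus: "qconj (- x) = - qconj x"
  and qconj_scaleR: "qconj (r *\<^sub>R x) = r *\<^sub>R qconj x"
  and qconj_mult: "qconj (x * y) = qconj y * qconj x"
  and qconj_qconj [simp]: "qconj (qconj x) = x"
  and qconj_0 [simp]: "qconj 0 = 0"
  and qconj_1 [simp]: "qconj 1 = 1"
  and qconj_of_real [simp]: "qconj (of_real r) = of_real r"
  by (simp_all add: quat_eq_iff of_real_def algebra_simps)

lemma norm_qconj [simp]: "norm (qconj x) = norm x"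
  by (simp add: norm_quat_def inner_quat_def)

lemma bounded_linear_qconj: "bounded_linear qconj"
  by (rule bounded_linear_intro[where K = 1]) (simp_all add: qconj_add qconj_scaleR)

lemma continuous_on_qconj [continuous_intros]:
  "continuous_on A g \<Longrightarrow> continuous_on A (\<lambda>x. qconj (g x))"
  by (rule bounded_linear.continuous_on[OF bounded_linear_qconj])

lemma measurable_qconj [measurable]: "qconj \<in> borel_measurable borel"
  by (intro borel_measurable_continuous_onI continuous_intros)

lemma tendsto_qconj [tendsto_intros]:
  "(g \<longlongrightarrow> l) G \<Longrightarrow> ((\<lambda>x. qconj (g x)) \<longlongrightarrow> qconj l) G"
  by (rule bounded_linear.tendsto[OF bounded_linear_qconj])

lemma qconj_mult_self: "qconj x * x = of_real ((norm x)\<^sup>2)" "x * qconj x = of_real ((norm x)\<^sup>2)"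
  by (simp_all add: quat_eq_iff of_real_def norm_quat_def inner_quat_def algebra_simps)

lemma imag_units_square: "I \<in> imag_units \<Longrightarrow> I * I = - 1"
  by (simp add: imag_units_def power2_eq_square)

lemma imag_units_qconj: "I \<in> imag_units \<Longrightarrow> qconj I = - I"
  by (simp add: imag_units_iff quat_eq_iff)

lemma imag_units_uminus: "I \<in> imag_units \<Longrightarrow> - I \<in> imag_units"
  by (simp add: imag_units_def)

lemma of_real_quat_commute: "of_real r * (x::quat) = x * of_real r"
  by (simp add: of_real_def)

lemma unit_exp_mult:
  assumes "I \<in> imag_units"
  shows "unit_exp I s * unit_exp I t = unit_exp I (s + t)"
proof -
  have "unit_exp I s * unit_exp I t
      = of_real (cos s * cos t) + (cos s * sin t) *\<^sub>R I + (sin s * cos t) *\<^sub>R I + (sin s * sin t) *\<^sub>R (I * I)"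
    by (simp add: unit_exp_def of_real_def algebra_simps)
  also have "\<dots> = unit_exp I (s + t)"
    by (simp add: unit_exp_def of_real_def imag_units_square[OF assms] cos_add sin_add algebra_simps)
  finally show ?thesis .
qed

lemma unit_exp_0 [simp]: "unit_exp I 0 = 1"
  by (simp add: unit_exp_def)

lemma unit_exp_power: "I \<in> imag_units \<Longrightarrow> unit_exp I t ^ n = unit_exp I (real n * t)"
  by (induction n) (simp_all add: unit_exp_mult algebra_simps)

lemma qconj_unit_exp: "I \<in> imag_units \<Longrightarrow> qconj (unit_exp I t) = unit_exp I (- t)"
  by (simp add: unit_exp_def qconj_add qconj_mult imag_units_qconj of_real_quat_commute)

lemma continuous_on_unit_exp [continuous_intros]:
  fixes g :: "'a::t2_space \<Rightarrow> real"
  shows "continuous_on A g \<Longrightarrow> continuous_on A (\<lambda>x. unit_exp I (g x))"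
  unfolding unit_exp_def by (intro continuous_intros)

lemma has_vector_derivative_unit_exp:
  assumes "I \<in> imag_units"
  shows "((\<lambda>t. unit_exp I (k * t)) has_vector_derivative k *\<^sub>R (I * unit_exp I (k * t))) (at t within A)"
proof -
  have "((\<lambda>t. cos (k * t) *\<^sub>R 1 + sin (k * t) *\<^sub>R I) has_vector_derivative
      (- sin (k * t) * k) *\<^sub>R 1 + (cos (k * t) * k) *\<^sub>R I) (at t within A)"
    by (auto intro!: derivative_eq_intros simp: field_simps has_real_derivative_iff_has_vector_derivative[symmetric])
  moreover have "(- sin (k * t) * k) *\<^sub>R 1 + (cos (k * t) * k) *\<^sub>R I = k *\<^sub>R (I * unit_exp I (k * t))"
    by (simp add: unit_exp_def of_real_def imag_units_square[OF assms] algebra_simps)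
  moreover have "(\<lambda>t. cos (k * t) *\<^sub>R 1 + sin (k * t) *\<^sub>R I) = (\<lambda>t. unit_exp I (k * t))"
    by (simp add: unit_exp_def of_real_def)
  ultimately show ?thesis by simp
qed


section \<open>Integration over compact intervals\<close>

text \<open>Lebesgue measure on a compact interval.\<close>

abbreviation ivl :: "real \<Rightarrow> real \<Rightarrow> real measure" where
  "ivl a b \<equiv> restrict_space lborel {a..b}"

lemma finite_measure_ivl: "finite_measure (ivl a b)"
  by standard (simp add: emeasure_restrict_space emeasure_lborel_Icc_eq)

lemma integrable_ivl_continuous:
  fixes g :: "real \<Rightarrow> 'a::{banach, second_countable_topology}"
  assumes "continuous_on {a..b} g"
  shows "integrable (ivl a b) g"
  using borel_integrable_atLeastAtMost'[OF assms]
  by (simp add: integrable_restrict_space set_integrable_def)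

lemma integral_ivl_FTC:
  fixes g :: "real \<Rightarrow> 'a::euclidean_space"
  assumes "a \<le> b" "\<And>x. a \<le> x \<Longrightarrow> x \<le> b \<Longrightarrow> (G has_vector_derivative g x) (at x within {a..b})"
    "continuous_on {a..b} g"
  shows "integral\<^sup>L (ivl a b) g = G b - G a"
  using integral_FTC_atLeastAtMost[OF assms] by (simp add: integral_restrict_space)

lemma integral_ivl_const: "a \<le> b \<Longrightarrow> integral\<^sup>L (ivl a b) (\<lambda>_. c) = (b - a) *\<^sub>R (c::'a::euclidean_space)"
  by (subst integral_restrict_space) simp_all

lemma measurable_ivl_continuous:
  fixes g :: "real \<Rightarrow> 'a::{banach, second_countable_topology}"
  shows "continuous_on {a..b} g \<Longrightarrow> g \<in> borel_measurable (ivl a b)"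
  by (rule borel_measurable_integrable[OF integrable_ivl_continuous])

lemma sums_integral_ivl:
  fixes g :: "nat \<Rightarrow> real \<Rightarrow> 'a::euclidean_space"
  assumes cont: "\<And>n. continuous_on {a..b} (g n)"
    and bd: "\<And>n x. x \<in> {a..b} \<Longrightarrow> norm (g n x) \<le> B n" and B: "summable B" and "a \<le> b"
  shows "(\<lambda>n. integral\<^sup>L (ivl a b) (g n)) sums integral\<^sup>L (ivl a b) (\<lambda>x. \<Sum>n. g n x)"
proof (rule sums_integral)
  interpret finite_measure "ivl a b" by (rule finite_measure_ivl)
  show "integrable (ivl a b) (g n)" for n by (rule integrable_ivl_continuous[OF cont])
  show "AE x in ivl a b. summable (\<lambda>n. norm (g n x))"
    by (rule AE_I2) (use bd in \<open>auto intro!: summable_comparison_test'[OF B] simp: space_restrict_space\<close>)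
  have "(\<integral>x. norm (g n x) \<partial>ivl a b) \<le> (\<integral>x. B n \<partial>ivl a b)" for n
    by (intro integral_mono integrable_ivl_continuous continuous_intros cont)
       (use bd in \<open>auto simp: space_restrict_space\<close>)
  then have "norm (\<integral>x. norm (g n x) \<partial>ivl a b) \<le> (b - a) * B n" for n
    unfolding integral_ivl_const[OF \<open>a \<le> b\<close>] by simp
  then show "summable (\<lambda>n. \<integral>x. norm (g n x) \<partial>ivl a b)"
    by (intro summable_comparison_test'[OF summable_mult[OF B]])
qed

lemma continuous_on_suminf_bounded:
  fixes g :: "nat \<Rightarrow> real \<Rightarrow> 'a::banach"
  assumes "\<And>n. continuous_on A (g n)" "\<And>n x. x \<in> A \<Longrightarrow> norm (g n x) \<le> B n" "summable B"
  shows "continuous_on A (\<lambda>x. \<Sum>n. g n x)"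
proof (rule uniform_limit_theorem)
  show "uniform_limit A (\<lambda>n x. \<Sum>i<n. g i x) (\<lambda>x. \<Sum>n. g n x) sequentially"
    by (rule Weierstrass_m_test) (use assms in auto)
qed (auto intro!: always_eventually continuous_intros assms(1))


section \<open>Power series on a circle\<close>

text \<open>The function \<open>q \<mapsto> \<Sum>\<^sub>n q\<^sup>n a\<^sub>n\<close> on the unit circle of the slice of \<open>I\<close>, as a function of the angle.\<close>

definition circle_series :: "quat \<Rightarrow> (nat \<Rightarrow> quat) \<Rightarrow> real \<Rightarrow> quat" where
  "circle_series I a t = (\<Sum>n. unit_exp I (real n * t) * a n)"

text \<open>The coefficients of \<open>q\<^sup>k \<star> f\<close> in terms of those of \<open>f\<close>.\<close>

definition shift_seq :: "nat \<Rightarrow> (nat \<Rightarrow> 'a::zero) \<Rightarrow> nat \<Rightarrow> 'a" where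
  "shift_seq k a n = (if n < k then 0 else a (n - k))"

lemma shift_seq_add [simp]: "shift_seq k a (n + k) = a n"
  by (simp add: shift_seq_def)

lemma summable_shift_seq:
  fixes g :: "'b::zero \<Rightarrow> 'a::real_normed_vector"
  assumes "g 0 = 0"
  shows "summable (\<lambda>n. g (shift_seq k a n)) \<longleftrightarrow> summable (\<lambda>n. g (a n))"
  using summable_iff_shift[of "\<lambda>n. g (shift_seq k a n)" k] by simp

lemma sums_shift_seq:
  fixes h :: "nat \<Rightarrow> 'a::zero \<Rightarrow> 'b::real_normed_vector"
  assumes "\<And>n. h n 0 = 0"
  shows "(\<lambda>n. h n (shift_seq k a n)) sums s \<longleftrightarrow> (\<lambda>n. h (n + k) (a n)) sums s"
  using sums_zero_iff_shift[of k "\<lambda>n. h n (shift_seq k a n)" s] assms by (simp add: shift_seq_def)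

context
  fixes I assumes I: "I \<in> imag_units"
begin

lemma norm_circle_term: "norm (unit_exp I t * c) = norm c"
  by (simp add: norm_mult norm_unit_exp[OF I])

lemma summable_circle_term:
  assumes "summable (\<lambda>n. norm (a n))"
  shows "summable (\<lambda>n. unit_exp I (real n * t) * a n)"
  by (rule summable_norm_cancel) (simp add: norm_circle_term assms)

lemma continuous_on_circle_series:
  assumes "summable (\<lambda>n. norm (a n))"
  shows "continuous_on A (circle_series I a)"
  unfolding circle_series_def
  by (rule continuous_on_suminf_bounded[OF _ _ assms])
     (auto intro!: continuous_intros simp: norm_circle_term)

lemma norm_circle_series_le:
  assumes "summable (\<lambda>n. norm (a n))"
  shows "norm (circle_series I a t) \<le> (\<Sum>n. norm (a n))"
  unfolding circle_series_def
  by (rule order.trans[OF summable_norm]) (simp_all add: norm_circle_term assms)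

text \<open>Shifting the coefficients multiplies from the left, by a number in the slice of \<open>I\<close>.\<close>

lemma circle_series_shift:
  assumes "summable (\<lambda>n. norm (a n))"
  shows "circle_series I (shift_seq k a) t = unit_exp I (real k * t) * circle_series I a t"
proof -
  have "(\<lambda>n. unit_exp I (real k * t) * (unit_exp I (real n * t) * a n)) sums
      (unit_exp I (real k * t) * circle_series I a t)"
    unfolding circle_series_def by (intro sums_mult summable_sums summable_circle_term assms)
  then have "(\<lambda>n. unit_exp I (real (n + k) * t) * a n) sums (unit_exp I (real k * t) * circle_series I a t)"
    by (simp add: mult.assoc[symmetric] unit_exp_mult[OF I] algebra_simps)
  then have "(\<lambda>n. unit_exp I (real n * t) * shift_seq k a n) sums (unit_exp I (real k * t) * circle_series I a t)"
    by (subst sums_shift_seq[where h = "\<lambda>n x. unit_exp I (real n * t) * x"]) simp_all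
  then show ?thesis by (simp add: circle_series_def sums_iff)
qed

lemma integral_unit_exp:
  assumes "k \<in> \<int>"
  shows "integral\<^sup>L (ivl 0 (2 * pi)) (\<lambda>t. unit_exp I (k * t)) = (if k = 0 then of_real (2 * pi) else 0)"
proof (cases "k = 0")
  case True
  then show ?thesis using integral_ivl_const[of 0 "2 * pi" "1::quat"]
    by (simp add: scaleR_conv_of_real del: lebesgue_integral_const)
next
  case False
  obtain m where m: "k = of_int m" using assms by (auto elim: Ints_cases)
  have per: "unit_exp I (k * (2 * pi)) = 1"
    using cos_int_2pin[of m] sin_int_2pin[of m] by (simp add: unit_exp_def m algebra_simps)
  have *: "(-1/k) *\<^sub>R (I * (k *\<^sub>R (I * unit_exp I (k * x)))) = unit_exp I (k * x)" for x
    using False by (simp add: mult.assoc[symmetric] imag_units_square[OF I])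
  have "((\<lambda>t. (- 1 / k) *\<^sub>R (I * unit_exp I (k * t))) has_vector_derivative unit_exp I (k * x)) (at x within A)" for x A
    using has_vector_derivative_scaleR[OF DERIV_const has_vector_derivative_mult_right[OF has_vector_derivative_unit_exp[OF I]], of "-1/k" I k x A]
    unfolding * by simp
  then have "integral\<^sup>L (ivl 0 (2 * pi)) (\<lambda>t. unit_exp I (k * t))
      = (- 1 / k) *\<^sub>R (I * unit_exp I (k * (2 * pi))) - (- 1 / k) *\<^sub>R (I * unit_exp I (k * 0))"
    by (intro integral_ivl_FTC continuous_intros) auto
  then show ?thesis using False by (simp add: per)
qed

text \<open>
  Parseval's identity, polarized, for absolutely convergent series. Conjugation brings the powers
  of the unit exponential next to each other, so the coefficients need not lie in the slice of \<open>I\<close>.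
\<close>

lemma parseval:
  assumes a: "summable (\<lambda>n. norm (a n))" and b: "summable (\<lambda>n. norm (b n))"
  shows "(\<lambda>n. (2 * pi) *\<^sub>R (qconj (a n) * b n)) sums
    integral\<^sup>L (ivl 0 (2 * pi)) (\<lambda>t. qconj (circle_series I a t) * circle_series I b t)"
proof -
  let ?M = "ivl 0 (2 * pi)"
  have mono: "integral\<^sup>L ?M (\<lambda>t. qconj (unit_exp I (real n * t) * a n) * (unit_exp I (real m * t) * b m))
      = (if m = n then (2 * pi) *\<^sub>R (qconj (a n) * b n) else 0)" for n m
  proof -
    have "qconj (unit_exp I (real n * t) * a n) * (unit_exp I (real m * t) * b m)
        = qconj (a n) * unit_exp I ((real m - real n) * t) * b m" for t
    proof -
      have "unit_exp I ((real m - real n) * t) = unit_exp I (- (real n * t)) * unit_exp I (real m * t)"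
        by (simp add: unit_exp_mult[OF I] algebra_simps)
      then show ?thesis by (simp add: qconj_mult qconj_unit_exp[OF I] mult.assoc)
    qed
    then have "integral\<^sup>L ?M (\<lambda>t. qconj (unit_exp I (real n * t) * a n) * (unit_exp I (real m * t) * b m))
      = qconj (a n) * integral\<^sup>L ?M (\<lambda>t. unit_exp I ((real m - real n) * t)) * b m"
      by (simp add: integrable_ivl_continuous continuous_intros)
    also have "\<dots> = (if m = n then (2 * pi) *\<^sub>R (qconj (a n) * b n) else 0)"
      by (subst integral_unit_exp) (auto simp: of_real_def)
    finally show ?thesis .
  qed
  have inner: "integral\<^sup>L ?M (\<lambda>t. qconj (unit_exp I (real n * t) * a n) * circle_series I b t)
      = (2 * pi) *\<^sub>R (qconj (a n) * b n)" for n
  proof -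
    have "(\<lambda>m. integral\<^sup>L ?M (\<lambda>t. qconj (unit_exp I (real n * t) * a n) * (unit_exp I (real m * t) * b m)))
      sums integral\<^sup>L ?M (\<lambda>t. \<Sum>m. qconj (unit_exp I (real n * t) * a n) * (unit_exp I (real m * t) * b m))"
      by (rule sums_integral_ivl[where B = "\<lambda>m. norm (a n) * norm (b m)"])
         (auto intro!: continuous_intros summable_mult b simp: norm_mult norm_unit_exp[OF I])
    moreover have "(\<lambda>m. integral\<^sup>L ?M (\<lambda>t. qconj (unit_exp I (real n * t) * a n) * (unit_exp I (real m * t) * b m)))
      sums ((2 * pi) *\<^sub>R (qconj (a n) * b n))"
      unfolding mono using sums_single[of n "\<lambda>m. (2 * pi) *\<^sub>R (qconj (a n) * b n)"] by simp
    moreover have "(\<Sum>m. qconj (unit_exp I (real n * t) * a n) * (unit_exp I (real m * t) * b m))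
      = qconj (unit_exp I (real n * t) * a n) * circle_series I b t" for t
      unfolding circle_series_def by (rule suminf_mult[OF summable_circle_term[OF b]])
    ultimately show ?thesis using sums_unique2 by force
  qed
  have "(\<lambda>n. integral\<^sup>L ?M (\<lambda>t. qconj (unit_exp I (real n * t) * a n) * circle_series I b t))
      sums integral\<^sup>L ?M (\<lambda>t. \<Sum>n. qconj (unit_exp I (real n * t) * a n) * circle_series I b t)"
    by (rule sums_integral_ivl[where B = "\<lambda>n. norm (a n) * (\<Sum>m. norm (b m))"])
       (auto intro!: continuous_intros summable_mult2 a mult_left_mono continuous_on_circle_series b norm_circle_series_le
         simp: norm_mult norm_unit_exp[OF I])
  moreover have "(\<Sum>n. qconj (unit_exp I (real n * t) * a n) * circle_series I b t)
      = qconj (circle_series I a t) * circle_series I b t" for t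
    unfolding circle_series_def[of I a]
    by (subst suminf_mult2[symmetric])
       (auto intro!: summable_circle_term a bounded_linear.summable[OF bounded_linear_qconj]
         simp: bounded_linear.suminf[OF bounded_linear_qconj summable_circle_term[OF a]])
  ultimately show ?thesis by (simp add: inner)
qed

lemma parseval_norm:
  assumes "summable (\<lambda>n. norm (a n))"
  shows "(\<lambda>n. 2 * pi * (norm (a n))\<^sup>2) sums integral\<^sup>L (ivl 0 (2 * pi)) (\<lambda>t. (norm (circle_series I a t))\<^sup>2)"
proof -
  have bl: "bounded_linear qre"
    by (rule bounded_linear_intro[where K = 1])
       (simp_all, simp add: norm_quat_def inner_quat_def real_le_rsqrt power2_eq_square)
  have eq: "qre (of_real r) = r" for r by (simp add: of_real_def)
  have "(\<lambda>n. qre ((2 * pi) *\<^sub>R (qconj (a n) * a n))) sums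
    qre (integral\<^sup>L (ivl 0 (2 * pi)) (\<lambda>t. qconj (circle_series I a t) * circle_series I a t))"
    by (rule bounded_linear.sums[OF bl parseval[OF assms assms]])
  moreover have "qre (integral\<^sup>L (ivl 0 (2 * pi)) (\<lambda>t. qconj (circle_series I a t) * circle_series I a t))
     = integral\<^sup>L (ivl 0 (2 * pi)) (\<lambda>t. qre (qconj (circle_series I a t) * circle_series I a t))"
    by (rule integral_bounded_linear[OF bl, symmetric])
       (intro integrable_ivl_continuous continuous_intros continuous_on_circle_series assms)
  ultimately show ?thesis by (simp only: qconj_mult_self eq scaleR_quat.sel mult.assoc)
qed

end


section \<open>Lebesgue summability implies Abel summability\<close>

text \<open>The kernel \<open>\<Sum>\<^sub>n n r\<^sup>n sin (n t)\<close>: up to sign, half the angular derivative of the Poisson kernel.\<close>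

definition abel_kernel :: "real \<Rightarrow> real \<Rightarrow> real" where
  "abel_kernel r t = (1 - r\<^sup>2) * r * sin t / (1 - 2 * r * cos t + r\<^sup>2)\<^sup>2"

lemma abel_kernel_sums:
  assumes "0 \<le> r" "r < 1"
  shows "(\<lambda>n. real n * r ^ n * sin (real n * t)) sums abel_kernel r t"
proof -
  define z where "z = complex_of_real r * cis t"
  have nz: "norm z < 1" using assms by (simp add: z_def norm_mult)
  have "(\<lambda>n. z * (of_nat (Suc n) * z ^ n)) sums (z * (1 / (1 - z)\<^sup>2))"
    by (intro sums_mult geometric_deriv_sums nz)
  then have "(\<lambda>n. of_nat (Suc n) * z ^ Suc n) sums (z / (1 - z)\<^sup>2)"
    by (simp add: mult_ac)
  then have "(\<lambda>n. of_nat n * z ^ n) sums (z / (1 - z)\<^sup>2)"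
    using sums_Suc_iff[of "\<lambda>n. of_nat n * z ^ n" "z / (1 - z)\<^sup>2"] by simp
  then have "(\<lambda>n. Im (of_nat n * z ^ n)) sums Im (z / (1 - z)\<^sup>2)"
    by (rule sums_Im)
  moreover have "Im (of_nat n * z ^ n) = real n * r ^ n * sin (real n * t)" for n
  proof -
    have "of_nat n * z ^ n = of_real (real n * r ^ n) * cis (real n * t)"
      by (simp add: z_def power_mult_distrib Complex.DeMoivre)
    then show ?thesis by (simp only: times_complex.sel Re_complex_of_real Im_complex_of_real cis.sel)
  qed
  moreover have "Im (z / (1 - z)\<^sup>2) = abel_kernel r t"
  proof -
    define c s where "c = cos t" and "s = sin t"
    have cs: "c\<^sup>2 + s\<^sup>2 = 1" by (simp add: c_def s_def)
    have z: "Re z = r * c" "Im z = r * s" by (simp_all add: z_def c_def s_def)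
    have y: "Re ((1 - z)\<^sup>2) = (1 - r * c)\<^sup>2 - (r * s)\<^sup>2" "Im ((1 - z)\<^sup>2) = - 2 * (1 - r * c) * (r * s)"
      by (simp_all add: power2_eq_square z algebra_simps)
    have "(r * s) * ((1 - r * c)\<^sup>2 - (r * s)\<^sup>2) - (r * c) * (- 2 * (1 - r * c) * (r * s)) = r * s * (1 - r\<^sup>2 * (c\<^sup>2 + s\<^sup>2))"
      by (simp add: power2_eq_square algebra_simps)
    then have num: "(r * s) * ((1 - r * c)\<^sup>2 - (r * s)\<^sup>2) - (r * c) * (- 2 * (1 - r * c) * (r * s)) = (1 - r\<^sup>2) * r * s"
      by (simp add: cs)
    have "((1 - r * c)\<^sup>2 - (r * s)\<^sup>2)\<^sup>2 + (- 2 * (1 - r * c) * (r * s))\<^sup>2 = (1 - 2 * r * c + r\<^sup>2 * (c\<^sup>2 + s\<^sup>2))\<^sup>2"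
      by (simp add: power2_eq_square algebra_simps)
    then have den: "((1 - r * c)\<^sup>2 - (r * s)\<^sup>2)\<^sup>2 + (- 2 * (1 - r * c) * (r * s))\<^sup>2 = (1 - 2 * r * c + r\<^sup>2)\<^sup>2"
      by (simp add: cs)
    show ?thesis unfolding Im_divide z y num den by (simp add: abel_kernel_def c_def s_def)
  qed
  ultimately show ?thesis by (simp only:)
qed

lemma abel_kernel_nonneg:
  assumes "0 \<le> r" "r < 1" "t \<in> {0..pi}"
  shows "0 \<le> abel_kernel r t"
proof -
  have "r\<^sup>2 \<le> 1" using assms by (simp add: power_le_one)
  then show ?thesis unfolding abel_kernel_def using assms
    by (intro divide_nonneg_nonneg mult_nonneg_nonneg sin_ge_zero) auto
qed

text \<open>Away from the origin the kernel tends to 0 uniformly as \<open>r\<close> tends to 1.\<close>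

lemma abel_kernel_le:
  assumes "0 \<le> r" "r < 1" "0 < d" "d < pi" "t \<in> {d..pi}"
  shows "abel_kernel r t \<le> (1 - r\<^sup>2) / (sin d) ^ 4"
proof -
  have r2: "r\<^sup>2 \<le> 1" using assms by (simp add: power_le_one)
  have sd: "0 < sin d" using assms by (intro sin_gt_zero) auto
  have "cos t \<le> cos d" using assms by (intro cos_monotone_0_pi_le) auto
  then have "r * cos t \<le> r * cos d" using assms by (intro mult_left_mono)
  moreover have "1 - 2 * (r * cos d) + r\<^sup>2 = (r - cos d)\<^sup>2 + (sin d)\<^sup>2"
    using sin_cos_squared_add[of d] by (simp add: power2_eq_square algebra_simps)
  ultimately have ge: "(sin d)\<^sup>2 \<le> 1 - 2 * r * cos t + r\<^sup>2"
    using zero_le_power2[of "r - cos d"] by linarith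
  have "abel_kernel r t \<le> (1 - r\<^sup>2) * 1 * 1 / ((sin d)\<^sup>2)\<^sup>2"
    unfolding abel_kernel_def using assms r2 ge sd
    by (intro frac_le mult_mono power_mono) (auto intro!: mult_nonneg_nonneg sin_ge_zero)
  then show ?thesis by simp
qed

lemma integral_cos_ivl:
  assumes "k \<in> \<int>"
  shows "integral\<^sup>L (ivl 0 pi) (\<lambda>t. cos (k * t)) = (if k = 0 then pi else 0)"
proof (cases "k = 0")
  case True
  then show ?thesis using integral_ivl_const[of 0 pi "1::real"] by (simp del: lebesgue_integral_const)
next
  case False
  obtain m where m: "k = of_int m" using assms by (auto elim: Ints_cases)
  have "((\<lambda>t. sin (k * t) / k) has_vector_derivative cos (k * t)) (at t within {0..pi})" for t
    using False unfolding has_real_derivative_iff_has_vector_derivative[symmetric]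
    by (auto intro!: derivative_eq_intros)
  then have "integral\<^sup>L (ivl 0 pi) (\<lambda>t. cos (k * t)) = sin (k * pi) / k - sin (k * 0) / k"
    by (intro integral_ivl_FTC continuous_intros) auto
  then show ?thesis using False by (simp add: m sin_times_pi_eq_0)
qed

lemma integral_sin_sin_ivl:
  "integral\<^sup>L (ivl 0 pi) (\<lambda>t. sin (real m * t) * sin (real n * t)) = (if m = n \<and> n \<noteq> 0 then pi / 2 else 0)"
proof -
  have "integral\<^sup>L (ivl 0 pi) (\<lambda>t. sin (real m * t) * sin (real n * t))
     = integral\<^sup>L (ivl 0 pi) (\<lambda>t. (1 / 2) * (cos ((real m - real n) * t) - cos ((real m + real n) * t)))"
    by (intro Bochner_Integration.integral_cong refl) (simp add: sin_times_sin left_diff_distrib distrib_right)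
  also have "\<dots> = (1 / 2) * (integral\<^sup>L (ivl 0 pi) (\<lambda>t. cos ((real m - real n) * t))
       - integral\<^sup>L (ivl 0 pi) (\<lambda>t. cos ((real m + real n) * t)))"
    by (subst integral_mult_right_zero, subst Bochner_Integration.integral_diff)
       (intro integrable_ivl_continuous continuous_intros refl)+
  also have "\<dots> = (if m = n \<and> n \<noteq> 0 then pi / 2 else 0)"
    by (subst (1 2) integral_cos_ivl) auto
  finally show ?thesis .
qed

lemma integral_id_sin_ivl:
  assumes "n \<noteq> 0"
  shows "integral\<^sup>L (ivl 0 pi) (\<lambda>t. t * sin (real n * t)) = - pi * (- 1) ^ n / real n"
proof -
  have "((\<lambda>t. sin (real n * t) / (real n)\<^sup>2 - t * cos (real n * t) / real n) has_vector_derivative t * sin (real n * t))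
      (at t within {0..pi})" for t
    using assms unfolding has_real_derivative_iff_has_vector_derivative[symmetric]
    by (auto intro!: derivative_eq_intros simp: field_simps power2_eq_square)
  then have "integral\<^sup>L (ivl 0 pi) (\<lambda>t. t * sin (real n * t))
     = (sin (real n * pi) / (real n)\<^sup>2 - pi * cos (real n * pi) / real n) - (sin (real n * 0) / (real n)\<^sup>2 - 0 * cos (real n * 0) / real n)"
    by (intro integral_ivl_FTC continuous_intros) auto
  then show ?thesis by simp
qed

lemma summable_nat_times_power:
  assumes "0 \<le> r" "r < (1::real)"
  shows "summable (\<lambda>n. real n * r ^ n)"
proof -
  have "summable (\<lambda>n. r * (of_nat (Suc n) * r ^ n))"
    using geometric_deriv_sums[of r] assms by (intro summable_mult) (auto simp: sums_iff)
  then have "summable (\<lambda>n. real (Suc n) * r ^ Suc n)" by (simp add: mult_ac)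
  then show ?thesis by (subst summable_Suc_iff[symmetric])
qed

lemma continuous_on_abel_kernel:
  assumes "0 \<le> r" "r < 1"
  shows "continuous_on A (abel_kernel r)"
proof -
  have "continuous_on A (\<lambda>t. \<Sum>n. real n * r ^ n * sin (real n * t))"
    by (rule continuous_on_suminf_bounded[OF _ _ summable_nat_times_power[OF assms]])
       (auto intro!: continuous_intros mult_left_le simp: abs_mult assms(1))
  moreover have "(\<Sum>n. real n * r ^ n * sin (real n * t)) = abel_kernel r t" for t
    using abel_kernel_sums[OF assms] by (rule sums_unique[symmetric])
  ultimately show ?thesis by simp
qed

lemma continuous_on_Icc_bounded:
  fixes g :: "real \<Rightarrow> 'a::real_normed_vector"
  assumes "continuous_on {a..b} g"
  shows "\<exists>C. \<forall>t\<in>{a..b}. norm (g t) \<le> C"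
  using compact_imp_bounded[OF compact_continuous_image[OF assms compact_Icc]]
  by (simp add: bounded_iff)

lemma integral_abel_kernel:
  fixes g :: "real \<Rightarrow> 'a::euclidean_space"
  assumes r: "0 \<le> r" "r < 1" and g: "continuous_on {0..pi} g"
  shows "(\<lambda>n. (real n * r ^ n) *\<^sub>R integral\<^sup>L (ivl 0 pi) (\<lambda>t. sin (real n * t) *\<^sub>R g t))
    sums integral\<^sup>L (ivl 0 pi) (\<lambda>t. abel_kernel r t *\<^sub>R g t)"
proof -
  obtain C where C: "norm (g t) \<le> C" if "t \<in> {0..pi}" for t
    using continuous_on_Icc_bounded[OF g] by blast
  have "(\<lambda>n. integral\<^sup>L (ivl 0 pi) (\<lambda>t. (real n * r ^ n * sin (real n * t)) *\<^sub>R g t))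
    sums integral\<^sup>L (ivl 0 pi) (\<lambda>t. \<Sum>n. (real n * r ^ n * sin (real n * t)) *\<^sub>R g t)"
  proof (rule sums_integral_ivl[where B = "\<lambda>n. real n * r ^ n * C"])
    show "summable (\<lambda>n. real n * r ^ n * C)" by (intro summable_mult2 summable_nat_times_power r)
    fix n t assume t: "t \<in> {0..pi}"
    have "\<bar>real n * r ^ n * sin (real n * t)\<bar> \<le> real n * r ^ n"
      by (auto intro!: mult_left_le simp: abs_mult r)
    then show "norm ((real n * r ^ n * sin (real n * t)) *\<^sub>R g t) \<le> real n * r ^ n * C"
      unfolding norm_scaleR by (intro mult_mono C t) auto
  qed (auto intro!: continuous_intros g)
  moreover have "(\<Sum>n. (real n * r ^ n * sin (real n * t)) *\<^sub>R g t) = abel_kernel r t *\<^sub>R g t" for t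
    using bounded_linear.sums[OF bounded_linear_scaleR_left abel_kernel_sums[OF r]] by (rule sums_unique[symmetric])
  moreover have "integral\<^sup>L (ivl 0 pi) (\<lambda>t. (real n * r ^ n * sin (real n * t)) *\<^sub>R g t)
     = (real n * r ^ n) *\<^sub>R integral\<^sup>L (ivl 0 pi) (\<lambda>t. sin (real n * t) *\<^sub>R g t)" for n
    unfolding scaleR_scaleR[of "real n * r ^ n", symmetric] by (rule integral_scaleR_right)
  ultimately show ?thesis by simp
qed

text \<open>The first moment, which tends to \<open>pi / 2\<close> as \<open>r\<close> tends to 1.\<close>

lemma integral_abel_kernel_id:
  assumes "0 \<le> r" "r < 1"
  shows "integral\<^sup>L (ivl 0 pi) (\<lambda>t. abel_kernel r t * t) = pi * r / (1 + r)"
proof -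
  have "(\<lambda>n. (real n * r ^ n) * integral\<^sup>L (ivl 0 pi) (\<lambda>t. sin (real n * t) * t))
     sums integral\<^sup>L (ivl 0 pi) (\<lambda>t. abel_kernel r t * t)"
    using integral_abel_kernel[OF assms continuous_on_id] by simp
  moreover have "(real n * r ^ n) * integral\<^sup>L (ivl 0 pi) (\<lambda>t. sin (real n * t) * t)
     = (if n = 0 then 0 else - pi * (- r) ^ n)" for n
    using integral_id_sin_ivl[of n] by (simp add: mult.commute[of "sin _"] power_minus[of r])
  ultimately have "(\<lambda>n. if n = 0 then 0 else - pi * (- r) ^ n)
     sums integral\<^sup>L (ivl 0 pi) (\<lambda>t. abel_kernel r t * t)" by simp
  then have "(\<lambda>n. - pi * (- r) ^ Suc n) sums integral\<^sup>L (ivl 0 pi) (\<lambda>t. abel_kernel r t * t)"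
    using sums_Suc_iff[of "\<lambda>n. if n = 0 then 0 else - pi * (- r) ^ n"] by simp
  moreover have "(\<lambda>n. (- pi * - r) * (- r) ^ n) sums ((- pi * - r) * (1 / (1 - (- r))))"
    using assms by (intro sums_mult geometric_sums) auto
  ultimately show ?thesis using sums_unique2 by (fastforce simp: mult_ac)
qed

text \<open>
  If the symmetric derivative at 0 of the formally integrated series exists, then it is the Abel
  sum. The terms with \<open>n = 0\<close> vanish: on the left by the convention \<open>x / 0 = 0\<close>, on the right by
  assumption.
\<close>

lemma abel_sum_of_lebesgue_sum:
  fixes c :: "nat \<Rightarrow> 'a::euclidean_space"
  assumes c0: "c 0 = 0" and sm: "summable (\<lambda>n. norm (c n) / real n)"
    and lim: "((\<lambda>t. (\<Sum>n. (sin (real n * t) / real n) *\<^sub>R c n) /\<^sub>R t) \<longlongrightarrow> L) (at_right 0)"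
  shows "((\<lambda>r. \<Sum>n. r ^ n *\<^sub>R c n) \<longlongrightarrow> L) (at_left 1)"
proof -
  define \<phi> where "\<phi> = (\<lambda>t. \<Sum>n. (sin (real n * t) / real n) *\<^sub>R c n)"
  have bd: "norm ((sin (real n * t) / real n) *\<^sub>R c n) \<le> norm (c n) / real n" for n t
    using mult_right_mono[OF abs_sin_le_one[of "real n * t"], of "norm (c n) / real n"] by simp
  have cont: "continuous_on A \<phi>" for A unfolding \<phi>_def
  proof (rule continuous_on_suminf_bounded[OF _ bd sm])
    show "continuous_on A (\<lambda>t. (sin (real n * t) / real n) *\<^sub>R c n)" for n
      by (cases "n = 0") (auto intro!: continuous_intros)
  qed
  have coeff: "integral\<^sup>L (ivl 0 pi) (\<lambda>t. sin (real m * t) *\<^sub>R \<phi> t) = (pi / 2 / real m) *\<^sub>R c m" for m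
  proof -
    have S1: "(\<lambda>n. integral\<^sup>L (ivl 0 pi) (\<lambda>t. sin (real m * t) *\<^sub>R (sin (real n * t) / real n) *\<^sub>R c n))
      sums integral\<^sup>L (ivl 0 pi) (\<lambda>t. \<Sum>n. sin (real m * t) *\<^sub>R (sin (real n * t) / real n) *\<^sub>R c n)"
    proof (rule sums_integral_ivl[OF _ _ sm])
      show "norm (sin (real m * t) *\<^sub>R (sin (real n * t) / real n) *\<^sub>R c n) \<le> norm (c n) / real n" for n t
        unfolding norm_scaleR[of "sin (real m * t)"]
        by (rule order.trans[OF mult_left_le_one_le bd]) auto
      show "continuous_on {0..pi} (\<lambda>t. sin (real m * t) *\<^sub>R (sin (real n * t) / real n) *\<^sub>R c n)" for n
        by (cases "n = 0") (auto intro!: continuous_intros)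
    qed simp
    have S2: "(\<Sum>n. sin (real m * t) *\<^sub>R (sin (real n * t) / real n) *\<^sub>R c n) = sin (real m * t) *\<^sub>R \<phi> t" for t
      unfolding \<phi>_def by (intro suminf_scaleR_right[symmetric] summable_comparison_test'[OF sm] bd)
    have S3: "integral\<^sup>L (ivl 0 pi) (\<lambda>t. sin (real m * t) *\<^sub>R (sin (real n * t) / real n) *\<^sub>R c n)
        = (if n = m then (pi / 2 / real m) *\<^sub>R c m else 0)" for n
    proof -
      have A: "sin (real m * t) *\<^sub>R (sin (real n * t) / real n) *\<^sub>R c n
         = (sin (real m * t) * sin (real n * t)) *\<^sub>R (c n /\<^sub>R real n)" for t
        by (simp add: divide_inverse)
      have B: "integral\<^sup>L (ivl 0 pi) (\<lambda>t. (sin (real m * t) * sin (real n * t)) *\<^sub>R (c n /\<^sub>R real n))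
          = (if m = n \<and> n \<noteq> 0 then pi / 2 else 0) *\<^sub>R (c n /\<^sub>R real n)"
        unfolding integral_sin_sin_ivl[symmetric]
        by (intro integral_scaleR_left integrable_ivl_continuous continuous_intros)
      have C: "(if m = n \<and> n \<noteq> 0 then pi / 2 else 0) *\<^sub>R (c n /\<^sub>R real n)
          = (if n = m then (pi / 2 / real m) *\<^sub>R c m else 0)"
      proof (cases "n = m")
        case True
        show ?thesis unfolding True by (cases "m = 0") (simp only: c0, simp, simp only: scaleR_scaleR divide_inverse, simp)
      qed auto
      show ?thesis unfolding A B C ..
    qed
    from S1 have "(\<lambda>n. if n = m then (pi / 2 / real m) *\<^sub>R c m else 0) sums
        integral\<^sup>L (ivl 0 pi) (\<lambda>t. sin (real m * t) *\<^sub>R \<phi> t)"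
      unfolding S2 S3 .
    then show ?thesis by (rule sums_unique2) (rule sums_single)
  qed
  have val: "(\<Sum>n. r ^ n *\<^sub>R c n) = (2 / pi) *\<^sub>R integral\<^sup>L (ivl 0 pi) (\<lambda>t. abel_kernel r t *\<^sub>R \<phi> t)"
    if r: "0 \<le> r" "r < 1" for r
  proof -
    have "(\<lambda>n. (2 / pi) *\<^sub>R ((real n * r ^ n) *\<^sub>R ((pi / 2 / real n) *\<^sub>R c n)))
        sums ((2 / pi) *\<^sub>R integral\<^sup>L (ivl 0 pi) (\<lambda>t. abel_kernel r t *\<^sub>R \<phi> t))"
      using sums_scaleR_right[OF integral_abel_kernel[OF r cont], of "2 / pi"] by (simp only: coeff)
    moreover have "(2 / pi) *\<^sub>R ((real n * r ^ n) *\<^sub>R ((pi / 2 / real n) *\<^sub>R c n)) = r ^ n *\<^sub>R c n" for n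
      by (cases "n = 0") (simp_all add: c0)
    ultimately have "(\<lambda>n. r ^ n *\<^sub>R c n) sums ((2 / pi) *\<^sub>R integral\<^sup>L (ivl 0 pi) (\<lambda>t. abel_kernel r t *\<^sub>R \<phi> t))"
      by (simp only:)
    then show ?thesis by (rule sums_unique[symmetric])
  qed
  have D: "continuous_on A (\<lambda>t. \<phi> t - t *\<^sub>R L)" for A by (intro continuous_intros cont)
  obtain C where C: "norm (\<phi> t - t *\<^sub>R L) \<le> C" if "t \<in> {0..pi}" for t
    using continuous_on_Icc_bounded[OF D] by blast
  have C0: "0 \<le> C" using order.trans[OF norm_ge_zero C[of 0]] by simp
  have phi0: "\<phi> 0 = 0" by (simp add: \<phi>_def)
  \<comment> \<open>near 0 the kernel is controlled by its first moment, elsewhere it tends to 0 uniformly\<close>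
  have main: "((\<lambda>r. (2 / pi) *\<^sub>R integral\<^sup>L (ivl 0 pi) (\<lambda>t. abel_kernel r t *\<^sub>R (\<phi> t - t *\<^sub>R L))) \<longlongrightarrow> 0) (at_left 1)"
  proof (rule tendstoI)
    fix e :: real assume e: "0 < e"
    have "eventually (\<lambda>t. dist (\<phi> t /\<^sub>R t) L < e / 4) (at_right 0)"
      using tendstoD[OF lim, of "e / 4"] e by (simp add: \<phi>_def)
    then obtain d0 where d0: "d0 > 0" "\<And>t. 0 < t \<Longrightarrow> t < d0 \<Longrightarrow> dist (\<phi> t /\<^sub>R t) L < e / 4"
      by (auto simp: eventually_at_right_field)
    define d where "d = min (d0 / 2) 1"
    have d: "0 < d" "d < d0" "d < pi" using d0 pi_gt3 by (auto simp: d_def)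
    have near: "norm (\<phi> t - t *\<^sub>R L) \<le> e / 4 * t" if "0 \<le> t" "t \<le> d" for t
    proof (cases "t = 0")
      case False
      then have "norm (t *\<^sub>R (\<phi> t /\<^sub>R t - L)) \<le> t * (e / 4)"
        using d0(2)[of t] that d unfolding norm_scaleR dist_norm by (intro mult_mono) auto
      then show ?thesis using False by (simp add: algebra_simps)
    qed (simp add: phi0)
    define Q where "Q = C / (sin d) ^ 4"
    have "((\<lambda>r::real. 2 * ((1 - r\<^sup>2) * Q)) \<longlongrightarrow> 2 * ((1 - 1\<^sup>2) * Q)) (at_left 1)"
      by (intro tendsto_intros)
    then have "eventually (\<lambda>r. 2 * ((1 - r\<^sup>2) * Q) < e / 2) (at_left (1::real))"
      using e by (intro order_tendstoD(2)) auto
    moreover have "eventually (\<lambda>r. 0 < r \<and> r < 1) (at_left (1::real))"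
      by (auto simp: eventually_at_left_field intro!: exI[of _ 0])
    ultimately show "eventually (\<lambda>r. dist ((2 / pi) *\<^sub>R integral\<^sup>L (ivl 0 pi) (\<lambda>t. abel_kernel r t *\<^sub>R (\<phi> t - t *\<^sub>R L))) 0 < e) (at_left 1)"
    proof eventually_elim
      case (elim r)
      then have r: "0 \<le> r" "r < 1" by auto
      have r2: "0 \<le> 1 - r\<^sup>2" using r by (simp add: power_le_one)
      have pt: "norm (abel_kernel r t *\<^sub>R (\<phi> t - t *\<^sub>R L)) \<le> e / 4 * (abel_kernel r t * t) + (1 - r\<^sup>2) * Q"
        if t: "t \<in> {0..pi}" for t
      proof -
        have k: "0 \<le> abel_kernel r t" using abel_kernel_nonneg[OF r t] .
        have Q0: "0 \<le> (1 - r\<^sup>2) * Q" using r2 C0 d by (auto simp: Q_def)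
        have kt: "0 \<le> e / 4 * (abel_kernel r t * t)" using k t e by auto
        show ?thesis
        proof (cases "t \<le> d")
          case True
          have "abel_kernel r t * norm (\<phi> t - t *\<^sub>R L) \<le> abel_kernel r t * (e / 4 * t)"
            using near t k True by (intro mult_left_mono) auto
          also have "\<dots> = e / 4 * (abel_kernel r t * t)" by simp
          finally show ?thesis unfolding norm_scaleR abs_of_nonneg[OF k] using Q0 by linarith
        next
          case False
          then have "abel_kernel r t * norm (\<phi> t - t *\<^sub>R L) \<le> (1 - r\<^sup>2) / (sin d) ^ 4 * C"
            using abel_kernel_le[OF r d(1,3), of t] t C[OF t] r2 by (intro mult_mono) auto
          then show ?thesis using kt k by (simp add: Q_def)
        qed
      qed
      have ck: "continuous_on A (abel_kernel r)" for A by (rule continuous_on_abel_kernel[OF r])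
      have "norm (integral\<^sup>L (ivl 0 pi) (\<lambda>t. abel_kernel r t *\<^sub>R (\<phi> t - t *\<^sub>R L)))
          \<le> integral\<^sup>L (ivl 0 pi) (\<lambda>t. e / 4 * (abel_kernel r t * t) + (1 - r\<^sup>2) * Q)"
        by (rule order.trans[OF integral_norm_bound integral_mono])
           (use pt in \<open>auto intro!: integrable_ivl_continuous continuous_intros ck D simp: space_restrict_space\<close>)
      also have "\<dots> = e / 4 * (pi * r / (1 + r)) + pi * ((1 - r\<^sup>2) * Q)"
        unfolding integral_abel_kernel_id[OF r, symmetric]
        using integral_ivl_const[of 0 pi "(1 - r\<^sup>2) * Q"]
        by (subst Bochner_Integration.integral_add)
           (auto intro!: integrable_ivl_continuous continuous_intros ck simp del: lebesgue_integral_const)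
      also have "\<dots> \<le> e / 4 * pi + pi * ((1 - r\<^sup>2) * Q)"
        using r e by (intro add_right_mono mult_left_mono) (auto simp: field_simps)
      finally have "(2 / pi) * norm (integral\<^sup>L (ivl 0 pi) (\<lambda>t. abel_kernel r t *\<^sub>R (\<phi> t - t *\<^sub>R L)))
          \<le> (2 / pi) * (e / 4 * pi + pi * ((1 - r\<^sup>2) * Q))" by (intro mult_left_mono) auto
      also have "\<dots> = e / 2 + 2 * ((1 - r\<^sup>2) * Q)" by (simp add: field_simps)
      also have "\<dots> < e" using elim by simp
      finally show ?case by simp
    qed
  qed
  have "((\<lambda>r::real. (2 / pi) *\<^sub>R ((pi * r / (1 + r)) *\<^sub>R L)) \<longlongrightarrow> (2 / pi) *\<^sub>R ((pi * 1 / (1 + 1)) *\<^sub>R L)) (at_left 1)"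
    by (intro tendsto_intros) auto
  from tendsto_add[OF main this] have
    "((\<lambda>r. (2 / pi) *\<^sub>R integral\<^sup>L (ivl 0 pi) (\<lambda>t. abel_kernel r t *\<^sub>R (\<phi> t - t *\<^sub>R L)) + (2 / pi) *\<^sub>R ((pi * r / (1 + r)) *\<^sub>R L)) \<longlongrightarrow> L) (at_left 1)"
    by simp
  then show ?thesis
  proof (rule Lim_transform_eventually)
    have "eventually (\<lambda>r. 0 < r \<and> r < 1) (at_left (1::real))"
      by (auto simp: eventually_at_left_field intro!: exI[of _ 0])
    then show "eventually (\<lambda>r. (2 / pi) *\<^sub>R integral\<^sup>L (ivl 0 pi) (\<lambda>t. abel_kernel r t *\<^sub>R (\<phi> t - t *\<^sub>R L)) + (2 / pi) *\<^sub>R ((pi * r / (1 + r)) *\<^sub>R L)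
       = (\<Sum>n. r ^ n *\<^sub>R c n)) (at_left 1)"
    proof eventually_elim
      case (elim r)
      then have r: "0 \<le> r" "r < 1" by auto
      have ck: "continuous_on A (abel_kernel r)" for A by (rule continuous_on_abel_kernel[OF r])
      have "integral\<^sup>L (ivl 0 pi) (\<lambda>t. abel_kernel r t *\<^sub>R (\<phi> t - t *\<^sub>R L))
        = integral\<^sup>L (ivl 0 pi) (\<lambda>t. abel_kernel r t *\<^sub>R \<phi> t) - integral\<^sup>L (ivl 0 pi) (\<lambda>t. (abel_kernel r t * t) *\<^sub>R L)"
        by (subst Bochner_Integration.integral_diff[symmetric])
           (auto intro!: integrable_ivl_continuous continuous_intros ck cont simp: scaleR_diff_right)
      also have "integral\<^sup>L (ivl 0 pi) (\<lambda>t. (abel_kernel r t * t) *\<^sub>R L) = (pi * r / (1 + r)) *\<^sub>R L"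
        unfolding integral_abel_kernel_id[OF r, symmetric]
        by (intro integral_scaleR_left integrable_ivl_continuous continuous_intros ck)
      finally show ?case by (simp add: val[OF r] scaleR_diff_right)
    qed
  qed
qed


section \<open>Radial limits of square summable series\<close>

lemma L1_complete:
  fixes s :: "nat \<Rightarrow> 'a \<Rightarrow> 'b::{banach, second_countable_topology}"
  assumes int: "\<And>n. integrable M (s n)"
    and cau: "\<And>e. e > 0 \<Longrightarrow> \<exists>N. \<forall>i\<ge>N. \<forall>j\<ge>N. (LINT x|M. norm (s i x - s j x)) < e"
  obtains g where "integrable M g" "(\<lambda>n. LINT x|M. norm (s n x - g x)) \<longlonglongrightarrow> 0"
proof -
  obtain r where r: "strict_mono r" and ae: "AE x in M. Cauchy (\<lambda>i. s (r i) x)"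
    using cauchy_L1_AE_cauchy_subseq[OF int cau] by blast
  have meas [measurable]: "s n \<in> borel_measurable M" for n
    using int by (rule borel_measurable_integrable)
  define g where "g = (\<lambda>x. lim (\<lambda>i. s (r i) x))"
  have g [measurable]: "g \<in> borel_measurable M"
    unfolding g_def by (rule borel_measurable_lim_metric) simp
  have bound: "(\<integral>\<^sup>+x. norm (s n x - g x) \<partial>M) \<le> ennreal e"
    if N: "\<forall>i\<ge>N. \<forall>j\<ge>N. (LINT x|M. norm (s i x - s j x)) < e" and n: "N \<le> n" for N n e
  proof -
    have "AE x in M. ennreal (norm (s n x - g x)) = liminf (\<lambda>i. ennreal (norm (s n x - s (r i) x)))"
      using ae
    proof eventually_elim
      case (elim x)
      then have "(\<lambda>i. s (r i) x) \<longlonglongrightarrow> g x"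
        unfolding g_def by (simp add: Cauchy_convergent convergent_LIMSEQ_iff[symmetric])
      then have "(\<lambda>i. ennreal (norm (s n x - s (r i) x))) \<longlonglongrightarrow> ennreal (norm (s n x - g x))"
        by (intro tendsto_intros tendsto_ennrealI)
      then show ?case by (rule lim_imp_Liminf[OF sequentially_bot, symmetric])
    qed
    then have "(\<integral>\<^sup>+x. norm (s n x - g x) \<partial>M) = (\<integral>\<^sup>+x. liminf (\<lambda>i. ennreal (norm (s n x - s (r i) x))) \<partial>M)"
      by (rule nn_integral_cong_AE)
    also have "\<dots> \<le> liminf (\<lambda>i. \<integral>\<^sup>+x. ennreal (norm (s n x - s (r i) x)) \<partial>M)"
      by (rule nn_integral_liminf) measurable
    also have "\<dots> \<le> liminf (\<lambda>i. ennreal e)"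
    proof (rule Liminf_mono)
      have "eventually (\<lambda>i. N \<le> r i) sequentially"
        using eventually_ge_at_top[of N] by eventually_elim (meson r seq_suble order.trans)
      then show "eventually (\<lambda>i. (\<integral>\<^sup>+x. ennreal (norm (s n x - s (r i) x)) \<partial>M) \<le> ennreal e) sequentially"
      proof eventually_elim
        case (elim i)
        have "(\<integral>\<^sup>+x. ennreal (norm (s n x - s (r i) x)) \<partial>M) = ennreal (LINT x|M. norm (s n x - s (r i) x))"
          by (intro nn_integral_eq_integral integrable_norm Bochner_Integration.integrable_diff int) simp
        also have "\<dots> \<le> ennreal e" using N n elim by (intro ennreal_leI) (simp add: less_imp_le)
        finally show ?case .
      qed
    qed
    also have "\<dots> = ennreal e" by (simp add: Liminf_const)
    finally show ?thesis .
  qed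
  obtain N1 where N1: "\<forall>i\<ge>N1. \<forall>j\<ge>N1. (LINT x|M. norm (s i x - s j x)) < 1" using cau[of 1] by auto
  have "integrable M (\<lambda>x. s N1 x - g x)"
    by (rule integrableI_bounded) (use bound[OF N1 order.refl] in \<open>auto simp: le_less_trans\<close>)
  from Bochner_Integration.integrable_diff[OF int[of N1] this] have ig: "integrable M g" by simp
  have "(\<lambda>n. LINT x|M. norm (s n x - g x)) \<longlonglongrightarrow> 0"
  proof (rule LIMSEQ_I)
    fix e :: real assume e: "0 < e"
    obtain N where N: "\<forall>i\<ge>N. \<forall>j\<ge>N. (LINT x|M. norm (s i x - s j x)) < e / 2" using cau[of "e / 2"] e by auto
    have "norm ((LINT x|M. norm (s n x - g x)) - 0) < e" if "N \<le> n" for n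
    proof -
      have "ennreal (LINT x|M. norm (s n x - g x)) = (\<integral>\<^sup>+x. norm (s n x - g x) \<partial>M)"
        by (intro nn_integral_eq_integral[symmetric] integrable_norm Bochner_Integration.integrable_diff int ig) simp
      also have "\<dots> \<le> ennreal (e / 2)" by (rule bound[OF N that])
      finally have "(LINT x|M. norm (s n x - g x)) \<le> e / 2" using e by simp
      moreover have "0 \<le> (LINT x|M. norm (s n x - g x))" by simp
      ultimately show ?thesis using e by simp
    qed
    then show "\<exists>N. \<forall>n\<ge>N. norm ((LINT x|M. norm (s n x - g x)) - 0) < e" by blast
  qed
  with ig show thesis by (rule that)
qed

lemma integrable_ivl_subset:
  fixes g :: "real \<Rightarrow> 'a::{banach, second_countable_topology}"
  assumes "integrable (ivl a b) g" "a \<le> x" "y \<le> b"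
  shows "integrable (ivl x y) g"
proof -
  have "set_integrable lborel {a..b} g"
    using assms(1) by (simp add: integrable_restrict_space set_integrable_def)
  then have "set_integrable lborel {x..y} g"
    by (rule set_integrable_subset) (use assms in auto)
  then show ?thesis by (simp add: integrable_restrict_space set_integrable_def)
qed

lemma integral_ivl_mono_set:
  fixes g :: "real \<Rightarrow> real"
  assumes "integrable (ivl a b) g" "a \<le> x" "y \<le> b" "\<And>t. 0 \<le> g t"
  shows "integral\<^sup>L (ivl x y) g \<le> integral\<^sup>L (ivl a b) g"
proof -
  have "(LINT t|lborel. indicator {x..y} t *\<^sub>R g t) \<le> (LINT t|lborel. indicator {a..b} t *\<^sub>R g t)"
    using assms integrable_ivl_subset[OF assms(1-3)]
    by (intro integral_mono) (auto simp: integrable_restrict_space indicator_def)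
  then show ?thesis by (simp add: integral_restrict_space)
qed

lemma AE_lborel_negligible:
  assumes "negligible N"
  shows "AE x in lborel. x \<notin> N"
  using AE_not_in[OF assms[unfolded negligible_iff_null_sets]] by (simp only: AE_completion_iff)

lemma AE_lborel_reflect:
  assumes "AE x in lborel. P (x::real)" shows "AE x in lborel. P (s - x)"
proof (rule AE_distrD[where f = "\<lambda>x. s - x" and M' = borel and P = P])
  have "distr lborel borel (\<lambda>x. s + - 1 * x) = (lborel :: real measure)"
    by (subst lborel_real_affine[of "-1" s]) (auto simp: density_1 one_ennreal_def[symmetric])
  then have "distr lborel borel (\<lambda>x. s - x) = (lborel :: real measure)" by simp
  then show "AE x in distr lborel borel (\<lambda>x. s - x). P (x::real)"
    by (simp only: assms)
qed simp

text \<open>The Lebesgue differentiation theorem, for symmetric intervals.\<close>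

lemma AE_symmetric_derivative:
  fixes g :: "real \<Rightarrow> 'a::euclidean_space"
  assumes g: "integrable (ivl a b) g"
  shows "AE x in lborel. x \<in> {a<..<b} \<longrightarrow>
    ((\<lambda>h. integral\<^sup>L (ivl (x - h) (x + h)) g /\<^sub>R (2 * h)) \<longlongrightarrow> g x) (at_right 0)"
proof -
  define g0 where "g0 = (\<lambda>x. indicator {a..b} x *\<^sub>R g x)"
  have g0: "integrable lborel g0"
    using g by (simp add: integrable_restrict_space g0_def)
  have set: "set_integrable lborel {c..d} g0" for c d
    unfolding set_integrable_def by (intro integrable_mult_indicator g0) simp
  have hk: "g0 integrable_on {c..d}" for c d by (rule set_borel_integral_eq_integral(1)[OF set])
  have hk': "(\<lambda>x. g0 (- x)) integrable_on {c..d}" for c d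
    using hk[of "- d" "- c"] Henstock_Kurzweil_Integration.integrable_reflect_real[of g0 "- c" "- d"] by simp
  \<comment> \<open>one-sided derivatives: to the right for \<open>g0\<close>, and to the left by reflection\<close>
  obtain N1 where N1: "negligible N1" "\<And>x e. \<lbrakk>x \<notin> N1; 0 < e\<rbrakk> \<Longrightarrow>
      \<exists>d>0. \<forall>h. 0 < h \<and> h < d \<longrightarrow> norm (integral (cbox x (x + h *\<^sub>R One)) g0 /\<^sub>R h ^ DIM(real) - g0 x) < e"
    using integrable_ccontinuous_explicit[of g0] hk by (metis interval_cbox)
  obtain N2 where N2: "negligible N2" "\<And>x e. \<lbrakk>x \<notin> N2; 0 < e\<rbrakk> \<Longrightarrow>
      \<exists>d>0. \<forall>h. 0 < h \<and> h < d \<longrightarrow> norm (integral (cbox x (x + h *\<^sub>R One)) (\<lambda>x. g0 (- x)) /\<^sub>R h ^ DIM(real) - g0 (- x)) < e"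
    using integrable_ccontinuous_explicit[of "\<lambda>x. g0 (- x)"] hk' by (metis (no_types, lifting) interval_cbox)
  have "AE x in lborel. x \<notin> N1" by (rule AE_lborel_negligible[OF N1(1)])
  moreover have "AE x in lborel. - x \<notin> N2"
    using AE_lborel_reflect[OF AE_lborel_negligible[OF N2(1)], of 0] by simp
  ultimately show ?thesis
  proof eventually_elim
    case (elim x)
    have R: "((\<lambda>h. integral {x..x + h} g0 /\<^sub>R h) \<longlongrightarrow> g0 x) (at_right 0)"
      by (rule tendstoI) (use N1(2)[OF elim(1)] in \<open>fastforce simp: eventually_at_right_field dist_norm\<close>)
    have "((\<lambda>h. integral {- x..- x + h} (\<lambda>x. g0 (- x)) /\<^sub>R h) \<longlongrightarrow> g0 x) (at_right 0)"
      by (rule tendstoI) (use N2(2)[OF elim(2)] in \<open>fastforce simp: eventually_at_right_field dist_norm\<close>)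
    moreover have "integral {- x..- x + h} (\<lambda>x. g0 (- x)) = integral {x - h..x} g0" for h
      using Henstock_Kurzweil_Integration.integral_reflect_real[of x "x - h" g0] by simp
    ultimately have Lm: "((\<lambda>h. integral {x - h..x} g0 /\<^sub>R h) \<longlongrightarrow> g0 x) (at_right 0)" by simp
    show ?case
    proof
      assume x: "x \<in> {a<..<b}"
      then have "g0 x = g x" by (simp add: g0_def)
      have "((\<lambda>h. (1 / 2) *\<^sub>R (integral {x - h..x} g0 /\<^sub>R h + integral {x..x + h} g0 /\<^sub>R h)) \<longlongrightarrow> (1 / 2) *\<^sub>R (g0 x + g0 x)) (at_right 0)"
        by (intro tendsto_intros Lm R)
      then have lim: "((\<lambda>h. (1 / 2) *\<^sub>R (integral {x - h..x} g0 /\<^sub>R h + integral {x..x + h} g0 /\<^sub>R h)) \<longlongrightarrow> g x) (at_right 0)"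
        using \<open>g0 x = g x\<close> by (simp add: scaleR_2[symmetric])
      show "((\<lambda>h. integral\<^sup>L (ivl (x - h) (x + h)) g /\<^sub>R (2 * h)) \<longlongrightarrow> g x) (at_right 0)"
      proof (rule Lim_transform_eventually[OF lim])
        have "eventually (\<lambda>h. 0 < h \<and> h < min (x - a) (b - x)) (at_right 0)"
          using x by (auto simp: eventually_at_right_field intro!: exI[of _ "min (x - a) (b - x)"])
        then show "eventually (\<lambda>h. (1 / 2) *\<^sub>R (integral {x - h..x} g0 /\<^sub>R h + integral {x..x + h} g0 /\<^sub>R h)
            = integral\<^sup>L (ivl (x - h) (x + h)) g /\<^sub>R (2 * h)) (at_right 0)"
        proof eventually_elim
          case (elim h)
          have "integral\<^sup>L (ivl (x - h) (x + h)) g = integral\<^sup>L (ivl (x - h) (x + h)) g0"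
            using elim by (intro Bochner_Integration.integral_cong) (auto simp: g0_def space_restrict_space)
          also have "\<dots> = integral {x - h..x + h} g0"
            using set_borel_integral_eq_integral(2)[OF set, of "x - h" "x + h"]
            by (simp add: integral_restrict_space set_lebesgue_integral_def)
          also have "\<dots> = integral {x - h..x} g0 + integral {x..x + h} g0"
            using elim by (intro Henstock_Kurzweil_Integration.integral_combine[symmetric] hk) auto
          finally have eq: "integral\<^sup>L (ivl (x - h) (x + h)) g = integral {x - h..x} g0 + integral {x..x + h} g0" .
          show ?case
            unfolding eq by (simp only: scaleR_add_right scaleR_scaleR inverse_mult_distrib inverse_eq_divide[of "2::real"])
        qed
      qed
    qed
  qed
qed

lemma integral_unit_exp_symmetric:
  assumes "0 \<le> h"
  shows "integral\<^sup>L (ivl (t - h) (t + h)) (\<lambda>s. unit_exp I (real n * s))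
    = (if n = 0 then 2 * h else 2 * sin (real n * h) / real n) *\<^sub>R unit_exp I (real n * t)"
proof (cases "n = 0")
  case True
  then show ?thesis using integral_ivl_const[of "t - h" "t + h" "1::quat"] assms
    by (simp del: lebesgue_integral_const)
next
  case False
  define G where "G = (\<lambda>s. (sin (real n * s) / real n) *\<^sub>R 1 - (cos (real n * s) / real n) *\<^sub>R I)"
  have "(G has_vector_derivative unit_exp I (real n * s)) (at s within A)" for s A
  proof -
    have "(G has_vector_derivative cos (real n * s) *\<^sub>R 1 - (- sin (real n * s)) *\<^sub>R I) (at s within A)"
      unfolding G_def using False
      by (auto intro!: derivative_eq_intros simp: has_real_derivative_iff_has_vector_derivative[symmetric])
    then show ?thesis by (simp add: unit_exp_def of_real_def)
  qed
  then have "integral\<^sup>L (ivl (t - h) (t + h)) (\<lambda>s. unit_exp I (real n * s)) = G (t + h) - G (t - h)"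
    using assms by (intro integral_ivl_FTC continuous_intros) auto
  also have "\<dots> = (2 * sin (real n * h) / real n) *\<^sub>R (cos (real n * t) *\<^sub>R 1 + sin (real n * t) *\<^sub>R I)"
  proof -
    have "sin (real n * (t + h)) - sin (real n * (t - h)) = 2 * sin (real n * h) * cos (real n * t)"
      "cos (real n * (t + h)) - cos (real n * (t - h)) = - (2 * sin (real n * h) * sin (real n * t))"
      by (simp_all add: distrib_left right_diff_distrib sin_add sin_diff cos_add cos_diff)
    moreover have "G (t + h) - G (t - h)
        = ((sin (real n * (t + h)) - sin (real n * (t - h))) / real n) *\<^sub>R 1
          - ((cos (real n * (t + h)) - cos (real n * (t - h))) / real n) *\<^sub>R I"
      by (simp add: G_def diff_divide_distrib scaleR_left_diff_distrib)
    ultimately show ?thesis by (simp add: scaleR_add_right)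
  qed
  finally show ?thesis using False by (simp add: unit_exp_def of_real_def)
qed

lemma abs_le_mean_square:
  fixes x :: real
  assumes "0 < e" shows "\<bar>x\<bar> \<le> (e + x\<^sup>2 / e) / 2"
proof -
  have "0 \<le> (\<bar>x\<bar> - e)\<^sup>2" by simp
  then have "2 * \<bar>x\<bar> * e \<le> x\<^sup>2 + e\<^sup>2" by (simp add: power2_diff)
  then show ?thesis using assms by (simp add: field_simps power2_eq_square)
qed

lemma summable_mult_square:
  fixes x y :: "nat \<Rightarrow> real"
  assumes "summable (\<lambda>n. (x n)\<^sup>2)" "summable (\<lambda>n. (y n)\<^sup>2)"
  shows "summable (\<lambda>n. \<bar>x n * y n\<bar>)"
proof (rule summable_comparison_test')
  show "summable (\<lambda>n. ((x n)\<^sup>2 + (y n)\<^sup>2) / 2)"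
    by (intro summable_divide summable_add assms)
  have "0 \<le> (\<bar>x n\<bar> - \<bar>y n\<bar>)\<^sup>2" for n by simp
  from this[of n for n] show "norm \<bar>x n * y n\<bar> \<le> ((x n)\<^sup>2 + (y n)\<^sup>2) / 2" for n
    by (simp add: power2_diff abs_mult mult_ac)
qed

context
  fixes I and a :: "nat \<Rightarrow> quat"
  assumes I: "I \<in> imag_units" and a: "summable (\<lambda>n. (norm (a n))\<^sup>2)"
begin

lemma summable_power_mult:
  assumes "0 \<le> r" "r < 1"
  shows "summable (\<lambda>n. norm (r ^ n *\<^sub>R a n))"
proof -
  have "summable (\<lambda>n. (r\<^sup>2) ^ n)"
    using assms by (intro summable_geometric) (simp add: power2_eq_square abs_mult mult_le_one mult_strict_mono' power_less_one_iff flip: power2_eq_square)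
  then have "summable (\<lambda>n. (r ^ n)\<^sup>2)" by (simp add: power_mult[symmetric] mult.commute)
  from summable_mult_square[OF this a] show ?thesis by (simp add: abs_mult)
qed

text \<open>
  The Riesz-Fischer theorem, in the weak form that is needed: the integrals of the partial sums over
  subintervals converge to those of one integrable function.
\<close>

lemma circle_partial_sums_L1:
  obtains g where "integrable (ivl 0 (2 * pi)) g"
    "\<And>x y. 0 \<le> x \<Longrightarrow> y \<le> 2 * pi \<Longrightarrow>
      (\<lambda>N. integral\<^sup>L (ivl x y) (\<lambda>t. \<Sum>n<N. unit_exp I (real n * t) * a n)) \<longlonglongrightarrow> integral\<^sup>L (ivl x y) g"
proof -
  let ?M = "ivl 0 (2 * pi)"
  define S where "S = (\<lambda>N t. \<Sum>n<N. unit_exp I (real n * t) * a n)"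
  have contS: "continuous_on A (S N)" for A N unfolding S_def by (intro continuous_intros)
  have sq: "integral\<^sup>L ?M (\<lambda>t. (norm (S i t - S j t))\<^sup>2) = 2 * pi * (\<Sum>n\<in>{j..<i}. (norm (a n))\<^sup>2)" if "j \<le> i" for i j
  proof -
    define b where "b = (\<lambda>n. if n \<in> {j..<i} then a n else 0)"
    have diff: "circle_series I b t = S i t - S j t" for t
    proof -
      have "circle_series I b t = (\<Sum>n\<in>{j..<i}. unit_exp I (real n * t) * b n)"
        unfolding circle_series_def by (rule suminf_finite) (auto simp: b_def)
      also have "\<dots> = (\<Sum>n\<in>{j..<i}. unit_exp I (real n * t) * a n)" by (simp add: b_def)
      also have "\<dots> = S i t - S j t"
        unfolding S_def using sum_diff_nat_ivl[OF le0 that, of "\<lambda>n. unit_exp I (real n * t) * a n"]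
        by (simp add: lessThan_atLeast0)
      finally show ?thesis .
    qed
    have "summable (\<lambda>n. norm (b n))"
      by (rule summable_finite[of "{j..<i}"]) (auto simp: b_def)
    from parseval_norm[OF I this] have "integral\<^sup>L ?M (\<lambda>t. (norm (circle_series I b t))\<^sup>2) = (\<Sum>n. 2 * pi * (norm (b n))\<^sup>2)"
      by (simp add: sums_iff)
    also have "\<dots> = (\<Sum>n\<in>{j..<i}. 2 * pi * (norm (b n))\<^sup>2)"
      by (rule suminf_finite) (auto simp: b_def)
    also have "\<dots> = 2 * pi * (\<Sum>n\<in>{j..<i}. (norm (a n))\<^sup>2)"
      by (simp add: sum_distrib_left b_def)
    finally show ?thesis by (simp only: diff)
  qed
  have cau: "\<exists>N. \<forall>i\<ge>N. \<forall>j\<ge>N. (LINT t|?M. norm (S i t - S j t)) < e" if e: "e > 0" for e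
  proof -
    \<comment> \<open>the bound \<open>\<bar>x\<bar> \<le> (d + x\<^sup>2 / d) / 2\<close> plays the role of the Cauchy-Schwarz inequality\<close>
    define d where "d = e / (4 * pi)"
    have d: "0 < d" using e by (simp add: d_def)
    obtain N where N: "\<And>m n. m \<ge> N \<Longrightarrow> norm (\<Sum>k\<in>{m..<n}. (norm (a k))\<^sup>2) < d\<^sup>2"
      using a d unfolding summable_Cauchy by (meson zero_less_power)
    have le: "(LINT t|?M. norm (S i t - S j t)) < e" if ij: "N \<le> j" "j \<le> i" for i j
    proof -
      have "(LINT t|?M. norm (S i t - S j t)) \<le> (LINT t|?M. d / 2 + (norm (S i t - S j t))\<^sup>2 / (2 * d))"
        using abs_le_mean_square[OF d, of "norm (S i t - S j t)" for t] d
        by (intro integral_mono integrable_ivl_continuous continuous_intros contS) (auto simp: field_simps)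
      also have "\<dots> = (2 * pi) * (d / 2) + 2 * pi * (\<Sum>n\<in>{j..<i}. (norm (a n))\<^sup>2) / (2 * d)"
        using d integral_ivl_const[of 0 "2 * pi" "d / 2"]
        by (subst Bochner_Integration.integral_add)
           (auto intro!: integrable_ivl_continuous continuous_intros contS simp: sq[OF ij(2)] simp del: lebesgue_integral_const)
      also have "\<dots> \<le> (2 * pi) * (d / 2) + 2 * pi * d\<^sup>2 / (2 * d)"
        using N[OF ij(1), of i] d by (intro add_left_mono divide_right_mono mult_left_mono) auto
      also have "\<dots> = 2 * pi * d" using d by (simp add: power2_eq_square)
      also have "\<dots> < e" using e by (simp add: d_def)
      finally show ?thesis .
    qed
    have "(LINT t|?M. norm (S i t - S j t)) < e" if "N \<le> i" "N \<le> j" for i j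
      using le[of i j] le[of j i] that by (cases "j \<le> i") (auto simp: norm_minus_commute)
    then show ?thesis by blast
  qed
  obtain g where g: "integrable ?M g" and lim: "(\<lambda>n. LINT t|?M. norm (S n t - g t)) \<longlonglongrightarrow> 0"
    by (rule L1_complete[OF integrable_ivl_continuous[OF contS] cau])
  have "(\<lambda>N. integral\<^sup>L (ivl x y) (S N)) \<longlonglongrightarrow> integral\<^sup>L (ivl x y) g" if xy: "0 \<le> x" "y \<le> 2 * pi" for x y
  proof (rule LIM_zero_cancel, rule Lim_null_comparison[OF always_eventually lim], rule allI)
    fix n
    have gi: "integrable (ivl x y) g" by (rule integrable_ivl_subset[OF g xy])
    have "norm (integral\<^sup>L (ivl x y) (S n) - integral\<^sup>L (ivl x y) g) = norm (integral\<^sup>L (ivl x y) (\<lambda>t. S n t - g t))"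
      by (subst Bochner_Integration.integral_diff) (auto intro!: gi integrable_ivl_continuous contS)
    also have "\<dots> \<le> integral\<^sup>L (ivl x y) (\<lambda>t. norm (S n t - g t))" by (rule integral_norm_bound)
    also have "\<dots> \<le> integral\<^sup>L ?M (\<lambda>t. norm (S n t - g t))"
      by (intro integral_ivl_mono_set xy integrable_norm Bochner_Integration.integrable_diff g integrable_ivl_continuous contS) simp
    finally show "norm (integral\<^sup>L (ivl x y) (S n) - integral\<^sup>L (ivl x y) g) \<le> (LINT t|?M. norm (S n t - g t))" .
  qed
  with g show thesis unfolding S_def by (rule that)
qed

text \<open>
  Fatou's theorem for square summable coefficients: the partial sums converge in \<open>L\<^sup>1\<close> to some
  \<open>g\<close>, and at each point where the symmetric means of \<open>g\<close> converge to \<open>g\<close> the Abel means converge.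
\<close>

lemma AE_radial_limit:
  "AE t in lborel. t \<in> {0<..<2 * pi} \<longrightarrow>
    (\<exists>L. ((\<lambda>r. circle_series I (\<lambda>n. r ^ n *\<^sub>R a n) t) \<longlongrightarrow> L) (at_left 1))"
proof -
  obtain g where g: "integrable (ivl 0 (2 * pi)) g" and lim: "\<And>x y. 0 \<le> x \<Longrightarrow> y \<le> 2 * pi \<Longrightarrow>
      (\<lambda>N. integral\<^sup>L (ivl x y) (\<lambda>t. \<Sum>n<N. unit_exp I (real n * t) * a n)) \<longlonglongrightarrow> integral\<^sup>L (ivl x y) g"
    by (rule circle_partial_sums_L1) blast
  from AE_symmetric_derivative[OF g] show ?thesis
  proof eventually_elim
    case (elim t)
    show ?case
    proof
      assume t: "t \<in> {0<..<2 * pi}"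
      \<comment> \<open>the symmetric integral of the series splits off its constant term and becomes a sine series\<close>
      define c where "c = (\<lambda>n. if n = 0 then 0 else unit_exp I (real n * t) * a n)"
      have "summable (\<lambda>n. \<bar>norm (a n) * (1 / real n)\<bar>)"
        using inverse_power_summable[of 2, where 'a = real]
        by (intro summable_mult_square a) (simp add: field_simps power_one_over)
      then have sm: "summable (\<lambda>n. norm (c n) / real n)"
        by (rule summable_comparison_test') (auto simp: c_def norm_mult norm_unit_exp[OF I])
      define \<phi> where "\<phi> = (\<lambda>h. \<Sum>n. (sin (real n * h) / real n) *\<^sub>R c n)"
      have sm\<phi>: "summable (\<lambda>n. (sin (real n * h) / real n) *\<^sub>R c n)" for h
        by (rule summable_comparison_test'[OF sm])
           (use mult_right_mono[OF abs_sin_le_one[of "real n * h" for n], of "norm (c n) / real n" for n] in simp)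
      have val: "\<phi> h /\<^sub>R h = integral\<^sup>L (ivl (t - h) (t + h)) g /\<^sub>R (2 * h) - a 0"
        if h: "0 < h" "h < min t (2 * pi - t)" for h
      proof -
        have "integral\<^sup>L (ivl (t - h) (t + h)) (\<lambda>s. \<Sum>n<N. unit_exp I (real n * s) * a n)
            = (\<Sum>n<N. integral\<^sup>L (ivl (t - h) (t + h)) (\<lambda>s. unit_exp I (real n * s)) * a n)" for N
          by (subst Bochner_Integration.integral_sum)
             (auto intro!: integrable_ivl_continuous continuous_intros sum.cong Bochner_Integration.integral_mult_left)
        also have "\<dots> N = (\<Sum>n<N. 2 *\<^sub>R ((sin (real n * h) / real n) *\<^sub>R c n) + (if n = 0 then (2 * h) *\<^sub>R a n else 0))" for N
          using h by (intro sum.cong refl) (simp add: integral_unit_exp_symmetric c_def)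
        finally have "(\<lambda>n. 2 *\<^sub>R ((sin (real n * h) / real n) *\<^sub>R c n) + (if n = 0 then (2 * h) *\<^sub>R a n else 0))
            sums integral\<^sup>L (ivl (t - h) (t + h)) g"
          using lim[of "t - h" "t + h"] h by (simp add: sums_def)
        moreover have "(\<lambda>n. 2 *\<^sub>R ((sin (real n * h) / real n) *\<^sub>R c n) + (if n = 0 then (2 * h) *\<^sub>R a n else 0))
            sums (2 *\<^sub>R \<phi> h + (2 * h) *\<^sub>R a 0)"
          unfolding \<phi>_def by (intro sums_add sums_scaleR_right summable_sums sm\<phi> sums_single)
        ultimately have "integral\<^sup>L (ivl (t - h) (t + h)) g = 2 *\<^sub>R \<phi> h + (2 * h) *\<^sub>R a 0"
          by (rule sums_unique2)
        then show ?thesis using h by (simp add: scaleR_add_right)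
      qed
      have "((\<lambda>h. integral\<^sup>L (ivl (t - h) (t + h)) g /\<^sub>R (2 * h) - a 0) \<longlongrightarrow> g t - a 0) (at_right 0)"
        using elim t by (intro tendsto_intros) auto
      then have "((\<lambda>h. \<phi> h /\<^sub>R h) \<longlongrightarrow> g t - a 0) (at_right 0)"
      proof (rule Lim_transform_eventually)
        show "eventually (\<lambda>h. integral\<^sup>L (ivl (t - h) (t + h)) g /\<^sub>R (2 * h) - a 0 = \<phi> h /\<^sub>R h) (at_right 0)"
          using t val by (auto simp: eventually_at_right_field intro!: exI[of _ "min t (2 * pi - t)"])
      qed
      then have "((\<lambda>r. \<Sum>n. r ^ n *\<^sub>R c n) \<longlongrightarrow> g t - a 0) (at_left 1)"
        unfolding \<phi>_def by (rule abel_sum_of_lebesgue_sum[rotated 2]) (simp add: c_def, rule sm)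
      then have "((\<lambda>r. a 0 + (\<Sum>n. r ^ n *\<^sub>R c n)) \<longlongrightarrow> a 0 + (g t - a 0)) (at_left 1)"
        by (intro tendsto_intros)
      then have "((\<lambda>r. circle_series I (\<lambda>n. r ^ n *\<^sub>R a n) t) \<longlongrightarrow> a 0 + (g t - a 0)) (at_left 1)"
      proof (rule Lim_transform_eventually)
        have "eventually (\<lambda>r. 0 < r \<and> r < 1) (at_left (1::real))"
          by (auto simp: eventually_at_left_field intro!: exI[of _ 0])
        then show "eventually (\<lambda>r. a 0 + (\<Sum>n. r ^ n *\<^sub>R c n) = circle_series I (\<lambda>n. r ^ n *\<^sub>R a n) t) (at_left 1)"
        proof eventually_elim
          case (elim r)
          have "(\<lambda>n. unit_exp I (real n * t) * (r ^ n *\<^sub>R a n)) sums circle_series I (\<lambda>n. r ^ n *\<^sub>R a n) t"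
            unfolding circle_series_def using elim
            by (intro summable_sums summable_circle_term[OF I] summable_power_mult) auto
          then have "(\<lambda>n. unit_exp I (real n * t) * (r ^ n *\<^sub>R a n) - (if n = 0 then a n else 0)) sums
              (circle_series I (\<lambda>n. r ^ n *\<^sub>R a n) t - a 0)"
            by (intro sums_diff sums_single)
          moreover have "unit_exp I (real n * t) * (r ^ n *\<^sub>R a n) - (if n = 0 then a n else 0) = r ^ n *\<^sub>R c n" for n
            by (simp add: c_def)
          ultimately have "(\<lambda>n. r ^ n *\<^sub>R c n) sums (circle_series I (\<lambda>n. r ^ n *\<^sub>R a n) t - a 0)"
            by (simp only:)
          then show ?case by (subst sums_unique[symmetric], assumption) simp
        qed
      qed
      then show "\<exists>L. ((\<lambda>r. circle_series I (\<lambda>n. r ^ n *\<^sub>R a n) t) \<longlongrightarrow> L) (at_left 1)" ..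
    qed
  qed
qed

end


section \<open>Mean square convergence of the Abel means\<close>

lemma tannery_sequentially:
  fixes x :: "nat \<Rightarrow> nat \<Rightarrow> 'a::{real_normed_algebra, banach}"
  assumes "\<And>n. (\<lambda>j. x n j) \<longlonglongrightarrow> y n" "\<And>n j. norm (x n j) \<le> B n" "summable B"
  shows "(\<lambda>j. \<Sum>n. x n j) \<longlonglongrightarrow> (\<Sum>n. y n)"
  using tannerys_theorem[of x y sequentially B] assms by (simp add: always_eventually)

text \<open>Continuity in mean square of \<open>x \<mapsto> qconj x * u * x\<close>, with a free parameter instead of a product of norms.\<close>

lemma norm_sandwich_diff_le:
  fixes x y u :: quat
  assumes "0 < e" "norm u = 1"
  shows "norm (qconj x * u * x - qconj y * u * y) \<le> (1 + 1 / e) * (norm (x - y))\<^sup>2 + e * (norm y)\<^sup>2"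
proof -
  define d where "d = norm (x - y)"
  have "norm x \<le> d + norm y" using norm_triangle_ineq[of "x - y" y] by (simp add: d_def)
  have "qconj x * u * x - qconj y * u * y = qconj (x - y) * u * x + qconj y * u * (x - y)"
    by (simp add: qconj_diff algebra_simps)
  then have "norm (qconj x * u * x - qconj y * u * y) \<le> norm (qconj (x - y) * u * x) + norm (qconj y * u * (x - y))"
    using norm_triangle_ineq by simp
  also have "\<dots> = d * norm x + norm y * d" by (simp only: norm_mult norm_qconj assms(2) d_def mult_1_right)
  also have "\<dots> \<le> d * (d + norm y) + norm y * d"
    using \<open>norm x \<le> d + norm y\<close> by (intro add_right_mono mult_left_mono) (simp_all add: d_def)
  also have "\<dots> = d\<^sup>2 + 2 * (norm y * d)" by (simp add: power2_eq_square algebra_simps)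
  also have "2 * (norm y * d) \<le> d\<^sup>2 / e + e * (norm y)\<^sup>2"
  proof -
    have "0 \<le> (d - e * norm y)\<^sup>2 / e" using assms by simp
    also have "\<dots> = d\<^sup>2 / e + e * (norm y)\<^sup>2 - 2 * (norm y * d)"
      using assms by (simp add: power2_eq_square field_simps)
    finally show ?thesis by simp
  qed
  finally show ?thesis by (simp add: d_def algebra_simps)
qed

context
  fixes I and a :: "nat \<Rightarrow> quat" and \<rho> :: "nat \<Rightarrow> real" and F :: "real \<Rightarrow> quat"
  assumes I: "I \<in> imag_units" and a: "summable (\<lambda>n. (norm (a n))\<^sup>2)"
    and \<rho>: "\<And>j. 0 \<le> \<rho> j" "\<And>j. \<rho> j < 1" "\<rho> \<longlonglongrightarrow> 1"
    and F [measurable]: "F \<in> borel_measurable (ivl 0 (2 * pi))"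
    and lim: "AE t in ivl 0 (2 * pi). (\<lambda>j. circle_series I (\<lambda>n. \<rho> j ^ n *\<^sub>R a n) t) \<longlonglongrightarrow> F t"
begin

text \<open>The Abel mean of the boundary series with parameter \<open>\<rho> j\<close>.\<close>

abbreviation (input) abel_mean where "abel_mean j \<equiv> circle_series I (\<lambda>n. \<rho> j ^ n *\<^sub>R a n)"

lemma cont_abel_mean: "continuous_on A (abel_mean j)"
  by (intro continuous_on_circle_series[OF I] summable_power_mult[OF I a] \<rho>)

lemma measurable_abel_mean [measurable]: "abel_mean j \<in> borel_measurable (ivl 0 (2 * pi))"
  by (rule borel_measurable_integrable[OF integrable_ivl_continuous[OF cont_abel_mean]])

text \<open>
  Fatou's lemma, applied to the differences of Abel means, turns convergence almost everywhere into
  an estimate in mean square.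
\<close>

lemma abel_mean_L2_bound:
  "(\<integral>\<^sup>+t. (norm (abel_mean i t - F t))\<^sup>2 \<partial>ivl 0 (2 * pi)) \<le> ennreal (\<Sum>n. 2 * pi * ((1 - \<rho> i ^ n) * norm (a n))\<^sup>2)"
proof -
  let ?M = "ivl 0 (2 * pi)"
  have "AE t in ?M. ennreal ((norm (abel_mean i t - F t))\<^sup>2) = liminf (\<lambda>j. ennreal ((norm (abel_mean i t - abel_mean j t))\<^sup>2))"
    using lim
  proof eventually_elim
    case (elim t)
    then have "(\<lambda>j. ennreal ((norm (abel_mean i t - abel_mean j t))\<^sup>2)) \<longlonglongrightarrow> ennreal ((norm (abel_mean i t - F t))\<^sup>2)"
      by (intro tendsto_intros tendsto_ennrealI)
    then show ?case by (rule lim_imp_Liminf[OF sequentially_bot, symmetric])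
  qed
  then have "(\<integral>\<^sup>+t. (norm (abel_mean i t - F t))\<^sup>2 \<partial>?M) = (\<integral>\<^sup>+t. liminf (\<lambda>j. ennreal ((norm (abel_mean i t - abel_mean j t))\<^sup>2)) \<partial>?M)"
    by (rule nn_integral_cong_AE)
  also have "\<dots> \<le> liminf (\<lambda>j. \<integral>\<^sup>+t. ennreal ((norm (abel_mean i t - abel_mean j t))\<^sup>2) \<partial>?M)"
    by (rule nn_integral_liminf) measurable
  also have "\<dots> \<le> liminf (\<lambda>j. ennreal (\<Sum>n. 2 * pi * ((1 - \<rho> i ^ n) * norm (a n))\<^sup>2))"
  proof (rule Liminf_mono)
    have "eventually (\<lambda>j. \<rho> i < \<rho> j) sequentially"
      using order_tendstoD(1)[OF \<rho>(3) \<rho>(2)] .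
    then show "eventually (\<lambda>j. (\<integral>\<^sup>+t. ennreal ((norm (abel_mean i t - abel_mean j t))\<^sup>2) \<partial>?M)
        \<le> ennreal (\<Sum>n. 2 * pi * ((1 - \<rho> i ^ n) * norm (a n))\<^sup>2)) sequentially"
    proof eventually_elim
      case (elim j)
      define d where "d = (\<lambda>n. \<rho> i ^ n *\<^sub>R a n - \<rho> j ^ n *\<^sub>R a n)"
      have sm: "summable (\<lambda>n. norm (\<rho> k ^ n *\<^sub>R a n))" for k
        by (intro summable_power_mult[OF I a] \<rho>)
      have smd: "summable (\<lambda>n. norm (d n))"
        by (rule summable_comparison_test'[OF summable_add[OF sm[of i] sm[of j]]])
           (simp add: d_def norm_triangle_ineq4 del: norm_scaleR)
      have "abel_mean i t - abel_mean j t = circle_series I d t" for t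
        unfolding circle_series_def d_def right_diff_distrib
        by (intro suminf_diff summable_circle_term[OF I] sm)
      then have "(\<integral>\<^sup>+t. ennreal ((norm (abel_mean i t - abel_mean j t))\<^sup>2) \<partial>?M) = ennreal (integral\<^sup>L ?M (\<lambda>t. (norm (circle_series I d t))\<^sup>2))"
        by (simp only:) (intro nn_integral_eq_integral integrable_ivl_continuous continuous_intros continuous_on_circle_series[OF I smd], simp)
      also have "integral\<^sup>L ?M (\<lambda>t. (norm (circle_series I d t))\<^sup>2) = (\<Sum>n. 2 * pi * (norm (d n))\<^sup>2)"
        using parseval_norm[OF I smd] by (simp add: sums_iff)
      also have "\<dots> \<le> (\<Sum>n. 2 * pi * ((1 - \<rho> i ^ n) * norm (a n))\<^sup>2)"
      proof (rule suminf_le)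
        show "2 * pi * (norm (d n))\<^sup>2 \<le> 2 * pi * ((1 - \<rho> i ^ n) * norm (a n))\<^sup>2" for n
        proof -
          have "\<rho> i ^ n \<le> \<rho> j ^ n" using elim \<rho> by (intro power_mono) auto
          moreover have "\<rho> j ^ n \<le> 1" using \<rho> by (intro power_le_one) (auto simp: less_imp_le)
          ultimately have "\<bar>\<rho> i ^ n - \<rho> j ^ n\<bar> \<le> 1 - \<rho> i ^ n" by simp
          then have "norm (d n) \<le> (1 - \<rho> i ^ n) * norm (a n)"
            unfolding d_def scaleR_left_diff_distrib[symmetric] norm_scaleR by (intro mult_right_mono) auto
          then show ?thesis by (intro mult_left_mono power_mono) auto
        qed
        show "summable (\<lambda>n. 2 * pi * (norm (d n))\<^sup>2)" using parseval_norm[OF I smd] by (simp add: sums_iff)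
        show "summable (\<lambda>n. 2 * pi * ((1 - \<rho> i ^ n) * norm (a n))\<^sup>2)"
        proof (intro summable_mult summable_comparison_test'[OF a])
          fix n
          have "(1 - \<rho> i ^ n) * norm (a n) \<le> norm (a n)" "0 \<le> (1 - \<rho> i ^ n)"
            using \<rho>(1)[of i] \<rho>(2)[of i] by (auto intro!: mult_left_le_one_le power_le_one simp: less_imp_le)
          then show "norm (((1 - \<rho> i ^ n) * norm (a n))\<^sup>2) \<le> (norm (a n))\<^sup>2"
            unfolding real_norm_def abs_power2 by (intro power_mono mult_nonneg_nonneg norm_ge_zero)
        qed
      qed
      finally show ?case by (simp add: ennreal_leI)
    qed
  qed
  also have "\<dots> = ennreal (\<Sum>n. 2 * pi * ((1 - \<rho> i ^ n) * norm (a n))\<^sup>2)" by (simp add: Liminf_const)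
  finally show ?thesis .
qed

lemma integrable_diff_square: "integrable (ivl 0 (2 * pi)) (\<lambda>t. (norm (abel_mean i t - F t))\<^sup>2)"
  by (rule integrableI_bounded) (use abel_mean_L2_bound[of i] in \<open>auto simp: le_less_trans\<close>)

lemma integrable_limit_square: "integrable (ivl 0 (2 * pi)) (\<lambda>t. (norm (F t))\<^sup>2)"
proof (rule Bochner_Integration.integrable_bound)
  show "integrable (ivl 0 (2 * pi)) (\<lambda>t. 2 * (norm (abel_mean 0 t - F t))\<^sup>2 + 2 * (norm (abel_mean 0 t))\<^sup>2)"
    by (intro Bochner_Integration.integrable_add integrable_mult_right integrable_diff_square
          integrable_ivl_continuous continuous_intros cont_abel_mean)
  have "(norm y)\<^sup>2 \<le> 2 * (norm (x - y))\<^sup>2 + 2 * (norm x)\<^sup>2" for x y :: quat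
  proof -
    have "norm y \<le> norm (x - y) + norm x"
      using norm_triangle_ineq[of "y - x" x] by (simp add: norm_minus_commute)
    then have "(norm y)\<^sup>2 \<le> (norm (x - y) + norm x)\<^sup>2" by (intro power_mono) auto
    also have "\<dots> \<le> 2 * (norm (x - y))\<^sup>2 + 2 * (norm x)\<^sup>2"
      using zero_le_power2[of "norm (x - y) - norm x"] by (simp add: power2_sum power2_diff)
    finally show ?thesis .
  qed
  then show "AE t in ivl 0 (2 * pi). norm ((norm (F t))\<^sup>2) \<le> norm (2 * (norm (abel_mean 0 t - F t))\<^sup>2 + 2 * (norm (abel_mean 0 t))\<^sup>2)"
    by simp
qed simp

lemma abel_mean_L2_limit: "(\<lambda>j. LINT t|ivl 0 (2 * pi). (norm (abel_mean j t - F t))\<^sup>2) \<longlonglongrightarrow> 0"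
proof (rule Lim_null_comparison)
  have le: "0 \<le> 1 - \<rho> j ^ n" "1 - \<rho> j ^ n \<le> 1" for j n
    using \<rho>(1)[of j] \<rho>(2)[of j] by (auto intro!: power_le_one simp: less_imp_le)
  have sq: "((1 - \<rho> j ^ n) * norm (a n))\<^sup>2 \<le> (norm (a n))\<^sup>2" for j n
    using le[of j n] by (intro power_mono mult_left_le_one_le) auto
  have "norm (LINT t|ivl 0 (2 * pi). (norm (abel_mean j t - F t))\<^sup>2) \<le> (\<Sum>n. 2 * pi * ((1 - \<rho> j ^ n) * norm (a n))\<^sup>2)" for j
  proof -
    have nn: "0 \<le> (\<Sum>n. 2 * pi * ((1 - \<rho> j ^ n) * norm (a n))\<^sup>2)"
      by (intro suminf_nonneg summable_mult summable_comparison_test'[OF a]) (auto intro: sq)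
    have "ennreal (LINT t|ivl 0 (2 * pi). (norm (abel_mean j t - F t))\<^sup>2)
        = (\<integral>\<^sup>+t. (norm (abel_mean j t - F t))\<^sup>2 \<partial>ivl 0 (2 * pi))"
      by (intro nn_integral_eq_integral[symmetric] integrable_diff_square) simp
    also note abel_mean_L2_bound[of j]
    finally show ?thesis unfolding ennreal_le_iff[OF nn] by simp
  qed
  then show "eventually (\<lambda>j. norm (LINT t|ivl 0 (2 * pi). (norm (abel_mean j t - F t))\<^sup>2) \<le> (\<Sum>n. 2 * pi * ((1 - \<rho> j ^ n) * norm (a n))\<^sup>2)) sequentially"
    by (rule always_eventually[OF allI])
  have "(\<lambda>j. \<Sum>n. 2 * pi * ((1 - \<rho> j ^ n) * norm (a n))\<^sup>2) \<longlonglongrightarrow> (\<Sum>n. 2 * pi * ((1 - 1 ^ n) * norm (a n))\<^sup>2)"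
  proof (rule tannery_sequentially[where B = "\<lambda>n. 2 * pi * (norm (a n))\<^sup>2"])
    show "(\<lambda>j. 2 * pi * ((1 - \<rho> j ^ n) * norm (a n))\<^sup>2) \<longlonglongrightarrow> 2 * pi * ((1 - 1 ^ n) * norm (a n))\<^sup>2" for n
      by (intro tendsto_intros \<rho>(3))
    show "norm (2 * pi * ((1 - \<rho> j ^ n) * norm (a n))\<^sup>2) \<le> 2 * pi * (norm (a n))\<^sup>2" for n j
      using sq[of j n] by (simp add: abs_mult)
    show "summable (\<lambda>n. 2 * pi * (norm (a n))\<^sup>2)" by (intro summable_mult a)
  qed
  then show "(\<lambda>j. \<Sum>n. 2 * pi * ((1 - \<rho> j ^ n) * norm (a n))\<^sup>2) \<longlonglongrightarrow> 0" by simp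
qed

lemma cont_circle_sandwich:
  "continuous_on A (\<lambda>t. qconj (abel_mean j t) * unit_exp I (real k * t) * abel_mean j t)"
  by (intro continuous_intros cont_abel_mean)

lemma integrable_limit_sandwich:
  "integrable (ivl 0 (2 * pi)) (\<lambda>t. qconj (F t) * unit_exp I (real k * t) * F t)"
proof (rule Bochner_Integration.integrable_bound[OF integrable_limit_square])
  have "(\<lambda>t. unit_exp I (real k * t)) \<in> borel_measurable (ivl 0 (2 * pi))"
    by (intro borel_measurable_integrable integrable_ivl_continuous continuous_intros)
  then show "(\<lambda>t. qconj (F t) * unit_exp I (real k * t) * F t) \<in> borel_measurable (ivl 0 (2 * pi))" by measurable
qed (simp add: norm_mult norm_unit_exp[OF I] power2_eq_square)

text \<open>Parseval's identity for the boundary function, by passing to the limit in the Abel means.\<close>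

lemma integral_limit_sandwich:
  "integral\<^sup>L (ivl 0 (2 * pi)) (\<lambda>t. qconj (F t) * unit_exp I (real k * t) * F t)
    = (2 * pi) *\<^sub>R (\<Sum>n. qconj (a (n + k)) * a n)"
proof -
  let ?M = "ivl 0 (2 * pi)"
  define Q where "Q = (\<lambda>j. integral\<^sup>L ?M (\<lambda>t. qconj (abel_mean j t) * unit_exp I (real k * t) * abel_mean j t))"
  define L where "L = integral\<^sup>L ?M (\<lambda>t. qconj (F t) * unit_exp I (real k * t) * F t)"
  have "Q \<longlonglongrightarrow> L"
  proof (rule LIMSEQ_I)
    fix e :: real assume e: "0 < e"
    define S where "S = (LINT t|?M. (norm (F t))\<^sup>2)"
    have S: "0 \<le> S" by (simp add: S_def)
    define h where "h = e / (2 * (S + 1))"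
    have h: "0 < h" "h * S < e / 2 + 0"
      using e S by (auto simp: h_def field_simps)
    have "(\<lambda>j. (1 + 1 / h) * (LINT t|?M. (norm (abel_mean j t - F t))\<^sup>2)) \<longlonglongrightarrow> (1 + 1 / h) * 0"
      by (intro tendsto_intros abel_mean_L2_limit)
    then have "eventually (\<lambda>j. (1 + 1 / h) * (LINT t|?M. (norm (abel_mean j t - F t))\<^sup>2) < e / 2) sequentially"
      using e by (intro order_tendstoD(2)) auto
    then have "eventually (\<lambda>j. norm (Q j - L) < e) sequentially"
    proof eventually_elim
      case (elim j)
      have "norm (Q j - L) = norm (integral\<^sup>L ?M (\<lambda>t. qconj (abel_mean j t) * unit_exp I (real k * t) * abel_mean j t
           - qconj (F t) * unit_exp I (real k * t) * F t))"
        unfolding Q_def L_def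
        by (subst Bochner_Integration.integral_diff)
           (auto intro!: integrable_ivl_continuous cont_circle_sandwich integrable_limit_sandwich)
      also have "\<dots> \<le> integral\<^sup>L ?M (\<lambda>t. (1 + 1 / h) * (norm (abel_mean j t - F t))\<^sup>2 + h * (norm (F t))\<^sup>2)"
      proof (rule order.trans[OF integral_norm_bound integral_mono])
        show "integrable ?M (\<lambda>t. norm (qconj (abel_mean j t) * unit_exp I (real k * t) * abel_mean j t
           - qconj (F t) * unit_exp I (real k * t) * F t))"
          by (intro integrable_norm Bochner_Integration.integrable_diff integrable_limit_sandwich
                integrable_ivl_continuous[OF cont_circle_sandwich])
        show "integrable ?M (\<lambda>t. (1 + 1 / h) * (norm (abel_mean j t - F t))\<^sup>2 + h * (norm (F t))\<^sup>2)"
          by (intro Bochner_Integration.integrable_add integrable_mult_right integrable_diff_square integrable_limit_square)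
      qed (intro norm_sandwich_diff_le h norm_unit_exp I)
      also have "\<dots> = (1 + 1 / h) * (LINT t|?M. (norm (abel_mean j t - F t))\<^sup>2) + h * S"
        unfolding S_def
        by (simp add: integrable_diff_square integrable_limit_square)
      also have "\<dots> < e" using elim h by linarith
      finally show ?case .
    qed
    then show "\<exists>N. \<forall>n\<ge>N. norm (Q n - L) < e" by (simp add: eventually_sequentially)
  qed
  moreover have "Q \<longlonglongrightarrow> (2 * pi) *\<^sub>R (\<Sum>n. qconj (a (n + k)) * a n)"
  proof -
    have Q: "Q j = (2 * pi) *\<^sub>R (\<Sum>n. qconj (\<rho> j ^ (n + k) *\<^sub>R a (n + k)) * (\<rho> j ^ n *\<^sub>R a n))" for j
    proof -
      define b where "b = (\<lambda>n. \<rho> j ^ n *\<^sub>R a n)"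
      have b: "summable (\<lambda>n. norm (b n))" unfolding b_def by (intro summable_power_mult[OF I a] \<rho>)
      have sb: "summable (\<lambda>n. norm (shift_seq k b n))" using b by (simp add: summable_shift_seq)
      have "(\<lambda>n. (2 * pi) *\<^sub>R (qconj (b n) * shift_seq k b n)) sums
          integral\<^sup>L ?M (\<lambda>t. qconj (circle_series I b t) * circle_series I (shift_seq k b) t)"
        by (rule parseval[OF I b sb])
      also have "integral\<^sup>L ?M (\<lambda>t. qconj (circle_series I b t) * circle_series I (shift_seq k b) t) = Q j"
        unfolding Q_def b_def[symmetric] by (simp add: circle_series_shift[OF I b] mult.assoc)
      finally have "(\<lambda>n. (2 * pi) *\<^sub>R (qconj (b (n + k)) * b n)) sums Q j"
        by (subst (asm) sums_shift_seq[where h = "\<lambda>n x. (2 * pi) *\<^sub>R (qconj (b n) * x)"]) simp_all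
      then have s: "(\<lambda>n. (1 / (2 * pi)) *\<^sub>R ((2 * pi) *\<^sub>R (qconj (b (n + k)) * b n))) sums ((1 / (2 * pi)) *\<^sub>R Q j)"
        by (rule sums_scaleR_right)
      have "(\<Sum>n. qconj (b (n + k)) * b n) = (1 / (2 * pi)) *\<^sub>R Q j" using sums_unique[OF s] by simp
      then show ?thesis by (simp add: b_def)
    qed
    have "(\<lambda>j. (2 * pi) *\<^sub>R (\<Sum>n. qconj (\<rho> j ^ (n + k) *\<^sub>R a (n + k)) * (\<rho> j ^ n *\<^sub>R a n)))
        \<longlonglongrightarrow> (2 * pi) *\<^sub>R (\<Sum>n. qconj (1 ^ (n + k) *\<^sub>R a (n + k)) * (1 ^ n *\<^sub>R a n))"
    proof (intro tendsto_intros tannery_sequentially[where B = "\<lambda>n. \<bar>norm (a (n + k)) * norm (a n)\<bar>"])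
      show "summable (\<lambda>n. \<bar>norm (a (n + k)) * norm (a n)\<bar>)"
        by (rule summable_mult_square[OF _ a]) (use a in \<open>simp add: summable_iff_shift[of "\<lambda>n. (norm (a n))\<^sup>2" k]\<close>)
      fix n j
      have p: "\<bar>\<rho> j ^ m\<bar> \<le> 1" for m using \<rho>(1)[of j] \<rho>(2)[of j] by (simp add: power_le_one)
      have "norm (qconj (\<rho> j ^ (n + k) *\<^sub>R a (n + k)) * (\<rho> j ^ n *\<^sub>R a n))
         = (\<bar>\<rho> j ^ (n + k)\<bar> * norm (a (n + k))) * (\<bar>\<rho> j ^ n\<bar> * norm (a n))"
        by (simp only: norm_mult norm_qconj norm_scaleR)
      also have "\<dots> \<le> (1 * norm (a (n + k))) * (1 * norm (a n))"
        using p by (intro mult_mono) auto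
      finally show "norm (qconj (\<rho> j ^ (n + k) *\<^sub>R a (n + k)) * (\<rho> j ^ n *\<^sub>R a n)) \<le> \<bar>norm (a (n + k)) * norm (a n)\<bar>"
        by simp
    qed (rule \<rho>(3))+
    then show ?thesis unfolding Q[symmetric] by simp
  qed
  ultimately show ?thesis unfolding L_def by (rule LIMSEQ_unique)
qed

end


section \<open>Uniqueness of cosine coefficients\<close>

lemma integrable_ivl_scaleR_continuous:
  fixes g :: "real \<Rightarrow> 'a::{banach, second_countable_topology}"
  assumes g: "integrable (ivl a b) g" and p: "continuous_on {a..b} p"
  shows "integrable (ivl a b) (\<lambda>t. p t *\<^sub>R g t)"
proof -
  obtain C where C: "\<forall>t\<in>{a..b}. norm (p t) \<le> C" using continuous_on_Icc_bounded[OF p] by blast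
  show ?thesis
  proof (rule Bochner_Integration.integrable_bound)
    show "integrable (ivl a b) (\<lambda>t. C * norm (g t))" by (intro integrable_mult_right integrable_norm g)
    show "(\<lambda>t. p t *\<^sub>R g t) \<in> borel_measurable (ivl a b)"
      by (intro borel_measurable_scaleR measurable_ivl_continuous p borel_measurable_integrable g)
    have bd: "norm (p t *\<^sub>R g t) \<le> norm (C * norm (g t))" if t: "t \<in> {a..b}" for t
    proof -
      have "norm (p t) * norm (g t) \<le> C * norm (g t)" using C t by (intro mult_right_mono) auto
      also have "\<dots> \<le> norm (C * norm (g t))" unfolding real_norm_def by (rule abs_ge_self)
      finally show ?thesis by (simp only: norm_scaleR real_norm_def)
    qed
    show "AE t in ivl a b. norm (p t *\<^sub>R g t) \<le> norm (C * norm (g t))"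
    proof (rule AE_I2)
      fix t assume "t \<in> space (ivl a b)"
      then have "t \<in> {a..b}" by (simp add: space_restrict_space)
      then show "norm (p t *\<^sub>R g t) \<le> norm (C * norm (g t))" by (rule bd)
    qed
  qed
qed

context
  fixes g :: "real \<Rightarrow> 'a::euclidean_space"
  assumes g: "integrable (ivl 0 pi) g"
    and zero: "\<And>k::nat. integral\<^sup>L (ivl 0 pi) (\<lambda>t. cos (real k * t) *\<^sub>R g t) = 0"
begin

text \<open>
  A function with vanishing cosine coefficients is orthogonal to the polynomials in \<open>cos t\<close>, hence,
  by the Weierstrass theorem in the variable \<open>cos t\<close>, to all continuous functions on \<open>[0, pi]\<close>.
\<close>

lemma integral_cos_power_zero:
  "integral\<^sup>L (ivl 0 pi) (\<lambda>t. (cos t ^ m * cos (of_int k * t)) *\<^sub>R g t) = 0"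
proof (induction m arbitrary: k)
  case 0
  have "cos (of_int k * t) = cos (real (nat \<bar>k\<bar>) * t)" for t :: real
  proof (cases "0 \<le> k")
    case False
    then have "of_int k * t = - (real (nat \<bar>k\<bar>) * t)" by simp
    then show ?thesis by (simp only: cos_minus)
  qed simp
  then show ?case using zero[of "nat \<bar>k\<bar>"] by simp
next
  case (Suc m)
  have int: "integrable (ivl 0 pi) (\<lambda>t. (cos t ^ m * cos (of_int j * t)) *\<^sub>R g t)" for j
    by (intro integrable_ivl_scaleR_continuous g continuous_intros)
  have "(cos t ^ Suc m * cos (of_int k * t)) *\<^sub>R g t = (1 / 2) *\<^sub>R ((cos t ^ m * cos (of_int (k + 1) * t)) *\<^sub>R g t
      + (cos t ^ m * cos (of_int (k - 1) * t)) *\<^sub>R g t)" for t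
  proof -
    have "cos t * cos (of_int k * t) = (cos (of_int (k + 1) * t) + cos (of_int (k - 1) * t)) / 2"
      by (simp add: distrib_right left_diff_distrib cos_add cos_diff)
    then have "cos t ^ m * (cos t * cos (of_int k * t)) = cos t ^ m * ((cos (of_int (k + 1) * t) + cos (of_int (k - 1) * t)) / 2)"
      by (rule arg_cong)
    then have "cos t ^ Suc m * cos (of_int k * t) = (1 / 2) * (cos t ^ m * cos (of_int (k + 1) * t) + cos t ^ m * cos (of_int (k - 1) * t))"
      by (simp only: power_Suc2 mult.assoc distrib_left add_divide_distrib times_divide_eq_left times_divide_eq_right mult_1_left)
    then show ?thesis by (simp only: scaleR_scaleR[symmetric] scaleR_add_left)
  qed
  then have "integral\<^sup>L (ivl 0 pi) (\<lambda>t. (cos t ^ Suc m * cos (of_int k * t)) *\<^sub>R g t)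
     = (1 / 2) *\<^sub>R (integral\<^sup>L (ivl 0 pi) (\<lambda>t. (cos t ^ m * cos (of_int (k + 1) * t)) *\<^sub>R g t)
       + integral\<^sup>L (ivl 0 pi) (\<lambda>t. (cos t ^ m * cos (of_int (k - 1) * t)) *\<^sub>R g t))"
    by (simp only: integral_scaleR_right Bochner_Integration.integral_add[OF int int])
  then show ?case by (simp only: Suc.IH add_0 scaleR_zero_right)
qed

lemma integral_continuous_zero:
  assumes p: "continuous_on {0..pi} p"
  shows "integral\<^sup>L (ivl 0 pi) (\<lambda>t. p t *\<^sub>R g t) = 0"
proof -
  define C where "C = (LINT t|ivl 0 pi. norm (g t))"
  have C: "0 \<le> C" by (simp add: C_def)
  have "norm (integral\<^sup>L (ivl 0 pi) (\<lambda>t. p t *\<^sub>R g t)) \<le> 0 + e" if e: "0 < e" for e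
  proof -
    define d where "d = e / (C + 1)"
    have d: "0 < d" "d * C \<le> e" using e C by (auto simp: d_def field_simps)
    have "continuous_on {-1..1} (p \<circ> arccos)"
    proof (rule continuous_on_compose[OF continuous_on_arccos'])
      show "continuous_on (arccos ` {- 1..1}) p"
        by (rule continuous_on_subset[OF p]) (auto simp: arccos_lbound arccos_ubound)
    qed
    then obtain q where q: "real_polynomial_function q" "\<And>x. x \<in> {-1..1} \<Longrightarrow> \<bar>(p \<circ> arccos) x - q x\<bar> < d"
      by (rule Stone_Weierstrass_real_polynomial_function[OF compact_Icc _ d(1)]) blast
    obtain a n where an: "q = (\<lambda>x. \<Sum>i\<le>n. a i * x ^ i)"
      using q(1) unfolding real_polynomial_function_iff_sum by blast
    have cq: "continuous_on A (\<lambda>t. q (cos t))" for A unfolding an by (intro continuous_intros)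
    have close: "\<bar>p t - q (cos t)\<bar> \<le> d" if "t \<in> {0..pi}" for t
      using q(2)[of "cos t"] that by (simp add: arccos_cos)
    have "integral\<^sup>L (ivl 0 pi) (\<lambda>t. q (cos t) *\<^sub>R g t)
        = integral\<^sup>L (ivl 0 pi) (\<lambda>t. \<Sum>i\<le>n. a i *\<^sub>R ((cos t ^ i * cos (of_int 0 * t)) *\<^sub>R g t))"
      by (simp add: an scaleR_sum_left)
    also have "\<dots> = (\<Sum>i\<le>n. a i *\<^sub>R integral\<^sup>L (ivl 0 pi) (\<lambda>t. (cos t ^ i * cos (of_int 0 * t)) *\<^sub>R g t))"
      by (subst Bochner_Integration.integral_sum)
         (intro integrable_scaleR_right integrable_ivl_scaleR_continuous g continuous_intros, simp only: integral_scaleR_right)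
    also have "\<dots> = 0" by (simp only: integral_cos_power_zero) simp
    finally have "integral\<^sup>L (ivl 0 pi) (\<lambda>t. p t *\<^sub>R g t)
        = integral\<^sup>L (ivl 0 pi) (\<lambda>t. p t *\<^sub>R g t) - integral\<^sup>L (ivl 0 pi) (\<lambda>t. q (cos t) *\<^sub>R g t)" by simp
    also have "\<dots> = integral\<^sup>L (ivl 0 pi) (\<lambda>t. (p t - q (cos t)) *\<^sub>R g t)"
      unfolding scaleR_left_diff_distrib
      by (intro Bochner_Integration.integral_diff[symmetric] integrable_ivl_scaleR_continuous g p cq)
    finally have "norm (integral\<^sup>L (ivl 0 pi) (\<lambda>t. p t *\<^sub>R g t)) \<le> integral\<^sup>L (ivl 0 pi) (\<lambda>t. norm ((p t - q (cos t)) *\<^sub>R g t))"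
      by (simp only: integral_norm_bound)
    also have "\<dots> \<le> integral\<^sup>L (ivl 0 pi) (\<lambda>t. d * norm (g t))"
    proof (rule integral_mono)
      show "integrable (ivl 0 pi) (\<lambda>t. norm ((p t - q (cos t)) *\<^sub>R g t))"
        by (intro integrable_norm integrable_ivl_scaleR_continuous g continuous_on_diff p cq)
      show "integrable (ivl 0 pi) (\<lambda>t. d * norm (g t))" by (intro integrable_mult_right integrable_norm g)
      show "norm ((p t - q (cos t)) *\<^sub>R g t) \<le> d * norm (g t)" if "t \<in> space (ivl 0 pi)" for t
        unfolding norm_scaleR by (intro mult_right_mono) (use close that in \<open>simp_all add: space_restrict_space\<close>)
    qed
    also have "\<dots> = d * C" by (simp add: C_def)
    also have "\<dots> \<le> e" by (rule d)
    finally show ?thesis by simp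
  qed
  then have "norm (integral\<^sup>L (ivl 0 pi) (\<lambda>t. p t *\<^sub>R g t)) \<le> 0" by (rule field_le_epsilon)
  then show ?thesis by simp
qed

lemma integral_subinterval_zero:
  assumes "0 \<le> c" "c \<le> d" "d \<le> pi"
  shows "integral\<^sup>L (ivl c d) g = 0"
proof -
  \<comment> \<open>continuous functions decreasing to the indicator function of the subinterval\<close>
  define p where "p = (\<lambda>(n::nat) t. max 0 (1 - real n * infdist t {c..d}))"
  have cont: "continuous_on A (p n)" for n A unfolding p_def by (intro continuous_intros)
  have "(\<lambda>n. integral\<^sup>L (ivl 0 pi) (\<lambda>t. p n t *\<^sub>R g t)) \<longlonglongrightarrow> integral\<^sup>L (ivl 0 pi) (\<lambda>t. indicator {c..d} t *\<^sub>R g t)"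
  proof (rule integral_dominated_convergence)
    show "integrable (ivl 0 pi) (\<lambda>t. norm (g t))" by (intro integrable_norm g)
    show "(\<lambda>t. indicator {c..d} t *\<^sub>R g t) \<in> borel_measurable (ivl 0 pi)"
    proof (rule borel_measurable_scaleR[OF _ borel_measurable_integrable[OF g]])
      show "(\<lambda>t. indicator {c..d} t :: real) \<in> borel_measurable (ivl 0 pi)"
        by (rule measurable_restrict_space1) simp
    qed
    show "(\<lambda>t. p n t *\<^sub>R g t) \<in> borel_measurable (ivl 0 pi)" for n
      by (intro borel_measurable_integrable integrable_ivl_scaleR_continuous g cont)
    show "AE t in ivl 0 pi. norm (p n t *\<^sub>R g t) \<le> norm (g t)" for n
      by (intro AE_I2) (auto intro!: mult_left_le_one_le simp: p_def infdist_nonneg)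
    have "(\<lambda>n. p n t) \<longlonglongrightarrow> indicator {c..d} t" for t
    proof (cases "t \<in> {c..d}")
      case True
      then show ?thesis by (simp add: p_def)
    next
      case False
      then have pos: "0 < infdist t {c..d}"
        using assms by (intro infdist_pos_not_in_closed) auto
      obtain N :: nat where N: "1 < real N * infdist t {c..d}" using reals_Archimedean3[OF pos] by blast
      have z: "p n t = 0" if "N \<le> n" for n
      proof -
        have "real N * infdist t {c..d} \<le> real n * infdist t {c..d}"
          using that pos by (intro mult_right_mono) auto
        with N show ?thesis unfolding p_def by (intro max_absorb1) linarith
      qed
      have "eventually (\<lambda>n. indicator {c..d} t = p n t) sequentially"
        by (rule eventually_sequentiallyI[of N]) (simp only: z indicator_simps(2)[OF False])
      then show ?thesis by (rule Lim_transform_eventually[OF tendsto_const])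
    qed
    then show "AE t in ivl 0 pi. (\<lambda>n. p n t *\<^sub>R g t) \<longlonglongrightarrow> indicator {c..d} t *\<^sub>R g t"
      by (intro AE_I2 tendsto_intros)
  qed
  then have "integral\<^sup>L (ivl 0 pi) (\<lambda>t. indicator {c..d} t *\<^sub>R g t) = 0"
    by (simp add: integral_continuous_zero[OF cont] LIMSEQ_const_iff)
  then have zero: "(LINT t|lborel. indicator {0..pi} t *\<^sub>R (indicator {c..d} t *\<^sub>R g t)) = 0"
    by (subst (asm) integral_restrict_space) simp_all
  have "indicator {0..pi} t *\<^sub>R (indicator {c..d} t *\<^sub>R g t) = indicator {c..d} t *\<^sub>R g t" for t
    using assms by (auto simp: indicator_def)
  with zero have "(LINT t|lborel. indicator {c..d} t *\<^sub>R g t) = 0" by (simp only:)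
  then show ?thesis by (subst integral_restrict_space) simp_all
qed

lemma AE_zero_of_cos_coeffs_zero: "AE t in lborel. t \<in> {0<..<pi} \<longrightarrow> g t = 0"
  using AE_symmetric_derivative[OF g]
proof eventually_elim
  case (elim t)
  show ?case
  proof
    assume t: "t \<in> {0<..<pi}"
    with elim have lim: "((\<lambda>h. integral\<^sup>L (ivl (t - h) (t + h)) g /\<^sub>R (2 * h)) \<longlongrightarrow> g t) (at_right 0)" by blast
    have "eventually (\<lambda>h. integral\<^sup>L (ivl (t - h) (t + h)) g /\<^sub>R (2 * h) = 0) (at_right 0)"
      using t by (auto simp: eventually_at_right_field integral_subinterval_zero intro!: exI[of _ "min t (pi - t)"])
    then have "((\<lambda>h. 0) \<longlongrightarrow> g t) (at_right (0::real))" by (rule Lim_transform_eventually[OF lim])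
    then show "g t = 0" by (simp add: tendsto_const_iff)
  qed
qed

end


section \<open>The even and odd parts of the boundary function\<close>

lemma quat_i_imag_unit: "Quat 0 1 0 0 \<in> imag_units"
  by (simp add: imag_units_iff norm_quat_def inner_quat_def)

lemma radial_sequence:
  "\<exists>\<rho>::nat \<Rightarrow> real. (\<forall>j. 0 \<le> \<rho> j \<and> \<rho> j < 1) \<and> \<rho> \<longlonglongrightarrow> 1 \<and> filterlim \<rho> (at_left 1) sequentially"
proof -
  define \<rho> where "\<rho> = (\<lambda>j. 1 - 1 / real (Suc j))"
  have 1: "0 \<le> \<rho> j" "\<rho> j < 1" for j by (simp_all add: \<rho>_def)
  have "\<rho> \<longlonglongrightarrow> 1 - 0"
    unfolding \<rho>_def by (intro tendsto_intros LIMSEQ_Suc[OF lim_1_over_n])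
  then have 2: "\<rho> \<longlonglongrightarrow> 1" by simp
  have 3: "filterlim \<rho> (at_left 1) sequentially"
    by (rule tendsto_imp_filterlim_at_left[OF 2]) (simp add: 1)
  from 1 2 3 show ?thesis by blast
qed

text \<open>
  On the slice of \<open>J\<close>, the series at the point with modulus \<open>r\<close> and angle \<open>t\<close> is
  \<open>cos_part a r t + J * sin_part a r t\<close>, and neither part depends on \<open>J\<close>.
\<close>

definition cos_part :: "(nat \<Rightarrow> quat) \<Rightarrow> real \<Rightarrow> real \<Rightarrow> quat" where
  "cos_part a r t = (\<Sum>n. cos (real n * t) *\<^sub>R (r ^ n *\<^sub>R a n))"

definition sin_part :: "(nat \<Rightarrow> quat) \<Rightarrow> real \<Rightarrow> real \<Rightarrow> quat" where
  "sin_part a r t = (\<Sum>n. sin (real n * t) *\<^sub>R (r ^ n *\<^sub>R a n))"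

context
  fixes a :: "nat \<Rightarrow> quat"
  assumes a: "summable (\<lambda>n. (norm (a n))\<^sup>2)"
begin

lemma summable_radial:
  assumes "0 \<le> r" "r < 1"
  shows "summable (\<lambda>n. norm (r ^ n *\<^sub>R a n))"
  by (rule summable_power_mult[OF quat_i_imag_unit a assms])

lemma summable_trig_radial:
  assumes "0 \<le> r" "r < 1"
  shows "summable (\<lambda>n. cos (real n * t) *\<^sub>R (r ^ n *\<^sub>R a n))" "summable (\<lambda>n. sin (real n * t) *\<^sub>R (r ^ n *\<^sub>R a n))"
  by (rule summable_comparison_test'[OF summable_radial[OF assms]],
      simp add: mult_left_le_one_le del: scaleR_scaleR)+

lemma circle_series_eq_parts:
  assumes "0 \<le> r" "r < 1"
  shows "circle_series J (\<lambda>n. r ^ n *\<^sub>R a n) t = cos_part a r t + J * sin_part a r t"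
proof -
  have "(\<lambda>n. cos (real n * t) *\<^sub>R (r ^ n *\<^sub>R a n) + J * (sin (real n * t) *\<^sub>R (r ^ n *\<^sub>R a n)))
      sums (cos_part a r t + J * sin_part a r t)"
    unfolding cos_part_def sin_part_def
    by (intro sums_add sums_mult summable_sums summable_trig_radial assms)
  moreover have "cos (real n * t) *\<^sub>R (r ^ n *\<^sub>R a n) + J * (sin (real n * t) *\<^sub>R (r ^ n *\<^sub>R a n))
      = unit_exp J (real n * t) * (r ^ n *\<^sub>R a n)" for n
    by (simp add: unit_exp_def of_real_def algebra_simps)
  ultimately show ?thesis by (simp only: circle_series_def sums_unique[symmetric])
qed

lemma cont_parts:
  assumes "0 \<le> r" "r < 1"
  shows "continuous_on A (cos_part a r)" "continuous_on A (sin_part a r)"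
  unfolding cos_part_def sin_part_def
  by (rule continuous_on_suminf_bounded[OF _ _ summable_radial[OF assms]],
      intro continuous_intros, simp add: mult_left_le_one_le del: scaleR_scaleR)+

lemma parts_reflect:
  assumes "0 \<le> r" "r < 1"
  shows "cos_part a r (2 * pi - t) = cos_part a r t" "sin_part a r (2 * pi - t) = - sin_part a r t"
proof -
  have "cos (real n * (2 * pi - t)) = cos (real n * t)" "sin (real n * (2 * pi - t)) = - sin (real n * t)" for n
    using cos_int_2pin[of "int n"] sin_int_2pin[of "int n"]
    by (simp_all add: right_diff_distrib cos_diff sin_diff mult_ac)
  then show "cos_part a r (2 * pi - t) = cos_part a r t" "sin_part a r (2 * pi - t) = - sin_part a r t"
    by (simp_all del: scaleR_scaleR add: cos_part_def sin_part_def suminf_minus[OF summable_trig_radial(2)[OF assms], symmetric])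
qed

text \<open>Both parts can be recovered from two opposite imaginary units.\<close>

lemma parts_from_slice:
  assumes "0 \<le> r" "r < 1" and i: "i \<in> imag_units"
  shows "cos_part a r t = (1 / 2) *\<^sub>R (circle_series i (\<lambda>n. r ^ n *\<^sub>R a n) t + circle_series (- i) (\<lambda>n. r ^ n *\<^sub>R a n) t)"
    "sin_part a r t = (- 1 / 2) *\<^sub>R (i * (circle_series i (\<lambda>n. r ^ n *\<^sub>R a n) t - circle_series (- i) (\<lambda>n. r ^ n *\<^sub>R a n) t))"
proof -
  have "(1 / 2) *\<^sub>R (x + i * y + (x + - i * y)) = x" for x y :: quat
    by (simp add: scaleR_2[symmetric])
  moreover have "(- 1 / 2) *\<^sub>R (i * (x + i * y - (x + - i * y))) = y" for x y :: quat
  proof -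
    have "i * (x + i * y - (x + - i * y)) = 2 *\<^sub>R ((i * i) * y)"
      by (simp add: scaleR_2 algebra_simps)
    then show ?thesis by (simp add: imag_units_square[OF i])
  qed
  ultimately show "cos_part a r t = (1 / 2) *\<^sub>R (circle_series i (\<lambda>n. r ^ n *\<^sub>R a n) t + circle_series (- i) (\<lambda>n. r ^ n *\<^sub>R a n) t)"
    "sin_part a r t = (- 1 / 2) *\<^sub>R (i * (circle_series i (\<lambda>n. r ^ n *\<^sub>R a n) t - circle_series (- i) (\<lambda>n. r ^ n *\<^sub>R a n) t))"
    by (simp_all only: circle_series_eq_parts[OF assms(1,2)])
qed

text \<open>The exceptional null set of angles is independent of the slice.\<close>

lemma AE_radial_limit_parts:
  obtains b c where "b \<in> borel_measurable borel" "c \<in> borel_measurable borel"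
    "AE t in lborel. t \<in> {0<..<2 * pi} \<longrightarrow>
       ((\<lambda>r. cos_part a r t) \<longlongrightarrow> b t) (at_left 1) \<and> ((\<lambda>r. sin_part a r t) \<longlongrightarrow> c t) (at_left 1)"
proof -
  define i where "i = Quat 0 1 0 0"
  have i: "i \<in> imag_units" "- i \<in> imag_units"
    using imag_units_uminus[OF quat_i_imag_unit] by (simp_all add: i_def quat_i_imag_unit)
  obtain \<rho> :: "nat \<Rightarrow> real" where \<rho>': "\<forall>j. 0 \<le> \<rho> j \<and> \<rho> j < 1"
      and lim1: "filterlim \<rho> (at_left 1) sequentially"
    using radial_sequence by blast
  have \<rho>: "0 \<le> \<rho> j" "\<rho> j < 1" for j using \<rho>' by simp_all
  define b where "b = (\<lambda>t. lim (\<lambda>j. cos_part a (\<rho> j) t))"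
  define c where "c = (\<lambda>t. lim (\<lambda>j. sin_part a (\<rho> j) t))"
  have b: "b \<in> borel_measurable borel"
    unfolding b_def by (intro borel_measurable_lim_metric borel_measurable_continuous_onI cont_parts \<rho>)
  have c: "c \<in> borel_measurable borel"
    unfolding c_def by (intro borel_measurable_lim_metric borel_measurable_continuous_onI cont_parts \<rho>)
  have ev: "eventually (\<lambda>r. 0 < r \<and> r < 1) (at_left (1::real))"
    by (auto simp: eventually_at_left_field intro!: exI[of _ 0])
  from AE_radial_limit[OF i(1) a] AE_radial_limit[OF i(2) a]
  have "AE t in lborel. t \<in> {0<..<2 * pi} \<longrightarrow>
       ((\<lambda>r. cos_part a r t) \<longlongrightarrow> b t) (at_left 1) \<and> ((\<lambda>r. sin_part a r t) \<longlongrightarrow> c t) (at_left 1)"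
  proof eventually_elim
    case (elim t)
    show ?case
    proof
      assume "t \<in> {0<..<2 * pi}"
      with elim obtain L1 L2 where L: "((\<lambda>r. circle_series i (\<lambda>n. r ^ n *\<^sub>R a n) t) \<longlongrightarrow> L1) (at_left 1)"
        "((\<lambda>r. circle_series (- i) (\<lambda>n. r ^ n *\<^sub>R a n) t) \<longlongrightarrow> L2) (at_left 1)" by blast
      have B: "((\<lambda>r. cos_part a r t) \<longlongrightarrow> (1 / 2) *\<^sub>R (L1 + L2)) (at_left 1)"
      proof (rule Lim_transform_eventually)
        show "((\<lambda>r. (1 / 2) *\<^sub>R (circle_series i (\<lambda>n. r ^ n *\<^sub>R a n) t + circle_series (- i) (\<lambda>n. r ^ n *\<^sub>R a n) t))
           \<longlongrightarrow> (1 / 2) *\<^sub>R (L1 + L2)) (at_left 1)" by (intro tendsto_intros L)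
      qed (use ev in eventually_elim, simp only: parts_from_slice(1)[OF _ _ i(1)] less_imp_le)
      have C: "((\<lambda>r. sin_part a r t) \<longlongrightarrow> (- 1 / 2) *\<^sub>R (i * (L1 - L2))) (at_left 1)"
      proof (rule Lim_transform_eventually)
        show "((\<lambda>r. (- 1 / 2) *\<^sub>R (i * (circle_series i (\<lambda>n. r ^ n *\<^sub>R a n) t - circle_series (- i) (\<lambda>n. r ^ n *\<^sub>R a n) t)))
           \<longlongrightarrow> (- 1 / 2) *\<^sub>R (i * (L1 - L2))) (at_left 1)" by (intro tendsto_intros L)
      qed (use ev in eventually_elim, simp only: parts_from_slice(2)[OF _ _ i(1)] less_imp_le)
      have "b t = (1 / 2) *\<^sub>R (L1 + L2)" "c t = (- 1 / 2) *\<^sub>R (i * (L1 - L2))"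
        unfolding b_def c_def by (intro limI filterlim_compose[OF B lim1] filterlim_compose[OF C lim1])+
      with B C show "((\<lambda>r. cos_part a r t) \<longlongrightarrow> b t) (at_left 1) \<and> ((\<lambda>r. sin_part a r t) \<longlongrightarrow> c t) (at_left 1)" by simp
    qed
  qed
  with b c show thesis by (rule that)
qed

end


section \<open>Pointwise algebra of the even and odd parts\<close>

lemma self_conj_iff: "x = qconj x \<longleftrightarrow> (norm x)\<^sup>2 = (qre x)\<^sup>2"
proof -
  have "(norm x)\<^sup>2 = (qre x)\<^sup>2 + ((qi x)\<^sup>2 + (qj x)\<^sup>2 + (qk x)\<^sup>2)"
    by (simp add: norm_quat_def inner_quat_def power2_eq_square)
  moreover have "(qi x)\<^sup>2 + (qj x)\<^sup>2 + (qk x)\<^sup>2 = 0 \<longleftrightarrow> qi x = 0 \<and> qj x = 0 \<and> qk x = 0"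
    by (simp add: add_nonneg_eq_0_iff)
  ultimately show ?thesis by (auto simp: quat_eq_iff)
qed

text \<open>
  The products \<open>y * qconj x\<close> and \<open>qconj y * x\<close> have the same norm and the same real part, so one
  is real if and only if the other is.
\<close>

lemma self_conj_swap:
  "y * qconj x = qconj (y * qconj x) \<longleftrightarrow> qconj y * x = qconj x * y"
proof -
  have "qre (y * qconj x) = qre (qconj y * x)" by (simp add: algebra_simps)
  moreover have "norm (y * qconj x) = norm (qconj y * x)" by (simp add: norm_mult)
  ultimately have "y * qconj x = qconj (y * qconj x) \<longleftrightarrow> qconj y * x = qconj (qconj y * x)"
    by (simp only: self_conj_iff)
  then show ?thesis by (simp add: qconj_mult)
qed

lemma norm_slice_sum:
  assumes "J \<in> imag_units"
  shows "(norm (x + J * y))\<^sup>2 = (norm x)\<^sup>2 + (norm y)\<^sup>2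
    - 2 * (qi J * qi (y * qconj x) + qj J * qj (y * qconj x) + qk J * qk (y * qconj x))"
proof -
  have "(norm (x + J * y))\<^sup>2 = (norm x)\<^sup>2 + 2 * inner x (J * y) + (norm (J * y))\<^sup>2"
    by (simp add: power2_norm_eq_inner inner_add_left inner_add_right inner_commute)
  also have "norm (J * y) = norm y" using assms by (simp add: norm_mult imag_units_iff)
  also have "inner x (J * y) = - (qi J * qi (y * qconj x) + qj J * qj (y * qconj x) + qk J * qk (y * qconj x))"
    using assms by (simp add: imag_units_iff inner_quat_def algebra_simps)
  finally show ?thesis by simp
qed

text \<open>Four imaginary units suffice to test whether \<open>x + J * y\<close> is unimodular for all \<open>J\<close>.\<close>

lemma unimodular_on_sphere:
  assumes "norm (x + Quat 0 0 1 0 * y) = 1" "norm (x + Quat 0 0 (-1) 0 * y) = 1"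
    "norm (x + Quat 0 (-1) 0 0 * y) = 1" "norm (x + Quat 0 0 (1 / sqrt 2) (1 / sqrt 2) * y) = 1"
  shows "(norm x)\<^sup>2 + (norm y)\<^sup>2 = 1 \<and> qconj y * x = qconj x * y"
proof -
  have S: "Quat 0 0 1 0 \<in> imag_units" "Quat 0 0 (-1) 0 \<in> imag_units"
    "Quat 0 (-1) 0 0 \<in> imag_units" "Quat 0 0 (1 / sqrt 2) (1 / sqrt 2) \<in> imag_units"
    by (simp_all add: imag_units_iff norm_quat_def inner_quat_def)
  define w where "w = y * qconj x"
  define s where "s = (norm x)\<^sup>2 + (norm y)\<^sup>2"
  have eqs: "s - 2 * qj w = 1" "s + 2 * qj w = 1" "s + 2 * qi w = 1" "s - 2 * (qj w / sqrt 2 + qk w / sqrt 2) = 1"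
    using norm_slice_sum[OF S(1), of x y] norm_slice_sum[OF S(2), of x y] norm_slice_sum[OF S(3), of x y]
      norm_slice_sum[OF S(4), of x y]
    unfolding assms w_def[symmetric] s_def[symmetric] by simp_all
  from eqs(1-3) have zero: "s = 1" "qi w = 0" "qj w = 0" by auto
  with eqs(4) have "qk w = 0" by simp
  with zero have "s = 1" "w = qconj w" by (simp_all add: quat_eq_iff)
  then show ?thesis unfolding w_def s_def self_conj_swap by simp
qed

lemma unimodular_on_sphere_converse:
  assumes "(norm x)\<^sup>2 + (norm y)\<^sup>2 = 1" "qconj y * x = qconj x * y" and J: "J \<in> imag_units"
  shows "norm (x + J * y) = 1"
proof -
  have "y * qconj x = qconj (y * qconj x)" using assms(2) by (simp only: self_conj_swap)
  then have "qi (y * qconj x) = 0" "qj (y * qconj x) = 0" "qk (y * qconj x) = 0"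
    unfolding quat_eq_iff[of "y * qconj x"] qconj.sel by linarith+
  then have "(norm (x + J * y))\<^sup>2 = 1" by (simp only: norm_slice_sum[OF J] assms(1)) simp
  then show ?thesis using norm_ge_zero[of "x + J * y"] by (simp add: power2_eq_1_iff)
qed

text \<open>Averaging over \<open>I\<close> and \<open>- I\<close> removes the dependence on the slice.\<close>

lemma sandwich_average:
  assumes I: "I \<in> imag_units"
  shows "qconj (x + I * y) * unit_exp I s * (x + I * y) + qconj (x + - I * y) * unit_exp (- I) s * (x + - I * y)
    = 2 *\<^sub>R (cos s *\<^sub>R of_real ((norm x)\<^sup>2 + (norm y)\<^sup>2) + sin s *\<^sub>R (qconj y * x - qconj x * y))"
proof -
  have II: "I * (I * z) = - z" for z by (simp add: mult.assoc[symmetric] imag_units_square[OF I])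
  have N: "of_real ((norm x)\<^sup>2 + (norm y)\<^sup>2) = qconj x * x + qconj y * y"
    by (simp only: of_real_add qconj_mult_self)
  show ?thesis
    unfolding N scaleR_2
    by (simp add: unit_exp_def of_real_def qconj_add qconj_diff qconj_mult qconj_minus imag_units_qconj[OF I]
        algebra_simps II)
qed


section \<open>The Fourier coefficients of the modulus on a sphere\<close>

lemma AE_ivl_open:
  assumes "AE t in lborel. t \<in> {a<..<b} \<longrightarrow> P t"
  shows "AE t in ivl a b. P t"
proof -
  have "AE t in lborel. t \<in> {a..b} \<longrightarrow> P t"
    using assms AE_lborel_singleton[of a] AE_lborel_singleton[of b] by eventually_elim auto
  then show ?thesis by (subst AE_restrict_space_iff) simp_all
qed

lemma integral_ivl_symmetric:
  fixes G :: "real \<Rightarrow> 'a::euclidean_space"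
  assumes [measurable]: "G \<in> borel_measurable borel" and int: "integrable (ivl 0 (2 * pi)) G"
    and sym: "AE t in lborel. t \<in> {0<..<2 * pi} \<longrightarrow> G (2 * pi - t) = G t"
  shows "integral\<^sup>L (ivl 0 (2 * pi)) G = 2 *\<^sub>R integral\<^sup>L (ivl 0 pi) G"
proof -
  have sub: "integrable lborel (\<lambda>t. indicator {x..y} t *\<^sub>R G t)" if "0 \<le> x" "y \<le> 2 * pi" for x y
    using integrable_ivl_subset[OF int that] by (simp add: integrable_restrict_space)
  have "integral\<^sup>L (ivl 0 (2 * pi)) G = (LINT t|lborel. indicator {0..2 * pi} t *\<^sub>R G t)"
    by (simp add: integral_restrict_space)
  also have "\<dots> = (LINT t|lborel. indicator {0..pi} t *\<^sub>R G t + indicator {pi..2 * pi} t *\<^sub>R G t)"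
  proof (rule integral_cong_AE)
    show "AE t in lborel. indicator {0..2 * pi} t *\<^sub>R G t = indicator {0..pi} t *\<^sub>R G t + indicator {pi..2 * pi} t *\<^sub>R G t"
      using AE_lborel_singleton[of pi] by eventually_elim (auto simp: indicator_def)
  qed measurable
  also have "\<dots> = (LINT t|lborel. indicator {0..pi} t *\<^sub>R G t) + (LINT t|lborel. indicator {pi..2 * pi} t *\<^sub>R G t)"
    by (intro Bochner_Integration.integral_add sub) simp_all
  also have "(LINT t|lborel. indicator {pi..2 * pi} t *\<^sub>R G t)
      = (LINT t|lborel. indicator {pi..2 * pi} (2 * pi + - 1 * t) *\<^sub>R G (2 * pi + - 1 * t))"
    using lborel_integral_real_affine[of "-1" "\<lambda>t. indicator {pi..2 * pi} t *\<^sub>R G t" "2 * pi"] by simp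
  also have "\<dots> = (LINT t|lborel. indicator {0..pi} t *\<^sub>R G t)"
  proof (rule integral_cong_AE)
    show "AE t in lborel. indicator {pi..2 * pi} (2 * pi + - 1 * t) *\<^sub>R G (2 * pi + - 1 * t) = indicator {0..pi} t *\<^sub>R G t"
      using sym AE_lborel_singleton[of 0]
    proof eventually_elim
      case (elim t)
      then show ?case using pi_gt_zero by (cases "t \<in> {0..pi}") (auto simp: indicator_def)
    qed
  qed measurable
  finally show ?thesis by (simp add: integral_restrict_space scaleR_2)
qed

text \<open>
  A square summable coefficient sequence together with Borel functions that are, for almost every
  angle, the radial limits of its two parts.
\<close>

locale boundary_parts =
  fixes a :: "nat \<Rightarrow> quat" and b c :: "real \<Rightarrow> quat"
  assumes a: "summable (\<lambda>n. (norm (a n))\<^sup>2)"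
    and b [measurable]: "b \<in> borel_measurable borel" and c [measurable]: "c \<in> borel_measurable borel"
    and limits: "AE t in lborel. t \<in> {0<..<2 * pi} \<longrightarrow>
       ((\<lambda>r. cos_part a r t) \<longlongrightarrow> b t) (at_left 1) \<and> ((\<lambda>r. sin_part a r t) \<longlongrightarrow> c t) (at_left 1)"
begin

lemma slice_sandwich:
  assumes I: "I \<in> imag_units"
  shows "integrable (ivl 0 (2 * pi)) (\<lambda>t. qconj (b t + I * c t) * unit_exp I (real k * t) * (b t + I * c t))" (is ?int)
    and "integral\<^sup>L (ivl 0 (2 * pi)) (\<lambda>t. qconj (b t + I * c t) * unit_exp I (real k * t) * (b t + I * c t))
      = (2 * pi) *\<^sub>R (\<Sum>n. qconj (a (n + k)) * a n)" (is ?eq)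
proof -
  obtain \<rho> :: "nat \<Rightarrow> real" where \<rho>': "\<forall>j. 0 \<le> \<rho> j \<and> \<rho> j < 1" and \<rho>1: "\<rho> \<longlonglongrightarrow> 1"
      and lim1: "filterlim \<rho> (at_left 1) sequentially"
    using radial_sequence by blast
  have \<rho>: "0 \<le> \<rho> j" "\<rho> j < 1" for j using \<rho>' by simp_all
  have meas: "(\<lambda>t. b t + I * c t) \<in> borel_measurable (ivl 0 (2 * pi))"
    by (intro measurable_restrict_space1) simp
  have "AE t in lborel. t \<in> {0<..<2 * pi} \<longrightarrow>
      (\<lambda>j. circle_series I (\<lambda>n. \<rho> j ^ n *\<^sub>R a n) t) \<longlonglongrightarrow> b t + I * c t"
    using limits
  proof eventually_elim
    case (elim t)
    show ?case
    proof
      assume "t \<in> {0<..<2 * pi}"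
      with elim have "((\<lambda>r. cos_part a r t) \<longlongrightarrow> b t) (at_left 1)" "((\<lambda>r. sin_part a r t) \<longlongrightarrow> c t) (at_left 1)" by simp_all
      then have "(\<lambda>j. cos_part a (\<rho> j) t + I * sin_part a (\<rho> j) t) \<longlonglongrightarrow> b t + I * c t"
        by (intro tendsto_intros) (auto intro: filterlim_compose[OF _ lim1])
      then show "(\<lambda>j. circle_series I (\<lambda>n. \<rho> j ^ n *\<^sub>R a n) t) \<longlonglongrightarrow> b t + I * c t"
        by (simp only: circle_series_eq_parts[OF a \<rho>])
    qed
  qed
  then have lim: "AE t in ivl 0 (2 * pi). (\<lambda>j. circle_series I (\<lambda>n. \<rho> j ^ n *\<^sub>R a n) t) \<longlonglongrightarrow> b t + I * c t"
    by (rule AE_ivl_open)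
  show ?int by (rule integrable_limit_sandwich[OF I a \<rho> \<rho>1 meas lim])
  show ?eq by (rule integral_limit_sandwich[OF I a \<rho> \<rho>1 meas lim])
qed

text \<open>
  The quaternion \<open>U t\<close> is the mean of the squared modulus over the sphere with angle \<open>t\<close>. The difference
  \<open>V t\<close> is twice the vector part of \<open>qconj (c t) * b t\<close>.
\<close>

definition U :: "real \<Rightarrow> quat" where "U t = of_real ((norm (b t))\<^sup>2 + (norm (c t))\<^sup>2)"
definition V :: "real \<Rightarrow> quat" where "V t = qconj (c t) * b t - qconj (b t) * c t"

lemma measurable_UV [measurable]: "U \<in> borel_measurable borel" "V \<in> borel_measurable borel"
  unfolding U_def[abs_def] V_def[abs_def] by measurable

lemma integrable_mean: "integrable (ivl 0 (2 * pi)) (\<lambda>t. cos (real k * t) *\<^sub>R U t + sin (real k * t) *\<^sub>R V t)" (is ?int)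
  and integral_mean: "integral\<^sup>L (ivl 0 (2 * pi)) (\<lambda>t. cos (real k * t) *\<^sub>R U t + sin (real k * t) *\<^sub>R V t)
      = (2 * pi) *\<^sub>R (\<Sum>n. qconj (a (n + k)) * a n)" (is ?eq)
proof -
  note i = quat_i_imag_unit imag_units_uminus[OF quat_i_imag_unit]
  have eq: "cos (real k * t) *\<^sub>R U t + sin (real k * t) *\<^sub>R V t = (1 / 2) *\<^sub>R
      (qconj (b t + Quat 0 1 0 0 * c t) * unit_exp (Quat 0 1 0 0) (real k * t) * (b t + Quat 0 1 0 0 * c t)
     + qconj (b t + - Quat 0 1 0 0 * c t) * unit_exp (- Quat 0 1 0 0) (real k * t) * (b t + - Quat 0 1 0 0 * c t))" for t
    unfolding sandwich_average[OF i(1)] U_def V_def by simp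
  show ?int unfolding eq
    by (intro integrable_scaleR_right Bochner_Integration.integrable_add slice_sandwich(1) i)
  show ?eq unfolding eq
    by (simp only: integral_scaleR_right Bochner_Integration.integral_add[OF slice_sandwich(1)[OF i(1)] slice_sandwich(1)[OF i(2)]]
          slice_sandwich(2)[OF i(1)] slice_sandwich(2)[OF i(2)]) (simp add: scaleR_2[symmetric])
qed

lemma UV_reflect: "AE t in lborel. t \<in> {0<..<2 * pi} \<longrightarrow> U (2 * pi - t) = U t \<and> V (2 * pi - t) = - V t"
  using limits AE_lborel_reflect[OF limits, of "2 * pi"]
proof eventually_elim
  case (elim t)
  show ?case
  proof
    assume t: "t \<in> {0<..<2 * pi}"
    have ev: "eventually (\<lambda>r. 0 < r \<and> r < 1) (at_left (1::real))"
      by (auto simp: eventually_at_left_field intro!: exI[of _ 0])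
    from t elim have L: "((\<lambda>r. cos_part a r t) \<longlongrightarrow> b t) (at_left 1)" "((\<lambda>r. sin_part a r t) \<longlongrightarrow> c t) (at_left 1)"
      "((\<lambda>r. cos_part a r (2 * pi - t)) \<longlongrightarrow> b (2 * pi - t)) (at_left 1)"
      "((\<lambda>r. sin_part a r (2 * pi - t)) \<longlongrightarrow> c (2 * pi - t)) (at_left 1)" by simp_all
    have "((\<lambda>r. cos_part a r t) \<longlongrightarrow> b (2 * pi - t)) (at_left 1)"
      by (rule Lim_transform_eventually[OF L(3)]) (use ev in eventually_elim, simp only: parts_reflect[OF a] less_imp_le)
    then have B: "b (2 * pi - t) = b t" by (rule tendsto_unique[OF trivial_limit_at_left_real _ L(1)])
    have "((\<lambda>r. - sin_part a r t) \<longlongrightarrow> c (2 * pi - t)) (at_left 1)"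
      by (rule Lim_transform_eventually[OF L(4)]) (use ev in eventually_elim, simp only: parts_reflect[OF a] less_imp_le)
    then have C: "c (2 * pi - t) = - c t" by (rule tendsto_unique[OF trivial_limit_at_left_real _ tendsto_minus[OF L(2)]])
    show "U (2 * pi - t) = U t \<and> V (2 * pi - t) = - V t"
      by (simp add: U_def V_def B C qconj_minus)
  qed
qed

lemma integral_half_mean:
  "integral\<^sup>L (ivl 0 pi) (\<lambda>t. cos (real k * t) *\<^sub>R U t + sin (real k * t) *\<^sub>R V t) = pi *\<^sub>R (\<Sum>n. qconj (a (n + k)) * a n)"
proof -
  let ?G = "\<lambda>t. cos (real k * t) *\<^sub>R U t + sin (real k * t) *\<^sub>R V t"
  have "AE t in lborel. t \<in> {0<..<2 * pi} \<longrightarrow> ?G (2 * pi - t) = ?G t"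
    using UV_reflect
  proof eventually_elim
    case (elim t)
    have "cos (real k * (2 * pi - t)) = cos (real k * t)" "sin (real k * (2 * pi - t)) = - sin (real k * t)"
      using cos_int_2pin[of "int k"] sin_int_2pin[of "int k"]
      by (simp_all add: right_diff_distrib cos_diff sin_diff mult_ac)
    with elim show ?case by simp
  qed
  then have "(2 * pi) *\<^sub>R (\<Sum>n. qconj (a (n + k)) * a n) = 2 *\<^sub>R integral\<^sup>L (ivl 0 pi) ?G"
    unfolding integral_mean[symmetric] by (intro integral_ivl_symmetric integrable_mean) measurable
  then have "2 *\<^sub>R (pi *\<^sub>R (\<Sum>n. qconj (a (n + k)) * a n)) = 2 *\<^sub>R integral\<^sup>L (ivl 0 pi) ?G"
    by (simp only: scaleR_scaleR)
  from real_vector.scale_left_imp_eq[OF _ this] show ?thesis by simp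
qed

lemma integrable_UV: "integrable (ivl 0 pi) U" "integrable (ivl 0 pi) V"
proof -
  have "integrable (ivl 0 (2 * pi)) U" using integrable_mean[of 0] by simp
  then show U: "integrable (ivl 0 pi) U" by (rule integrable_ivl_subset) simp_all
  show "integrable (ivl 0 pi) V"
  proof (rule Bochner_Integration.integrable_bound[OF U])
    show "V \<in> borel_measurable (ivl 0 pi)" by (intro measurable_restrict_space1) simp
    have "norm (V t) \<le> norm (U t)" for t
    proof -
      have "norm (V t) \<le> norm (c t) * norm (b t) + norm (b t) * norm (c t)"
        unfolding V_def by (rule order.trans[OF norm_triangle_ineq4]) (simp add: norm_mult)
      also have "\<dots> \<le> (norm (b t))\<^sup>2 + (norm (c t))\<^sup>2"
        using zero_le_power2[of "norm (b t) - norm (c t)"] by (simp add: power2_diff mult_ac)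
      also have "\<dots> = norm (U t)" by (simp only: U_def norm_of_real) simp
      finally show ?thesis .
    qed
    then show "AE t in ivl 0 pi. norm (V t) \<le> norm (U t)" by simp
  qed
qed

lemma integral_cos_one: "integral\<^sup>L (ivl 0 pi) (\<lambda>t. cos (real k * t) *\<^sub>R (1::quat)) = (if k = 0 then pi else 0) *\<^sub>R 1"
proof -
  have "integral\<^sup>L (ivl 0 pi) (\<lambda>t. cos (real k * t) *\<^sub>R (1::quat)) = integral\<^sup>L (ivl 0 pi) (\<lambda>t. cos (real k * t)) *\<^sub>R 1"
    by (intro integral_scaleR_left integrable_ivl_continuous continuous_intros)
  then show ?thesis by (simp only: integral_cos_ivl Ints_of_nat of_nat_eq_0_iff)
qed

text \<open>\<open>U - 1\<close> is real and \<open>V\<close> is purely imaginary, so taking conjugates separates their contributions.\<close>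

lemma UV_coeffs_zero:
  assumes orth: "\<And>k. (\<Sum>n. qconj (a (n + k)) * a n) = (if k = 0 then 1 else 0)"
  shows "integral\<^sup>L (ivl 0 pi) (\<lambda>t. cos (real k * t) *\<^sub>R (U t - 1)) = 0"
    and "integral\<^sup>L (ivl 0 pi) (\<lambda>t. sin (real k * t) *\<^sub>R V t) = 0"
proof -
  have intU: "integrable (ivl 0 pi) (\<lambda>t. cos (real k * t) *\<^sub>R U t)"
    and intV: "integrable (ivl 0 pi) (\<lambda>t. sin (real k * t) *\<^sub>R V t)"
    and int1: "integrable (ivl 0 pi) (\<lambda>t. cos (real k * t) *\<^sub>R (1::quat))"
    by (intro integrable_ivl_scaleR_continuous integrable_ivl_continuous integrable_UV continuous_intros)+
  define X where "X = integral\<^sup>L (ivl 0 pi) (\<lambda>t. cos (real k * t) *\<^sub>R (U t - 1))"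
  define Y where "Y = integral\<^sup>L (ivl 0 pi) (\<lambda>t. sin (real k * t) *\<^sub>R V t)"
  have X: "X = integral\<^sup>L (ivl 0 pi) (\<lambda>t. cos (real k * t) *\<^sub>R U t) - (if k = 0 then pi else 0) *\<^sub>R 1"
    unfolding X_def scaleR_diff_right integral_cos_one[symmetric] by (rule Bochner_Integration.integral_diff[OF intU int1])
  have S: "integral\<^sup>L (ivl 0 pi) (\<lambda>t. cos (real k * t) *\<^sub>R U t) + Y = pi *\<^sub>R (if k = 0 then 1 else 0)"
    unfolding Y_def Bochner_Integration.integral_add[OF intU intV, symmetric] integral_half_mean orth ..
  have "(if k = 0 then pi else 0) *\<^sub>R 1 = pi *\<^sub>R (if k = 0 then 1 else 0 :: quat)" by simp
  then have XY: "X + Y = 0" by (simp only: X diff_add_eq S diff_self)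
  have intU1: "integrable (ivl 0 pi) (\<lambda>t. cos (real k * t) *\<^sub>R (U t - 1))"
    unfolding scaleR_diff_right by (rule Bochner_Integration.integrable_diff[OF intU int1])
  have "qconj (cos (real k * t) *\<^sub>R (U t - 1)) = cos (real k * t) *\<^sub>R (U t - 1)" for t
    unfolding qconj_scaleR qconj_diff U_def qconj_of_real qconj_1 ..
  then have cX: "qconj X = X"
    unfolding X_def integral_bounded_linear[OF bounded_linear_qconj intU1, symmetric] by (simp only:)
  have "qconj (sin (real k * t) *\<^sub>R V t) = - (sin (real k * t) *\<^sub>R V t)" for t
    unfolding qconj_scaleR V_def qconj_diff qconj_mult qconj_qconj by (simp add: scaleR_diff_right)
  then have cY: "qconj Y = - Y"
    unfolding Y_def integral_bounded_linear[OF bounded_linear_qconj intV, symmetric] by (simp only: Bochner_Integration.integral_minus)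
  have "qconj X + qconj Y = 0" unfolding qconj_add[symmetric] XY by simp
  then have "X - Y = 0" by (simp add: cX cY)
  with XY have "X + X = 0" by (metis add_diff_cancel_left' add.commute add_diff_eq diff_add_cancel right_minus_eq)
  then have "X = 0" by (simp add: scaleR_2[symmetric])
  with XY show "X = 0" "Y = 0" by simp_all
qed

text \<open>
  Orthonormality of the shifts of \<open>a\<close> says that the unimodularity relations hold on almost every
  sphere. Necessity is the uniqueness of cosine coefficients, applied to \<open>U - 1\<close> and to
  \<open>sin t * V\<close>, whose cosine coefficients are differences of sine coefficients of \<open>V\<close>.
\<close>

lemma orthonormal_iff_unimodular:
  "(\<forall>k. (\<Sum>n. qconj (a (n + k)) * a n) = (if k = 0 then 1 else 0)) \<longleftrightarrow>
   (AE t in lborel. t \<in> {0<..<pi} \<longrightarrow> (norm (b t))\<^sup>2 + (norm (c t))\<^sup>2 = 1 \<and> qconj (c t) * b t = qconj (b t) * c t)"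
proof
  assume "\<forall>k. (\<Sum>n. qconj (a (n + k)) * a n) = (if k = 0 then 1 else 0)"
  then have orth: "(\<Sum>n. qconj (a (n + k)) * a n) = (if k = 0 then 1 else 0)" for k by blast
  note zero = UV_coeffs_zero[OF orth]
  have "AE t in lborel. t \<in> {0<..<pi} \<longrightarrow> U t - 1 = 0"
    by (rule AE_zero_of_cos_coeffs_zero[OF _ zero(1)])
       (rule Bochner_Integration.integrable_diff[OF integrable_UV(1) integrable_ivl_continuous[OF continuous_on_const]])
  moreover have "AE t in lborel. t \<in> {0<..<pi} \<longrightarrow> sin t *\<^sub>R V t = 0"
  proof (rule AE_zero_of_cos_coeffs_zero)
    show "integrable (ivl 0 pi) (\<lambda>t. sin t *\<^sub>R V t)"
      by (intro integrable_ivl_scaleR_continuous integrable_UV continuous_intros)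
    fix k :: nat
    show "integral\<^sup>L (ivl 0 pi) (\<lambda>t. cos (real k * t) *\<^sub>R (sin t *\<^sub>R V t)) = 0"
    proof (cases k)
      case 0
      then show ?thesis using zero(2)[of 1] by simp
    next
      case (Suc j)
      have "cos (real k * t) *\<^sub>R (sin t *\<^sub>R V t) = (1 / 2) *\<^sub>R (sin (real (Suc k) * t) *\<^sub>R V t - sin (real j * t) *\<^sub>R V t)" for t
      proof -
        have "real (Suc k) * t = real k * t + t" "real j * t = real k * t - t"
          by (simp_all add: Suc algebra_simps)
        then have "cos (real k * t) * sin t = (1 / 2) * (sin (real (Suc k) * t) - sin (real j * t))"
          by (simp only: sin_add sin_diff) simp
        then show ?thesis by (simp only: scaleR_scaleR scaleR_left_diff_distrib[symmetric])
      qed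
      then have "integral\<^sup>L (ivl 0 pi) (\<lambda>t. cos (real k * t) *\<^sub>R (sin t *\<^sub>R V t))
          = (1 / 2) *\<^sub>R (integral\<^sup>L (ivl 0 pi) (\<lambda>t. sin (real (Suc k) * t) *\<^sub>R V t) - integral\<^sup>L (ivl 0 pi) (\<lambda>t. sin (real j * t) *\<^sub>R V t))"
        by (simp only: integral_scaleR_right)
           (subst Bochner_Integration.integral_diff, (intro integrable_ivl_scaleR_continuous integrable_UV continuous_intros)+, rule refl)
      then show ?thesis by (simp only: zero(2) diff_self scaleR_zero_right)
    qed
  qed
  ultimately show "AE t in lborel. t \<in> {0<..<pi} \<longrightarrow> (norm (b t))\<^sup>2 + (norm (c t))\<^sup>2 = 1 \<and> qconj (c t) * b t = qconj (b t) * c t"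
  proof eventually_elim
    case (elim t)
    show ?case
    proof
      assume t: "t \<in> {0<..<pi}"
      then have "sin t \<noteq> 0" using sin_gt_zero[of t] by simp
      with elim t have "U t = 1" "V t = 0" by simp_all
      from this(1) have "of_real ((norm (b t))\<^sup>2 + (norm (c t))\<^sup>2) = (of_real 1 :: quat)" by (simp only: U_def of_real_1)
      then have "(norm (b t))\<^sup>2 + (norm (c t))\<^sup>2 = 1" by (simp only: of_real_eq_iff)
      moreover have "qconj (c t) * b t = qconj (b t) * c t" using \<open>V t = 0\<close> by (simp add: V_def)
      ultimately show "(norm (b t))\<^sup>2 + (norm (c t))\<^sup>2 = 1 \<and> qconj (c t) * b t = qconj (b t) * c t" ..
    qed
  qed
next
  assume "AE t in lborel. t \<in> {0<..<pi} \<longrightarrow> (norm (b t))\<^sup>2 + (norm (c t))\<^sup>2 = 1 \<and> qconj (c t) * b t = qconj (b t) * c t"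
  then have UV: "AE t in ivl 0 pi. (norm (b t))\<^sup>2 + (norm (c t))\<^sup>2 = 1 \<and> qconj (c t) * b t = qconj (b t) * c t"
    by (rule AE_ivl_open)
  show "\<forall>k. (\<Sum>n. qconj (a (n + k)) * a n) = (if k = 0 then 1 else 0)"
  proof
    fix k
    have "pi *\<^sub>R (\<Sum>n. qconj (a (n + k)) * a n) = integral\<^sup>L (ivl 0 pi) (\<lambda>t. cos (real k * t) *\<^sub>R (1::quat))"
      unfolding integral_half_mean[symmetric]
    proof (rule integral_cong_AE)
      show "(\<lambda>t. cos (real k * t) *\<^sub>R U t + sin (real k * t) *\<^sub>R V t) \<in> borel_measurable (ivl 0 pi)"
        "(\<lambda>t. cos (real k * t) *\<^sub>R (1::quat)) \<in> borel_measurable (ivl 0 pi)"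
        by (intro measurable_restrict_space1, measurable)+
      show "AE t in ivl 0 pi. cos (real k * t) *\<^sub>R U t + sin (real k * t) *\<^sub>R V t = cos (real k * t) *\<^sub>R 1"
        using UV by eventually_elim (simp only: U_def V_def of_real_1 diff_self scaleR_zero_right add_0_right)
    qed
    also have "\<dots> = pi *\<^sub>R (if k = 0 then 1 else 0)" by (simp only: integral_cos_one) simp
    finally show "(\<Sum>n. qconj (a (n + k)) * a n) = (if k = 0 then 1 else 0)"
      by (rule real_vector.scale_left_imp_eq[rotated]) simp
  qed
qed

end


section \<open>Contractivity of isometric multipliers\<close>

lemma sums_shift_orthonormal:
  assumes a: "summable (\<lambda>n. (norm (a n))\<^sup>2)"
    and orth: "\<And>k. (\<Sum>n. qconj (a (n + k)) * a n) = (if k = 0 then 1 else 0)"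
  shows "(\<lambda>n. qconj (shift_seq j a n) * shift_seq k a n) sums (if j = k then 1 else 0)"
proof -
  have sm: "summable (\<lambda>n. qconj (a (n + m)) * a n)" for m
  proof (rule summable_norm_cancel)
    have "summable (\<lambda>n. \<bar>norm (a (n + m)) * norm (a n)\<bar>)"
      by (rule summable_mult_square[OF _ a]) (use a in \<open>simp add: summable_iff_shift[of "\<lambda>n. (norm (a n))\<^sup>2" m]\<close>)
    then show "summable (\<lambda>n. norm (qconj (a (n + m)) * a n))" by (simp add: norm_mult)
  qed
  have le: "(\<lambda>n. qconj (shift_seq j a n) * shift_seq (j + m) a n) sums (if m = 0 then 1 else 0)" for j m
  proof -
    have "(\<lambda>n. qconj (a (n + m)) * a n) sums (if m = 0 then 1 else 0)"
      using summable_sums[OF sm[of m]] unfolding orth .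
    then have "(\<lambda>n. qconj (shift_seq j a (n + (j + m))) * a n) sums (if m = 0 then 1 else 0)"
      by (simp add: shift_seq_def add.assoc add.commute[of j])
    then show ?thesis
      by (subst sums_shift_seq[where h = "\<lambda>n x. qconj (shift_seq j a n) * x"]) simp_all
  qed
  show ?thesis
  proof (cases "j \<le> k")
    case True
    then show ?thesis using le[of j "k - j"] by (cases "j = k") simp_all
  next
    case False
    then have "(\<lambda>n. qconj (shift_seq k a n) * shift_seq j a n) sums 0"
      using le[of k "j - k"] by simp
    from bounded_linear.sums[OF bounded_linear_qconj this] False show ?thesis
      by (simp add: qconj_mult)
  qed
qed

text \<open>
  If the shifts of \<open>a\<close> are orthonormal, then \<open>g \<mapsto> f \<star> g\<close> preserves the norm of the coefficients.
  Evaluate \<open>f \<star> g\<close> at \<open>w\<close>, with the polynomial \<open>g\<close> whose coefficients are the conjugates of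
  \<open>w\<^sup>k * f w\<close>, and let the degree of \<open>g\<close> tend to infinity.
\<close>

lemma norm_le_1_if_orthonormal:
  assumes coeffs: "has_slice_coeffs f a" and a: "summable (\<lambda>n. (norm (a n))\<^sup>2)"
    and orth: "\<And>k. (\<Sum>n. qconj (a (n + k)) * a n) = (if k = 0 then 1 else 0)"
    and w: "w \<in> ball 0 1"
  shows "norm (f w) \<le> 1"
proof -
  define K where "K = 1 / (1 - (norm w)\<^sup>2)"
  have w1: "(norm w)\<^sup>2 < 1" using w by (simp add: abs_square_less_1)
  have K: "0 < K" using w1 by (simp add: K_def)
  have geo: "(\<lambda>n. ((norm w)\<^sup>2) ^ n) sums K"
    unfolding K_def by (rule geometric_sums) (use w1 in simp)
  have T_le: "(\<Sum>k<N. (norm (w ^ k * f w))\<^sup>2) \<le> K" for N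
  proof -
    define c where "c = (\<lambda>k. qconj (w ^ k * f w))"
    define e where "e = (\<lambda>n. \<Sum>k<N. shift_seq k a n * c k)"
    define T where "T = (\<Sum>k<N. (norm (w ^ k * f w))\<^sup>2)"
    have fw: "(\<lambda>n. w ^ n * a n) sums f w" using coeffs w by (simp add: has_slice_coeffs_def)
    have "(\<lambda>n. w ^ n * shift_seq k a n) sums (w ^ k * f w)" for k
    proof -
      have "(\<lambda>n. w ^ (n + k) * a n) sums (w ^ k * f w)"
        using sums_mult[OF fw, of "w ^ k"]
        by (simp only: mult.assoc[symmetric] power_add[symmetric] add.commute)
      then show ?thesis by (subst sums_shift_seq[where h = "\<lambda>n x. w ^ n * x"]) simp_all
    qed
    then have "(\<lambda>n. \<Sum>k<N. w ^ n * shift_seq k a n * c k) sums (\<Sum>k<N. w ^ k * f w * c k)"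
      by (intro sums_sum sums_mult2)
    then have point: "(\<lambda>n. w ^ n * e n) sums of_real T"
      by (simp only: e_def sum_distrib_left mult.assoc[symmetric] c_def qconj_mult_self T_def of_real_sum)
    have "(\<lambda>n. \<Sum>j<N. \<Sum>k<N. qconj (c j) * (qconj (shift_seq j a n) * shift_seq k a n) * c k)
        sums (\<Sum>j<N. \<Sum>k<N. qconj (c j) * (if j = k then 1 else 0) * c k)"
      by (intro sums_sum sums_mult2 sums_mult sums_shift_orthonormal[OF a orth])
    moreover have "(\<Sum>j<N. \<Sum>k<N. qconj (c j) * (qconj (shift_seq j a n) * shift_seq k a n) * c k) = of_real ((norm (e n))\<^sup>2)" for n
    proof -
      have "qconj (e n) = (\<Sum>j<N. qconj (c j) * qconj (shift_seq j a n))"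
        unfolding e_def by (subst linear_sum[OF bounded_linear.linear[OF bounded_linear_qconj]]) (simp add: qconj_mult)
      then show ?thesis unfolding qconj_mult_self(1)[symmetric] e_def
        by (simp only: sum_product mult.assoc)
    qed
    moreover have "(\<Sum>j<N. \<Sum>k<N. qconj (c j) * (if j = k then 1 else 0) * c k) = of_real T"
    proof -
      have "(\<Sum>k<N. qconj (c j) * (if j = k then 1 else 0) * c k) = qconj (c j) * c j" if "j < N" for j
      proof -
        have "(\<Sum>k<N. qconj (c j) * (if j = k then 1 else 0) * c k) = (\<Sum>k<N. if j = k then qconj (c j) * c k else 0)"
          by (rule sum.cong) auto
        then show ?thesis using that by simp
      qed
      then show ?thesis unfolding T_def of_real_sum
        by (intro sum.cong refl) (simp only: qconj_mult_self c_def norm_qconj lessThan_iff)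
    qed
    ultimately have "(\<lambda>n. of_real ((norm (e n))\<^sup>2) :: quat) sums of_real T" by (simp only:)
    then have sq: "(\<lambda>n. (norm (e n))\<^sup>2) sums T" by (simp only: sums_of_real_iff)
    \<comment> \<open>the arithmetic-geometric mean inequality bounds \<open>T\<close> by \<open>(K + T) / 2\<close>, so \<open>T \<le> K\<close>\<close>
    have half: "(\<lambda>n. (((norm w)\<^sup>2) ^ n + (norm (e n))\<^sup>2) / 2) sums ((K + T) / 2)"
      by (intro sums_divide sums_add geo sq)
    have bd: "norm (w ^ n * e n) \<le> (((norm w)\<^sup>2) ^ n + (norm (e n))\<^sup>2) / 2" for n
      using zero_le_power2[of "norm w ^ n - norm (e n)"]
      by (simp add: norm_mult norm_power power2_diff power_mult[symmetric] mult.commute)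
    have sm: "summable (\<lambda>n. norm (w ^ n * e n))"
    proof (rule summable_comparison_test'[OF sums_summable[OF half]])
      show "norm (norm (w ^ n * e n)) \<le> (((norm w)\<^sup>2) ^ n + (norm (e n))\<^sup>2) / 2" for n
        unfolding real_norm_def abs_norm_cancel by (rule bd)
    qed
    have T0: "0 \<le> T" by (simp add: T_def sum_nonneg)
    have "T = norm (\<Sum>n. w ^ n * e n)" using sums_unique[OF point, symmetric] T0 by simp
    also have "\<dots> \<le> (\<Sum>n. norm (w ^ n * e n))"
      by (rule summable_norm[OF sm])
    also have "\<dots> \<le> (\<Sum>n. (((norm w)\<^sup>2) ^ n + (norm (e n))\<^sup>2) / 2)"
      by (intro suminf_le bd sm sums_summable[OF half])
    also have "\<dots> = (K + T) / 2" using sums_unique[OF half] by simp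
    finally show ?thesis unfolding T_def[symmetric] by simp
  qed
  have "(\<lambda>k. ((norm w)\<^sup>2) ^ k * (norm (f w))\<^sup>2) sums (K * (norm (f w))\<^sup>2)"
    by (intro sums_mult2 geo)
  moreover have "((norm w)\<^sup>2) ^ k * (norm (f w))\<^sup>2 = (norm (w ^ k * f w))\<^sup>2" for k
    by (simp add: norm_mult norm_power power_mult_distrib power_mult[symmetric] mult.commute)
  ultimately have "(\<lambda>N. \<Sum>k<N. (norm (w ^ k * f w))\<^sup>2) \<longlonglongrightarrow> K * (norm (f w))\<^sup>2"
    by (simp only: sums_def)
  then have "K * (norm (f w))\<^sup>2 \<le> K" by (rule LIMSEQ_le_const2) (use T_le in blast)
  then have "(norm (f w))\<^sup>2 \<le> 1" using K by simp
  then show ?thesis by (simp add: power2_le_iff_abs_le abs_square_le_1)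
qed


section \<open>Boundary values\<close>

lemma eventually_at_left_1: "eventually (\<lambda>r. 0 < r \<and> r < 1) (at_left (1::real))"
  by (auto simp: eventually_at_left_field intro!: exI[of _ 0])

lemma slice_value:
  assumes coeffs: "has_slice_coeffs f a" and a: "summable (\<lambda>n. (norm (a n))\<^sup>2)"
    and r: "0 \<le> r" "r < 1" and J: "J \<in> imag_units"
  shows "f (r *\<^sub>R unit_exp J t) = cos_part a r t + J * sin_part a r t"
proof -
  have "r *\<^sub>R unit_exp J t \<in> ball 0 1" using r by (simp add: norm_unit_exp[OF J])
  then have "(\<lambda>n. (r *\<^sub>R unit_exp J t) ^ n * a n) sums f (r *\<^sub>R unit_exp J t)"
    by (rule bspec[OF coeffs[unfolded has_slice_coeffs_def]])
  moreover have "(r *\<^sub>R unit_exp J t) ^ n * a n = unit_exp J (real n * t) * (r ^ n *\<^sub>R a n)" for n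
    by (simp add: scaleR_power unit_exp_power[OF J])
  ultimately show ?thesis
    unfolding circle_series_eq_parts[OF a r, symmetric] circle_series_def by (simp only: sums_iff)
qed

lemma radial_limit_value:
  assumes coeffs: "has_slice_coeffs f a" and a: "summable (\<lambda>n. (norm (a n))\<^sup>2)" and J: "J \<in> imag_units"
    and "((\<lambda>r. cos_part a r t) \<longlongrightarrow> x) (at_left 1)" "((\<lambda>r. sin_part a r t) \<longlongrightarrow> y) (at_left 1)"
  shows "((\<lambda>r. f (r *\<^sub>R unit_exp J t)) \<longlongrightarrow> x + J * y) (at_left 1)"
proof (rule Lim_transform_eventually)
  show "((\<lambda>r. cos_part a r t + J * sin_part a r t) \<longlongrightarrow> x + J * y) (at_left 1)"
    by (intro tendsto_intros assms)
  show "eventually (\<lambda>r. cos_part a r t + J * sin_part a r t = f (r *\<^sub>R unit_exp J t)) (at_left 1)"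
    using eventually_at_left_1 by eventually_elim (simp only: slice_value[OF coeffs a _ _ J] less_imp_le)
qed

lemma boundary_value_eqI:
  "((\<lambda>r. f (r *\<^sub>R q)) \<longlongrightarrow> L) (at_left 1) \<Longrightarrow> boundary_value f q = L"
  unfolding boundary_value_def by (rule tendsto_Lim[OF trivial_limit_at_left_real])

text \<open>The \<open>\<star>\<close>-product with a power of \<open>q\<close> is the pointwise product, since \<open>q\<^sup>k\<close> has real coefficients.\<close>

lemma
  assumes coeffs: "has_slice_coeffs f a"
  shows has_slice_coeffs_power_star: "has_slice_coeffs ((\<lambda>q. q ^ k) \<star> f) (shift_seq k a)"
    and power_star_eq: "q \<in> ball 0 1 \<Longrightarrow> ((\<lambda>q. q ^ k) \<star> f) q = q ^ k * f q"
proof -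
  have "has_slice_coeffs (\<lambda>q. q ^ k) (\<lambda>n. if n = k then 1 else 0)"
    unfolding has_slice_coeffs_def
  proof
    fix q :: quat
    have "(\<lambda>n. if n = k then q ^ n else 0) sums (q ^ k)" by (rule sums_single)
    then show "(\<lambda>n. q ^ n * (if n = k then 1 else 0)) sums (q ^ k)"
      by (simp add: if_distrib[where f = "\<lambda>x. _ * x"] cong: if_cong)
  qed
  then have mono: "slice_coeff (\<lambda>q. q ^ k) = (\<lambda>n. if n = k then 1 else 0)" by (rule slice_coeff_eq)
  have conv: "(\<Sum>j\<le>n. slice_coeff (\<lambda>q. q ^ k) j * slice_coeff f (n - j)) = shift_seq k a n" for n
  proof -
    have "(\<Sum>j\<le>n. slice_coeff (\<lambda>q. q ^ k) j * slice_coeff f (n - j)) = (\<Sum>j\<le>n. if j = k then a (n - j) else 0)"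
      unfolding mono slice_coeff_eq[OF coeffs] by (rule sum.cong) auto
    then show ?thesis by (auto simp: shift_seq_def)
  qed
  have sums: "(\<lambda>n. q ^ n * shift_seq k a n) sums (q ^ k * f q)" if "q \<in> ball 0 1" for q
  proof -
    have "(\<lambda>n. q ^ n * a n) sums f q" using coeffs that by (simp add: has_slice_coeffs_def)
    then have "(\<lambda>n. q ^ k * (q ^ n * a n)) sums (q ^ k * f q)" by (rule sums_mult)
    then have "(\<lambda>n. q ^ (n + k) * a n) sums (q ^ k * f q)"
      by (simp only: mult.assoc[symmetric] power_add[symmetric] add.commute)
    then show ?thesis by (subst sums_shift_seq[where h = "\<lambda>n x. q ^ n * x"]) simp_all
  qed
  show eq: "((\<lambda>q. q ^ k) \<star> f) q = q ^ k * f q" if "q \<in> ball 0 1" for q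
    using sums_unique[OF sums[OF that]] by (simp add: star_prod_def conv)
  show "has_slice_coeffs ((\<lambda>q. q ^ k) \<star> f) (shift_seq k a)"
    unfolding has_slice_coeffs_def by (simp add: eq sums)
qed

lemma hardy_inner_power_star:
  assumes coeffs: "has_slice_coeffs f a" and a: "summable (\<lambda>n. (norm (a n))\<^sup>2)"
  shows "hardy_inner ((\<lambda>q. q ^ k) \<star> f) f = (\<Sum>n. qconj (a (n + k)) * a n)"
proof -
  have "summable (\<lambda>n. \<bar>norm (a (n + k)) * norm (a n)\<bar>)"
    by (rule summable_mult_square[OF _ a]) (use a in \<open>simp add: summable_iff_shift[of "\<lambda>n. (norm (a n))\<^sup>2" k]\<close>)
  then have "summable (\<lambda>n. qconj (a (n + k)) * a n)"
    by (intro summable_norm_cancel[of "\<lambda>n. qconj (a (n + k)) * a n"]) (simp add: norm_mult)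
  then have "(\<lambda>n. qconj (a (n + k)) * a n) sums (\<Sum>n. qconj (a (n + k)) * a n)" by (rule summable_sums)
  then have "(\<lambda>n. qconj (a n) * shift_seq k a n) sums (\<Sum>n. qconj (a (n + k)) * a n)"
    by (subst sums_shift_seq[where h = "\<lambda>n x. qconj (a n) * x"]) simp_all
  then show ?thesis
    unfolding hardy_inner_def slice_coeff_eq[OF has_slice_coeffs_power_star[OF coeffs]] slice_coeff_eq[OF coeffs]
    by (rule sums_unique[symmetric])
qed

text \<open>No measurability of \<open>h\<close> is assumed: it follows from completeness of the Lebesgue measure.\<close>

lemma set_lebesgue_integral_cong_AE_ivl:
  fixes g h :: "real \<Rightarrow> 'a::euclidean_space"
  assumes g: "integrable (ivl x y) g" and eq: "AE t in lborel. t \<in> {x<..<y} \<longrightarrow> h t = g t"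
  shows "(LINT t:{x..y}|lebesgue. h t) = integral\<^sup>L (ivl x y) g"
proof -
  have int: "integrable lborel (\<lambda>t. indicator {x..y} t *\<^sub>R g t)"
    using g by (simp add: integrable_restrict_space)
  then have leb: "set_integrable lebesgue {x..y} g"
    unfolding set_integrable_def by (subst integrable_completion) (rule borel_measurable_integrable, assumption)
  have "AE t in lborel. t \<in> {x..y} \<longrightarrow> h t = g t"
    using eq AE_lborel_singleton[of x] AE_lborel_singleton[of y] by eventually_elim auto
  then obtain N where N: "\<And>t. t \<in> {x..y} - N \<Longrightarrow> h t = g t" "N \<in> null_sets lborel"
    by (elim AE_E3) auto
  have neg: "negligible N" using N(2) by (simp add: negligible_iff_null_sets null_sets_completionI)
  have "set_integrable lebesgue {x..y} h" by (rule absolutely_integrable_spike[OF leb neg N(1)])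
  then have "(LINT t:{x..y}|lebesgue. h t) = integral {x..y} h"
    by (rule set_lebesgue_integral_eq_integral)
  also have "\<dots> = integral {x..y} g" by (rule integral_spike[OF neg]) (simp add: N(1))
  also have "\<dots> = (LINT t:{x..y}|lborel. g t)"
    using int by (intro set_borel_integral_eq_integral(2)[symmetric]) (simp add: set_integrable_def)
  finally show ?thesis by (simp add: integral_restrict_space set_lebesgue_integral_def)
qed

lemma (in boundary_parts) slice_inner_power_star:
  assumes coeffs: "has_slice_coeffs f a" and I: "I \<in> imag_units"
  shows "slice_inner I ((\<lambda>q. q ^ k) \<star> f) f = (\<Sum>n. qconj (a (n + k)) * a n)"
proof -
  let ?F = "\<lambda>t. b t + I * c t"
  let ?g = "(\<lambda>q. q ^ k) \<star> f"
  have "AE t in lborel. t \<in> {0<..<2 * pi} \<longrightarrow>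
      qconj (boundary_value f (unit_exp I t)) * boundary_value ?g (unit_exp I t) = qconj (?F t) * unit_exp I (real k * t) * ?F t"
    using limits
  proof eventually_elim
    case (elim t)
    show ?case
    proof
      assume "t \<in> {0<..<2 * pi}"
      with elim have lim: "((\<lambda>r. f (r *\<^sub>R unit_exp I t)) \<longlongrightarrow> ?F t) (at_left 1)"
        by (intro radial_limit_value[OF coeffs a I]) simp_all
      have "((\<lambda>r::real. (r *\<^sub>R unit_exp I t) ^ k * f (r *\<^sub>R unit_exp I t)) \<longlongrightarrow> (1 *\<^sub>R unit_exp I t) ^ k * ?F t) (at_left 1)"
        by (intro tendsto_intros lim)
      then have "((\<lambda>r. ?g (r *\<^sub>R unit_exp I t)) \<longlongrightarrow> (1 *\<^sub>R unit_exp I t) ^ k * ?F t) (at_left 1)"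
      proof (rule Lim_transform_eventually)
        show "eventually (\<lambda>r. (r *\<^sub>R unit_exp I t) ^ k * f (r *\<^sub>R unit_exp I t) = ?g (r *\<^sub>R unit_exp I t)) (at_left 1)"
          using eventually_at_left_1
        proof eventually_elim
          case (elim r)
          then have "r *\<^sub>R unit_exp I t \<in> ball 0 1" by (simp add: norm_unit_exp[OF I])
          then show ?case by (rule power_star_eq[OF coeffs, symmetric])
        qed
      qed
      then have "boundary_value ?g (unit_exp I t) = unit_exp I (real k * t) * ?F t"
        by (simp add: boundary_value_eqI unit_exp_power[OF I])
      then show "qconj (boundary_value f (unit_exp I t)) * boundary_value ?g (unit_exp I t) = qconj (?F t) * unit_exp I (real k * t) * ?F t"
        by (simp only: boundary_value_eqI[OF lim] mult.assoc)
    qed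
  qed
  then have "(LINT t:{0..2 * pi}|lebesgue. qconj (boundary_value f (unit_exp I t)) * boundary_value ?g (unit_exp I t))
      = (2 * pi) *\<^sub>R (\<Sum>n. qconj (a (n + k)) * a n)"
    unfolding slice_sandwich(2)[OF I, symmetric] by (rule set_lebesgue_integral_cong_AE_ivl[OF slice_sandwich(1)[OF I]])
  then show ?thesis unfolding slice_inner_def by simp
qed


section \<open>Almost every point of the boundary\<close>

lemma AE_scale_measure_iff:
  assumes "0 < r"
  shows "(AE x in scale_measure (ennreal r) M. P x) \<longleftrightarrow> (AE x in M. P x)"
proof -
  have "null_sets (scale_measure (ennreal r) M) = null_sets M"
    using assms by (auto simp: null_sets_def)
  then show ?thesis by (simp add: eventually_ae_filter sets_eq_imp_space_eq[OF sets_scale_measure])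
qed

lemma (in pair_sigma_finite) AE_pair_fst:
  assumes "AE x in M1. P x" shows "AE z in M1 \<Otimes>\<^sub>M M2. P (fst z)"
proof -
  obtain N where N: "\<And>x. x \<in> space M1 - N \<Longrightarrow> P x" "N \<in> null_sets M1" using AE_E3[OF assms] by blast
  show ?thesis
  proof (rule AE_I')
    show "N \<times> space M2 \<in> null_sets (M1 \<Otimes>\<^sub>M M2)" by (rule M2.times_in_null_sets1) (simp_all add: N)
    have "x \<in> N" if "x \<in> space M1" "\<not> P x" for x using N(1)[of x] that by blast
    then show "{z \<in> space (M1 \<Otimes>\<^sub>M M2). \<not> P (fst z)} \<subseteq> N \<times> space M2"
      by (auto simp: space_pair_measure)
  qed
qed

lemma (in pair_sigma_finite) AE_pair_snd:
  assumes "AE y in M2. P y" shows "AE z in M1 \<Otimes>\<^sub>M M2. P (snd z)"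
proof -
  obtain N where N: "\<And>x. x \<in> space M2 - N \<Longrightarrow> P x" "N \<in> null_sets M2" using AE_E3[OF assms] by blast
  show ?thesis
  proof (rule AE_I')
    show "space M1 \<times> N \<in> null_sets (M1 \<Otimes>\<^sub>M M2)" by (rule M2.times_in_null_sets2) (simp_all add: N)
    have "x \<in> N" if "x \<in> space M2" "\<not> P x" for x using N(1)[of x] that by blast
    then show "{z \<in> space (M1 \<Otimes>\<^sub>M M2). \<not> P (snd z)} \<subseteq> space M1 \<times> N"
      by (auto simp: space_pair_measure)
  qed
qed

lemma sphere_coords_borel: "sphere_coords \<in> borel_measurable borel"
  using measurable_sphere_coords by (simp add: borel_prod)

lemma AE_sphere_area_imag_units: "AE J in sphere_area. J \<in> imag_units"
proof -
  have closed: "closed imag_units"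
    unfolding imag_units_def by (intro closed_Collect_eq continuous_intros)
  have "sphere_coords \<in> density (restrict_space lborel ({0..pi} \<times> {0..<2 * pi})) (\<lambda>(\<phi>, \<theta>). ennreal (sin \<phi>)) \<rightarrow>\<^sub>M borel"
    using measurable_restrict_space1[OF sphere_coords_borel, of "{0..pi} \<times> {0..<2 * pi}"]
    by (simp add: measurable_cong_sets[OF sets_density refl] cong: measurable_cong_sets)
  then show ?thesis unfolding sphere_area_def
    by (subst AE_distr_iff) (use closed in \<open>simp_all add: sphere_coords_in_imag_units\<close>)
qed

text \<open>
  The area measure charges every neighbourhood of a point with interior spherical coordinates, so a
  continuous function that vanishes almost everywhere vanishes there.
\<close>

lemma AE_sphere_area_continuous:
  fixes h :: "quat \<Rightarrow> 'a::{t2_space, real_normed_vector}"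
  assumes ae: "AE J in sphere_area. h J = 0" and h: "continuous_on UNIV h"
    and p: "\<phi> \<in> {0<..<pi}" "\<theta> \<in> {0<..<2 * pi}"
  shows "h (sphere_coords (\<phi>, \<theta>)) = 0"
proof -
  let ?R = "{0..pi} \<times> {0..<2 * pi}"
  let ?O = "{0<..<pi} \<times> {0<..<2 * pi}"
  have R: "?R \<inter> space lborel \<in> sets lborel" by (simp add: borel_Times)
  have meas: "sphere_coords \<in> density (restrict_space lborel ?R) (\<lambda>(\<phi>, \<theta>). ennreal (sin \<phi>)) \<rightarrow>\<^sub>M borel"
    using measurable_restrict_space1[OF sphere_coords_borel, of ?R]
    by (simp add: measurable_cong_sets[OF sets_density refl] cong: measurable_cong_sets)
  have "(\<lambda>p. ennreal (sin (fst p))) \<in> borel_measurable (borel \<Otimes>\<^sub>M (borel :: real measure))"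
    by measurable
  then have dens: "(\<lambda>(\<phi>, \<theta>). ennreal (sin \<phi>)) \<in> borel_measurable (restrict_space lborel ?R)"
    by (intro measurable_restrict_space1) (simp add: borel_prod split_beta)
  have "AE p in density (restrict_space lborel ?R) (\<lambda>(\<phi>, \<theta>). ennreal (sin \<phi>)). h (sphere_coords p) = 0"
    using ae unfolding sphere_area_def by (rule AE_distrD[OF meas])
  then have "AE p in lborel. p \<in> ?R \<longrightarrow> 0 < (case p of (\<phi>, \<theta>) \<Rightarrow> ennreal (sin \<phi>)) \<longrightarrow> h (sphere_coords p) = 0"
    unfolding AE_density[OF dens] AE_restrict_space_iff[OF R] .
  then have "AE p in lborel. p \<in> ?O \<longrightarrow> h (sphere_coords p) = 0"
  proof eventually_elim
    case (elim p)
    then show ?case by (auto simp: sin_gt_zero)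
  qed
  then obtain N where N: "\<And>p. p \<in> ?O - N \<Longrightarrow> h (sphere_coords p) = 0" "N \<in> null_sets lborel"
    by (elim AE_E3) auto
  define B where "B = {p \<in> ?O. h (sphere_coords p) \<noteq> 0}"
  have coords: "sphere_coords = (\<lambda>p. sin (fst p) *\<^sub>R (cos (snd p) *\<^sub>R Quat 0 1 0 0 + sin (snd p) *\<^sub>R Quat 0 0 1 0)
      + cos (fst p) *\<^sub>R Quat 0 0 0 1)"
    by (rule ext) (simp add: sphere_coords_def split_beta quat_eq_iff)
  have "continuous_on UNIV sphere_coords" unfolding coords by (intro continuous_intros)
  then have "continuous_on UNIV (\<lambda>p. h (sphere_coords p))"
    by (rule continuous_on_compose2[OF h]) simp
  then have "open (?O \<inter> (\<lambda>p. h (sphere_coords p)) -` (- {0}))"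
    by (intro continuous_on_open_vimage[THEN iffD1, rule_format] open_Int open_Times open_vimage) auto
  moreover have "?O \<inter> (\<lambda>p. h (sphere_coords p)) -` (- {0}) = B" by (auto simp: B_def)
  ultimately have "open B" by simp
  moreover have "negligible B"
  proof (rule negligible_subset)
    show "negligible N" using N(2) by (simp add: negligible_iff_null_sets null_sets_completionI)
    show "B \<subseteq> N" using N(1) by (auto simp: B_def)
  qed
  ultimately have "B = {}" using open_not_negligible by blast
  then show ?thesis using p by (auto simp: B_def)
qed

text \<open>The boundary measure is, up to a factor, the image of \<open>sphere_area \<Otimes>\<^sub>M angle_measure\<close>.\<close>

abbreviation angle_measure :: "real measure" where
  "angle_measure \<equiv> restrict_space lborel {0..<2 * pi}"

interpretation angles: pair_sigma_finite sphere_area angle_measure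
proof -
  have "finite_measure sphere_area" by standard (simp add: emeasure_sphere_area)
  moreover have "finite_measure angle_measure"
    by standard (simp add: emeasure_restrict_space)
  ultimately show "pair_sigma_finite sphere_area angle_measure"
    by (intro pair_sigma_finite.intro finite_measure.axioms(1))
qed

lemma AE_angle_measure_iff: "(AE t in angle_measure. P t) \<longleftrightarrow> (AE t in lborel. t \<in> {0<..<2 * pi} \<longrightarrow> P t)"
proof -
  have "(AE t in lborel. t \<in> {0..<2 * pi} \<longrightarrow> P t) \<longleftrightarrow> (AE t in lborel. t \<in> {0<..<2 * pi} \<longrightarrow> P t)"
  proof
    assume "AE t in lborel. t \<in> {0<..<2 * pi} \<longrightarrow> P t"
    then show "AE t in lborel. t \<in> {0..<2 * pi} \<longrightarrow> P t"
      using AE_lborel_singleton[of 0] by eventually_elim auto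
  qed (auto elim: eventually_mono)
  then show ?thesis by (simp add: AE_restrict_space_iff)
qed

lemma measurable_unit_exp_angles:
  "(\<lambda>(J, t). unit_exp J t) \<in> borel_measurable (sphere_area \<Otimes>\<^sub>M angle_measure)"
proof -
  have [measurable]: "(\<lambda>t. t) \<in> borel_measurable angle_measure"
    by (intro measurable_restrict_space1) simp
  show ?thesis unfolding unit_exp_def split_beta by measurable
qed

lemma AE_boundary_measureD:
  "AE q in boundary_measure. P q \<Longrightarrow> AE z in sphere_area \<Otimes>\<^sub>M angle_measure. P (unit_exp (fst z) (snd z))"
  unfolding boundary_measure_def
  by (subst (asm) AE_scale_measure_iff, simp) (drule AE_distrD[OF measurable_unit_exp_angles], simp add: split_beta)

lemma AE_boundary_measureI:
  assumes "{q. P q} \<in> sets borel" "AE z in sphere_area \<Otimes>\<^sub>M angle_measure. P (unit_exp (fst z) (snd z))"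
  shows "AE q in boundary_measure. P q"
  unfolding boundary_measure_def
  by (subst AE_scale_measure_iff, simp, subst AE_distr_iff[OF measurable_unit_exp_angles])
     (use assms in \<open>simp_all add: split_beta\<close>)

lemma qre_unit_exp: "J \<in> imag_units \<Longrightarrow> qre (unit_exp J t) = cos t"
  by (simp add: unit_exp_def of_real_def imag_units_iff)

text \<open>Every point of the unit sphere other than \<open>1\<close> and \<open>-1\<close> is \<open>unit_exp J t\<close> with \<open>t = arccos (qre q)\<close>.\<close>

lemma unit_exp_surj:
  assumes q: "norm q = 1" and t: "arccos (qre q) \<in> {0<..<pi}"
  shows "\<exists>J\<in>imag_units. q = unit_exp J (arccos (qre q))"
proof -
  define s where "s = sin (arccos (qre q))"
  have s: "0 < s" using t by (simp add: s_def sin_gt_zero)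
  have n: "(qre q)\<^sup>2 + ((qi q)\<^sup>2 + (qj q)\<^sup>2 + (qk q)\<^sup>2) = 1"
    using q by (simp add: norm_quat_def inner_quat_def power2_eq_square)
  have "0 \<le> (qi q)\<^sup>2 + (qj q)\<^sup>2 + (qk q)\<^sup>2" by simp
  with n have "(qre q)\<^sup>2 \<le> 1" by linarith
  then have le: "\<bar>qre q\<bar> \<le> 1" by (simp add: abs_square_le_1)
  then have c: "cos (arccos (qre q)) = qre q" by (rule cos_arccos_abs)
  have s2: "s\<^sup>2 = (qi q)\<^sup>2 + (qj q)\<^sup>2 + (qk q)\<^sup>2"
    using sin_cos_squared_add[of "arccos (qre q)"] n unfolding c s_def by linarith
  define J where "J = (1 / s) *\<^sub>R (q - of_real (qre q))"
  have "inner J J = ((qi q)\<^sup>2 + (qj q)\<^sup>2 + (qk q)\<^sup>2) / s\<^sup>2"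
    by (simp add: J_def inner_quat_def of_real_def power2_eq_square add_divide_distrib)
  also have "\<dots> = 1" unfolding s2[symmetric] using s by simp
  finally have "norm J = 1" by (simp only: norm_eq_1)
  moreover have "qre J = 0" by (simp add: J_def of_real_def)
  ultimately have "J \<in> imag_units" by (simp add: imag_units_iff)
  moreover have "q = unit_exp J (arccos (qre q))"
    unfolding unit_exp_def c s_def[symmetric] using s by (simp add: J_def of_real_def)
  ultimately show ?thesis by blast
qed

lemma cos_eq_arccos_reflect:
  assumes "t \<in> {0<..<2 * pi}"
  shows "arccos (cos t) = (if t \<le> pi then t else 2 * pi - t)"
proof (cases "t \<le> pi")
  case True
  then show ?thesis using assms by (simp add: arccos_cos)
next
  case False
  have "arccos (cos (2 * pi - t)) = 2 * pi - t" using assms False by (intro arccos_cos) auto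
  then show ?thesis using False by (simp add: cos_diff)
qed

context boundary_parts
begin

lemma AE_boundary_value_parts:
  assumes coeffs: "has_slice_coeffs f a"
  shows "AE t in lborel. t \<in> {0<..<2 * pi} \<longrightarrow> (\<forall>J\<in>imag_units. boundary_value f (unit_exp J t) = b t + J * c t)"
  using limits
proof eventually_elim
  case (elim t)
  then show ?case
    by (intro impI ballI boundary_value_eqI radial_limit_value[OF coeffs a]) simp_all
qed

text \<open>
  By Fubini's theorem, almost every sphere meets the set where \<open>f\<close> is unimodular in a set of full
  area; on such a sphere \<open>J \<mapsto> norm (b t + J * c t)\<close> is continuous, hence constantly 1.
\<close>

lemma unimodular_parts_if_boundary:
  assumes coeffs: "has_slice_coeffs f a" and ae: "AE q in boundary_measure. norm (boundary_value f q) = 1"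
  shows "AE t in lborel. t \<in> {0<..<pi} \<longrightarrow> (norm (b t))\<^sup>2 + (norm (c t))\<^sup>2 = 1 \<and> qconj (c t) * b t = qconj (b t) * c t"
proof -
  have "AE z in sphere_area \<Otimes>\<^sub>M angle_measure. norm (boundary_value f (unit_exp (fst z) (snd z))) = 1"
    by (rule AE_boundary_measureD[OF ae])
  moreover have "AE z in sphere_area \<Otimes>\<^sub>M angle_measure. fst z \<in> imag_units"
    by (rule angles.AE_pair_fst[OF AE_sphere_area_imag_units])
  moreover have "AE z in sphere_area \<Otimes>\<^sub>M angle_measure. \<forall>J\<in>imag_units. boundary_value f (unit_exp J (snd z)) = b (snd z) + J * c (snd z)"
    by (rule angles.AE_pair_snd, subst AE_angle_measure_iff, rule AE_boundary_value_parts[OF coeffs])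
  ultimately have "AE z in sphere_area \<Otimes>\<^sub>M angle_measure. norm (b (snd z) + fst z * c (snd z)) = 1"
    by eventually_elim simp
  from angles.AE_pair[OF this]
  have pair: "AE J in sphere_area. AE t in angle_measure. norm (b t + J * c t) = 1" by simp
  have [measurable]: "(\<lambda>t. t) \<in> borel_measurable angle_measure"
    by (intro measurable_restrict_space1) simp
  have [measurable]: "b \<in> borel_measurable angle_measure" "c \<in> borel_measurable angle_measure"
    by (intro measurable_restrict_space1, simp)+
  have "{z \<in> space (sphere_area \<Otimes>\<^sub>M angle_measure). norm (b (snd z) + fst z * c (snd z)) = 1} \<in> sets (sphere_area \<Otimes>\<^sub>M angle_measure)"
    by measurable
  from angles.AE_commute[OF this] pair
  have "AE t in angle_measure. AE J in sphere_area. norm (b t + J * c t) = 1" by blast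
  then have "AE t in lborel. t \<in> {0<..<2 * pi} \<longrightarrow> (AE J in sphere_area. norm (b t + J * c t) = 1)"
    by (simp only: AE_angle_measure_iff)
  then show ?thesis
  proof eventually_elim
    case (elim t)
    show ?case
    proof
      assume "t \<in> {0<..<pi}"
      with elim have "AE J in sphere_area. norm (b t + J * c t) = 1" by simp
      then have ae: "AE J in sphere_area. norm (b t + J * c t) - 1 = 0" by simp
      have cont: "continuous_on UNIV (\<lambda>J. norm (b t + J * c t) - 1)" by (intro continuous_intros)
      have on: "norm (b t + sphere_coords (\<phi>, \<theta>) * c t) = 1" if "\<phi> \<in> {0<..<pi}" "\<theta> \<in> {0<..<2 * pi}" for \<phi> \<theta>
        using AE_sphere_area_continuous[OF ae cont that] by simp
      \<comment> \<open>four imaginary units whose spherical coordinates lie in the open rectangle\<close>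
      have "3 * pi / 2 = 3 / 2 * pi" by simp
      then have "cos (3 * pi / 2) = 0" "sin (3 * pi / 2) = - 1"
        by (simp_all only: cos_3over2_pi sin_3over2_pi)
      then have "sphere_coords (pi / 2, pi / 2) = Quat 0 0 1 0"
        "sphere_coords (pi / 2, 3 / 2 * pi) = Quat 0 0 (-1) 0"
        "sphere_coords (pi / 2, pi) = Quat 0 (-1) 0 0"
        "sphere_coords (pi / 4, pi / 2) = Quat 0 0 (1 / sqrt 2) (1 / sqrt 2)"
        by (simp_all add: sphere_coords_def sin_45 cos_45 real_div_sqrt)
      with on[of "pi / 2" "pi / 2"] on[of "pi / 2" "3 / 2 * pi"] on[of "pi / 2" pi] on[of "pi / 4" "pi / 2"]
      show "(norm (b t))\<^sup>2 + (norm (c t))\<^sup>2 = 1 \<and> qconj (c t) * b t = qconj (b t) * c t"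
        by (intro unimodular_on_sphere) simp_all
    qed
  qed
qed

text \<open>
  The image of a null set of the product need not be a Borel set. The exceptional points are therefore
  described through their angle \<open>arccos (qre q)\<close>, which is a continuous function of the point.
\<close>

lemma boundary_if_unimodular_parts:
  assumes coeffs: "has_slice_coeffs f a"
    and ae: "AE t in lborel. t \<in> {0<..<pi} \<longrightarrow> (norm (b t))\<^sup>2 + (norm (c t))\<^sup>2 = 1 \<and> qconj (c t) * b t = qconj (b t) * c t"
  shows "AE q in boundary_measure. norm (boundary_value f q) = 1"
proof -
  have "AE t in lborel. t \<in> {0<..<pi} \<longrightarrow> (\<forall>J\<in>imag_units. norm (boundary_value f (unit_exp J t)) = 1)"
    using ae AE_boundary_value_parts[OF coeffs]
  proof eventually_elim
    case (elim t)
    then show ?case using unimodular_on_sphere_converse[of "b t" "c t"] by simp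
  qed
  then obtain N where N: "\<And>t. t \<in> {0<..<pi} - N \<Longrightarrow> (\<forall>J\<in>imag_units. norm (boundary_value f (unit_exp J t)) = 1)"
      "N \<in> null_sets lborel"
    by (elim AE_E3) auto
  define E where "E = N \<union> {0, pi}"
  have Eb: "E \<in> sets borel" using N(2) by (auto simp: E_def)
  have E: "AE t in lborel. t \<notin> E"
    using AE_not_in[OF N(2)] AE_lborel_singleton[of 0] AE_lborel_singleton[of pi]
    by eventually_elim (simp add: E_def)
  \<comment> \<open>clamping the real part makes the angle continuous on all of the quaternions\<close>
  define ang where "ang = (\<lambda>q. arccos (max (- 1) (min 1 (qre q))))"
  have qre_cont: "continuous_on UNIV qre"
  proof -
    have "continuous_on UNIV (\<lambda>q::quat. inner q 1)" by (intro continuous_intros)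
    then show ?thesis by (simp add: inner_quat_def)
  qed
  have "continuous_on UNIV ang" unfolding ang_def
    by (rule continuous_on_compose2[OF continuous_on_arccos']) (auto intro!: continuous_intros qre_cont)
  then have [measurable]: "ang \<in> borel_measurable borel" by (rule borel_measurable_continuous_onI)
  have "AE q in boundary_measure. norm q = 1 \<and> ang q \<notin> E"
  proof (rule AE_boundary_measureI)
    show "{q. norm q = 1 \<and> ang q \<notin> E} \<in> sets borel"
      using Eb by measurable
    have "AE z in sphere_area \<Otimes>\<^sub>M angle_measure. fst z \<in> imag_units"
      by (rule angles.AE_pair_fst[OF AE_sphere_area_imag_units])
    moreover have "AE z in sphere_area \<Otimes>\<^sub>M angle_measure. arccos (cos (snd z)) \<notin> E"
    proof (rule angles.AE_pair_snd, subst AE_angle_measure_iff)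
      show "AE t in lborel. t \<in> {0<..<2 * pi} \<longrightarrow> arccos (cos t) \<notin> E"
        using E AE_lborel_reflect[OF E, of "2 * pi"] by eventually_elim (simp add: cos_eq_arccos_reflect)
    qed
    ultimately show "AE z in sphere_area \<Otimes>\<^sub>M angle_measure. norm (unit_exp (fst z) (snd z)) = 1 \<and> ang (unit_exp (fst z) (snd z)) \<notin> E"
      by eventually_elim (simp add: norm_unit_exp qre_unit_exp ang_def)
  qed
  then show ?thesis
  proof eventually_elim
    case (elim q)
    have "\<bar>qre q\<bar> \<le> norm q" using Cauchy_Schwarz_ineq2[of q 1] by (simp add: inner_quat_def)
    with elim have ang: "ang q = arccos (qre q)" "- 1 \<le> qre q" "qre q \<le> 1" by (auto simp: ang_def)
    then have t: "arccos (qre q) \<in> {0<..<pi} - N"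
      using elim arccos_lbound[of "qre q"] arccos_ubound[of "qre q"] by (auto simp: E_def less_le)
    then obtain J where "J \<in> imag_units" "q = unit_exp J (arccos (qre q))"
      using unit_exp_surj[of q] elim by blast
    then show ?case using N(1)[OF t] by metis
  qed
qed

end


section \<open>Inner functions and orthonormal shifts\<close>

theorem theorem3p3:
  fixes f :: "quat \<Rightarrow> quat"
  assumes "f \<in> hardy2"
  shows "(inner_function f \<longleftrightarrow>
            (\<forall>k::nat. hardy_inner ((\<lambda>q. q ^ k) \<star> f) f = (if k = 0 then 1 else 0))) \<and>
         ((\<forall>k::nat. hardy_inner ((\<lambda>q. q ^ k) \<star> f) f = (if k = 0 then 1 else 0)) \<longleftrightarrow>
            (\<exists>I\<in>imag_units. \<forall>k::nat. slice_inner I ((\<lambda>q. q ^ k) \<star> f) f = (if k = 0 then 1 else 0)))"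
proof -
  obtain a where regular: "slice_regular f" and coeffs: "has_slice_coeffs f a"
    and a: "summable (\<lambda>n. (norm (a n))\<^sup>2)"
    using assms by (auto simp: hardy2_def)
  obtain b c where bc: "b \<in> borel_measurable borel" "c \<in> borel_measurable borel"
    "AE t in lborel. t \<in> {0<..<2 * pi} \<longrightarrow>
       ((\<lambda>r. cos_part a r t) \<longlongrightarrow> b t) (at_left 1) \<and> ((\<lambda>r. sin_part a r t) \<longlongrightarrow> c t) (at_left 1)"
    by (rule AE_radial_limit_parts[OF a])
  interpret boundary_parts a b c by standard (fact a bc)+
  let ?orth = "\<forall>k. (\<Sum>n. qconj (a (n + k)) * a n) = (if k = 0 then 1 else 0)"
  have "inner_function f \<longleftrightarrow> ?orth"
  proof
    assume "inner_function f"
    then have "AE q in boundary_measure. norm (boundary_value f q) = 1" by (simp add: inner_function_def)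
    then show ?orth
      unfolding orthonormal_iff_unimodular by (rule unimodular_parts_if_boundary[OF coeffs])
  next
    assume orth: ?orth
    then have bound: "\<forall>q\<in>ball 0 1. norm (f q) \<le> 1"
      using norm_le_1_if_orthonormal[OF coeffs a orth[rule_format]] by blast
    then have "f \<in> hardy_inf" using regular by (auto simp: hardy_inf_def bounded_iff)
    moreover have "AE q in boundary_measure. norm (boundary_value f q) = 1"
      using orth unfolding orthonormal_iff_unimodular by (rule boundary_if_unimodular_parts[OF coeffs])
    ultimately show "inner_function f" using bound by (simp add: inner_function_def)
  qed
  moreover have "(\<exists>I\<in>imag_units. \<forall>k::nat. slice_inner I ((\<lambda>q. q ^ k) \<star> f) f = (if k = 0 then 1 else 0)) \<longleftrightarrow> ?orth"
  proof
    assume "\<exists>I\<in>imag_units. \<forall>k::nat. slice_inner I ((\<lambda>q. q ^ k) \<star> f) f = (if k = 0 then 1 else 0)"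
    then obtain I where I: "I \<in> imag_units" and orth: "\<forall>k::nat. slice_inner I ((\<lambda>q. q ^ k) \<star> f) f = (if k = 0 then 1 else 0)" ..
    from orth show ?orth unfolding slice_inner_power_star[OF coeffs I] .
  next
    assume ?orth
    then have "\<forall>k::nat. slice_inner (Quat 0 1 0 0) ((\<lambda>q. q ^ k) \<star> f) f = (if k = 0 then 1 else 0)"
      unfolding slice_inner_power_star[OF coeffs quat_i_imag_unit] .
    then show "\<exists>I\<in>imag_units. \<forall>k::nat. slice_inner I ((\<lambda>q. q ^ k) \<star> f) f = (if k = 0 then 1 else 0)"
      by (rule bexI) (rule quat_i_imag_unit)
  qed
  ultimately show ?thesis by (simp only: hardy_inner_power_star[OF coeffs a])
qed

end
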